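(* Let $(\Omega,\mathcal F,\mathbb P,H)$ be a Gaussian space. Then $$\mathbb D^2_\infty(\Omega)\cap L^{\infty-0}(\Omega)=\mathbb D^\infty(\Omega).$$
   Context: A Gaussian space $(\Omega,\mathcal F,\mathbb P,H)$ consists of a probability space with complete $\sigma$-algebra $\mathcal F$ and a closed subspace $H$ of $L^2(\Omega)$ consisting of centered Gaussian random variables and generating $\mathcal F$; we write $W(h)$ for the Gaussian variable associated with $h\in H$. $L$ denotes the Ornstein–Uhlenbeck operator, $Lf=-\sum_n n f_n$ where $f_n$ is the component of $f$ in the $n$-th Wiener chaos. For $p>1$, $r\ge 0$, $\mathbb D^p_r(\Omega)$ is the Sobolev–Malliavin space with norm $\|(1-L)^{r/2}f\|_{L^p}$ (equivalently $\sum_{j\le r}\|\nabla^j f\|_{L^p(\Omega,H^{\otimes j})}$ with $\nabla$ the Malliavin derivative). $\mathbb D^\infty=\bigcap_{p>1,r\in\mathbb N}\mathbb D^p_r$, $\mathbb D^2_\infty=\bigcap_{r\in\mathbb N}\mathbb D^2_r$, and $L^{\infty-0}(\Omega)=\bigcap_{1\le p<\infty}L^p(\Omega)$. *)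

theory Defs
  imports "HOL-Probability.Probability"
begin

text \<open>Random variables are real functions on the sample space; equivalence
classes modulo a.e. equality are not formed explicitly. All spaces below are
saturated under a.e. modification.\<close>

fun hermite :: "nat \<Rightarrow> real \<Rightarrow> real" where
  "hermite 0 x = 1"
| "hermite (Suc 0) x = x"
| "hermite (Suc (Suc n)) x = x * hermite (Suc n) x - real (Suc n) * hermite n x"

definition L2 :: "'a measure \<Rightarrow> ('a \<Rightarrow> real) set" where
  "L2 M = {f. f \<in> borel_measurable M \<and> integrable M (\<lambda>x. (f x)\<^sup>2)}"

definition Lp :: "'a measure \<Rightarrow> real \<Rightarrow> ('a \<Rightarrow> real) set" where
  "Lp M p = {f. f \<in> borel_measurable M \<and> integrable M (\<lambda>x. \<bar>f x\<bar> powr p)}"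

definition lincomb :: "('a \<Rightarrow> real) set \<Rightarrow> ('a \<Rightarrow> real) set" where
  "lincomb S = {(\<lambda>x. \<Sum>i<n. c i * g i x) | (n::nat) (c::nat \<Rightarrow> real) (g::nat \<Rightarrow> 'a \<Rightarrow> real). \<forall>i<n. g i \<in> S}"

definition l2_closure :: "'a measure \<Rightarrow> ('a \<Rightarrow> real) set \<Rightarrow> ('a \<Rightarrow> real) set" where
  "l2_closure M S = {g \<in> L2 M. \<exists>s. (\<forall>k. s k \<in> S) \<and>
      (\<lambda>k. integral\<^sup>L M (\<lambda>x. (g x - s k x)\<^sup>2)) \<longlonglongrightarrow> 0}"

definition centered_gaussian :: "'a measure \<Rightarrow> ('a \<Rightarrow> real) \<Rightarrow> bool" where
  "centered_gaussian M h \<longleftrightarrow> h \<in> borel_measurable M \<and>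
     (distr M borel h = return borel 0 \<or>
      (\<exists>\<sigma>>0. distributed M lborel h (normal_density 0 \<sigma>)))"

definition gaussian_space :: "'a measure \<Rightarrow> ('a \<Rightarrow> real) set \<Rightarrow> bool" where
  "gaussian_space M H \<longleftrightarrow>
     prob_space M \<and>
     (\<forall>A\<in>null_sets M. \<forall>B\<subseteq>A. B \<in> sets M) \<and>
     H \<subseteq> L2 M \<and>
     (\<lambda>x. 0) \<in> H \<and>
     (\<forall>f\<in>H. \<forall>g\<in>H. (\<lambda>x. f x + g x) \<in> H) \<and>
     (\<forall>c. \<forall>f\<in>H. (\<lambda>x. c * f x) \<in> H) \<and>
     l2_closure M H \<subseteq> H \<and>
     (\<forall>h\<in>H. centered_gaussian M h) \<and>
     (\<forall>A\<in>sets M. \<exists>B\<in>sigma_sets (space M)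
          {h -` S \<inter> space M | h S. h \<in> H \<and> S \<in> sets borel}.
          (A - B) \<union> (B - A) \<in> null_sets M)"

definition chaos :: "'a measure \<Rightarrow> ('a \<Rightarrow> real) set \<Rightarrow> nat \<Rightarrow> ('a \<Rightarrow> real) set" where
  "chaos M H n = l2_closure M
     (lincomb {(\<lambda>x. hermite n (h x)) | h. h \<in> H \<and> integral\<^sup>L M (\<lambda>x. (h x)\<^sup>2) = 1})"

definition chaos_comp :: "'a measure \<Rightarrow> ('a \<Rightarrow> real) set \<Rightarrow> nat \<Rightarrow> ('a \<Rightarrow> real) \<Rightarrow> ('a \<Rightarrow> real)" where
  "chaos_comp M H n f = (SOME g. g \<in> chaos M H n \<and>
      (\<forall>u\<in>chaos M H n. integral\<^sup>L M (\<lambda>x. (f x - g x) * u x) = 0))"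

text \<open>(1 - L)^(r/2) f = sum_n (1+n)^(r/2) f_n, as an L^2 limit.\<close>
definition ou_pow :: "'a measure \<Rightarrow> ('a \<Rightarrow> real) set \<Rightarrow> real \<Rightarrow> ('a \<Rightarrow> real) \<Rightarrow> ('a \<Rightarrow> real)" where
  "ou_pow M H r f = (SOME g. g \<in> L2 M \<and>
      (\<lambda>N. integral\<^sup>L M (\<lambda>x. (g x - (\<Sum>n<N. (1 + real n) powr (r/2) * chaos_comp M H n f x))\<^sup>2))
        \<longlonglongrightarrow> 0)"

definition poly_functionals :: "('a \<Rightarrow> real) set \<Rightarrow> ('a \<Rightarrow> real) set" where
  "poly_functionals H = lincomb {(\<lambda>x. \<Prod>i<k. h i x) | (k::nat) (h::nat \<Rightarrow> 'a \<Rightarrow> real). \<forall>i<k. h i \<in> H}"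

text \<open>Sobolev--Malliavin space D^p_r: closure (completion realised inside L^p)
of the polynomial functionals w.r.t. the norm ||(1-L)^(r/2) f||_{L^p}.\<close>
definition sobolev :: "'a measure \<Rightarrow> ('a \<Rightarrow> real) set \<Rightarrow> real \<Rightarrow> real \<Rightarrow> ('a \<Rightarrow> real) set" where
  "sobolev M H p r = {f \<in> Lp M p. \<exists>\<phi>.
      (\<forall>k. \<phi> k \<in> poly_functionals H \<and> ou_pow M H r (\<phi> k) \<in> Lp M p) \<and>
      (\<lambda>k. integral\<^sup>L M (\<lambda>x. \<bar>\<phi> k x - f x\<bar> powr p)) \<longlonglongrightarrow> 0 \<and>
      (\<forall>e>0. \<exists>N. \<forall>m\<ge>N. \<forall>n\<ge>N.
          integral\<^sup>L M (\<lambda>x. \<bar>ou_pow M H r (\<phi> m) x - ou_pow M H r (\<phi> n) x\<bar> powr p) < e)}"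

definition D_infty :: "'a measure \<Rightarrow> ('a \<Rightarrow> real) set \<Rightarrow> ('a \<Rightarrow> real) set" where
  "D_infty M H = (\<Inter>p\<in>{p. p > 1}. \<Inter>r::nat. sobolev M H p (real r))"

definition D2_infty :: "'a measure \<Rightarrow> ('a \<Rightarrow> real) set \<Rightarrow> ('a \<Rightarrow> real) set" where
  "D2_infty M H = (\<Inter>r::nat. sobolev M H 2 (real r))"

definition L_infty_minus_0 :: "'a measure \<Rightarrow> ('a \<Rightarrow> real) set" where
  "L_infty_minus_0 M = (\<Inter>p\<in>{p. 1 \<le> p}. Lp M p)"

end

theory Submission
  imports Defs "HOL-Computational_Algebra.Polynomial"
begin

text \<open>
  Only even integers \<open>p\<close> matter, since the \<open>L\<^sup>p\<close> norms increase with \<open>p\<close> up to constants. Moments of polynomials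
  in Gaussian variables depend only on the covariance, so Mehler's formula on \<open>M \<times> M\<close> shows, without any
  multivariate distribution theory, that the Ornstein--Uhlenbeck semigroup contracts every even \<open>L\<^sup>p\<close> norm on
  polynomial functionals. Averaging over time bounds the resolvents \<open>R\<^sub>X = X (X + 1 - L)\<^sup>-\<^sup>1\<close> and the negative
  powers of \<open>1 - L\<close> in \<open>L\<^sup>p\<close>.

  For \<open>f\<close> in the left-hand side put \<open>u\<^sub>j = m\<^sub>j b\<^sub>j\<close>, where the polynomials \<open>b\<^sub>j\<close> converge to \<open>f\<close> quickly in
  \<open>L\<^sup>q\<close>, \<open>q = 2p - 2\<close>, and \<open>m\<^sub>j = 1 - (1 - R\<^sub>X\<^sup>r)\<^sup>N\<close> with \<open>X = 2\<^sup>j\<close>. The difference \<open>(1 - L)\<^sup>r (u\<^sub>j\<^sub>+\<^sub>1 - u\<^sub>j)\<close> is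
  \<open>O(X\<^sup>r)\<close> in \<open>L\<^sup>q\<close> and, by smoothness of \<open>f\<close> in \<open>L\<^sup>2\<close>, \<open>O(X\<^sup>-\<^sup>N)\<close> in \<open>L\<^sup>2\<close>. Since
  \<open>E g\<^sup>p \<le> \<parallel>g\<parallel>\<^sub>2 \<parallel>g\<parallel>\<^sub>q\<^sup>p\<^sup>-\<^sup>1\<close>, it is \<open>O(1/X)\<close> in \<open>L\<^sup>p\<close> for \<open>N\<close> large, so \<open>(1 - L)\<^sup>r u\<^sub>j\<close> is Cauchy in \<open>L\<^sup>p\<close>.
\<close>

subsection \<open>Polarization and moments of polynomial expressions\<close>

text \<open>Sharp truncation of the chaos expansion is not uniformly bounded in L^p for p > 2, so a
  cut-off has to be built from averages of the semigroup, and resolvents are convenient ones. Two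
  kinds of approximants of \<open>f\<close> must cooperate: the \<open>b j\<close> are close in L^q
  with uncontrolled derivatives, while approximants \<open>a j\<close> with bounded (1 - L)^(r + N)
  are available in L^2 only. The cut-off tames the derivatives of \<open>b j\<close> at the price
  X^r, and comparison with \<open>a j\<close> supplies the decay. As E g^p is at most a constant
  times X^(-N) (X^r)^(p - 1), the choice N = r (p - 1) + p leaves exactly X^(-p). The accuracy
  X^(-(N + r + 1)) of \<open>b j\<close> outweighs the operator norm X^r. Whole powers of 1 - L suit
  resolvents; the half-integer exponents of the Sobolev norms come back at the end through the
  bounded negative powers.\<close>

lemma coeff_as_evaluations:
  fixes N k0 :: nat
  shows "\<exists>w::nat \<Rightarrow> real. \<forall>k\<le>N. (\<Sum>t\<le>N. w t * real t ^ k) = (if k = k0 then 1 else 0)"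
proof -
  \<comment> \<open>The Lagrange basis for the nodes 0, ..., N: on polynomials of degree at most N,
    the coefficient with index \<open>k0\<close> is a fixed combination of the values at these
    nodes.\<close>
  define l where "l t = (\<Prod>u\<in>{..N}-{t}. smult (1 / (real t - real u)) [:- real u, 1:])" for t
  have deg: "degree (l t) \<le> N" if "t \<le> N" for t
  proof -
    have "degree (l t) \<le> (\<Sum>u\<in>{..N}-{t}. degree (smult (1 / (real t - real u)) [:- real u, 1:]))"
      unfolding l_def by (rule order_trans[OF degree_prod_sum_le]) (auto simp: o_def)
    also have "\<dots> \<le> (\<Sum>u\<in>{..N}-{t}. 1)"
      by (intro sum_mono) (auto intro: order_trans[OF degree_smult_le])
    also have "\<dots> = N" using that by simp
    finally show ?thesis .
  qed
  have ev: "poly (l t) (real u) = (if u = t then 1 else 0)" if "t \<le> N" "u \<le> N" for t u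
  proof -
    have "poly (l t) (real u) = (\<Prod>x\<in>{..N}-{t}. (real u - real x) / (real t - real x))"
      by (simp add: l_def poly_prod diff_divide_distrib)
    also have "\<dots> = (if u = t then 1 else 0)"
      using that by (auto intro!: prod.neutral)
    finally show ?thesis .
  qed
  have interp: "monom 1 k = (\<Sum>t\<le>N. smult (real t ^ k) (l t))" if "k \<le> N" for k
  proof (rule poly_eqI_degree[of "real ` {..N}"])
    fix x assume "x \<in> real ` {..N}"
    then obtain u where u: "u \<le> N" "x = real u" by auto
    then show "poly (monom 1 k) x = poly (\<Sum>t\<le>N. smult (real t ^ k) (l t)) x"
      by (simp add: poly_monom poly_sum ev if_distrib cong: if_cong)
  next
    have c: "card (real ` {..N}) = Suc N"
      by (subst card_image) (auto simp: inj_on_def)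
    show "degree (monom (1::real) k) < card (real ` {..N})"
      using that by (simp add: c degree_monom_eq)
    have "degree (\<Sum>t\<le>N. smult (real t ^ k) (l t)) \<le> N"
      by (intro degree_sum_le) (auto intro: order_trans[OF degree_smult_le] deg)
    then show "degree (\<Sum>t\<le>N. smult (real t ^ k) (l t)) < card (real ` {..N})"
      by (simp add: c)
  qed
  show ?thesis
  proof (intro exI[of _ "\<lambda>t. coeff (l t) k0"] allI impI)
    fix k assume k: "k \<le> N"
    have "(\<Sum>t\<le>N. coeff (l t) k0 * real t ^ k) = coeff (\<Sum>t\<le>N. smult (real t ^ k) (l t)) k0"
      by (simp add: coeff_sum mult.commute)
    then show "(\<Sum>t\<le>N. coeff (l t) k0 * real t ^ k) = (if k = k0 then 1 else 0)"
      by (simp add: interp[OF k, symmetric])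
  qed
qed

text \<open>Up to the factor n + 1, y^n z is the coefficient of t in (y + t z)^(n + 1), and a
  coefficient is a combination of values at t = 0, ..., n + 1. The weights do not depend on y and
  z.\<close>

lemma power_mult_polarization:
  "\<exists>w::nat \<Rightarrow> real. \<forall>y z. y ^ n * z = (\<Sum>t\<le>Suc n. w t * (y + real t * z) ^ Suc n)"
proof -
  obtain w :: "nat \<Rightarrow> real"
    where w: "\<And>k. k \<le> Suc n \<Longrightarrow> (\<Sum>t\<le>Suc n. w t * real t ^ k) = (if k = 1 then 1 else 0)"
    using coeff_as_evaluations[of "Suc n" 1] by blast
  have "(\<Sum>t\<le>Suc n. w t / real (Suc n) * (y + real t * z) ^ Suc n) = y ^ n * z" for y z :: real
  proof -
    have "(\<Sum>t\<le>Suc n. w t * (y + real t * z) ^ Suc n)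
      = (\<Sum>t\<le>Suc n. \<Sum>k\<le>Suc n. real (Suc n choose k) * z ^ k * y ^ (Suc n - k) * (w t * real t ^ k))"
      unfolding add.commute[of y] binomial_ring
      by (simp add: sum_distrib_left power_mult_distrib mult_ac del: power_Suc sum.atMost_Suc binomial_Suc_Suc)
    also have "\<dots> = (\<Sum>k\<le>Suc n. real (Suc n choose k) * z ^ k * y ^ (Suc n - k) * (\<Sum>t\<le>Suc n. w t * real t ^ k))"
      by (subst sum.swap) (simp only: sum_distrib_left)
    also have "\<dots> = (\<Sum>k\<le>Suc n. if k = 1 then real (Suc n choose k) * z ^ k * y ^ (Suc n - k) else 0)"
      by (intro sum.cong refl) (simp only: w atMost_iff split: if_split, simp)
    also have "\<dots> = real (Suc n) * z * y ^ n"
      by (subst sum.delta) auto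
    finally have e: "(\<Sum>t\<le>Suc n. w t * (y + real t * z) ^ Suc n) = real (Suc n) * z * y ^ n" .
    have "(\<Sum>t\<le>Suc n. w t / real (Suc n) * (y + real t * z) ^ Suc n)
       = (\<Sum>t\<le>Suc n. w t * (y + real t * z) ^ Suc n) / real (Suc n)"
      by (simp only: sum_divide_distrib times_divide_eq_left)
    then show ?thesis unfolding e by simp
  qed
  then show ?thesis by metis
qed

text \<open>A k-th power of a linear form times \<open>x k\<close> is covered by
  \<open>power_mult_polarization\<close>, whence the induction. Since a linear combination of
  elements of \<open>H\<close> is again in \<open>H\<close>, the identity reduces moments of
  arbitrary products to moments of single Gaussian variables.\<close>

lemma prod_polarization:
  "\<exists>L :: (real \<times> (nat \<Rightarrow> real)) list. \<forall>x :: nat \<Rightarrow> real.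
     (\<Prod>i<k. x i) = (\<Sum>(c, t)\<leftarrow>L. c * (\<Sum>i<k. t i * x i) ^ k)"
proof (induction k)
  case 0
  show ?case by (rule exI[of _ "[(1, \<lambda>_. 0)]"]) simp
next
  case (Suc k)
  then obtain L :: "(real \<times> (nat \<Rightarrow> real)) list" where
    L: "\<forall>x. (\<Prod>i<k. x i) = (\<Sum>(c, t)\<leftarrow>L. c * (\<Sum>i<k. t i * x i) ^ k)" ..
  obtain w :: "nat \<Rightarrow> real"
    where w: "\<forall>y z. y ^ k * z = (\<Sum>s\<le>Suc k. w s * (y + real s * z) ^ Suc k)"
    using power_mult_polarization[of k] ..
  \<comment> \<open>Each form \<open>t\<close> is replaced by the k + 2 forms with last coefficient
    s = 0, ..., k + 1, the nodes of the polarization in the last variable.\<close>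
  define L' where "L' = concat (map (\<lambda>(c, t). map (\<lambda>s. (c * w s, t(k := real s))) [0..<Suc (Suc k)]) L)"
  show ?case
  proof (intro exI[of _ L'] allI)
    fix x :: "nat \<Rightarrow> real"
    have one: "(\<Sum>(c, t)\<leftarrow>map (\<lambda>s. (c * w s, t(k := real s))) [0..<Suc (Suc k)]. c * (\<Sum>i<Suc k. t i * x i) ^ Suc k)
      = c * (\<Sum>i<k. t i * x i) ^ k * x k" for c t
    proof -
      have "(\<Sum>i<k. (t(k := real s)) i * x i) = (\<Sum>i<k. t i * x i)" for s
        by (rule sum.cong) auto
      then have upd: "(\<Sum>i<Suc k. (t(k := real s)) i * x i) = (\<Sum>i<k. t i * x i) + real s * x k" for s
        by (simp only: sum.lessThan_Suc fun_upd_same)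
      have "(\<Sum>(c, t)\<leftarrow>map (\<lambda>s. (c * w s, t(k := real s))) [0..<Suc (Suc k)]. c * (\<Sum>i<Suc k. t i * x i) ^ Suc k)
        = (\<Sum>s\<leftarrow>[0..<Suc (Suc k)]. c * (w s * ((\<Sum>i<k. t i * x i) + real s * x k) ^ Suc k))"
        by (simp only: map_map o_def case_prod_conv upd mult.assoc)
      also have "\<dots> = c * (\<Sum>s\<le>Suc k. w s * ((\<Sum>i<k. t i * x i) + real s * x k) ^ Suc k)"
        by (simp only: sum_list_const_mult interv_sum_list_conv_sum_set_nat set_upt atLeast0LessThan lessThan_Suc_atMost)
      finally show ?thesis by (simp only: w[rule_format, symmetric] mult.assoc)
    qed
    have "(\<Sum>(c, t)\<leftarrow>L'. c * (\<Sum>i<Suc k. t i * x i) ^ Suc k)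
      = (\<Sum>(c, t)\<leftarrow>L. c * (\<Sum>i<k. t i * x i) ^ k * x k)"
      unfolding L'_def
    proof (induction L)
      case (Cons p L)
      obtain c t where "p = (c, t)" by (cases p)
      then show ?case
        by (simp only: list.map concat.simps map_append sum_list.append sum_list.Cons one case_prod_conv Cons.IH)
    qed simp
    also have "\<dots> = (\<Sum>(c, t)\<leftarrow>L. c * (\<Sum>i<k. t i * x i) ^ k) * x k"
      by (induction L) (auto simp: distrib_right)
    finally show "(\<Prod>i<Suc k. x i) = (\<Sum>(c, t)\<leftarrow>L'. c * (\<Sum>i<Suc k. t i * x i) ^ Suc k)"
      by (simp only: prod.lessThan_Suc L[rule_format])
  qed
qed

text \<open>A polynomial functional is evaluated at a valuation of its indeterminates; this lets one
  compare the same polynomial in two different Gaussian families.\<close>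

inductive_set spoly :: "'i set \<Rightarrow> (('i \<Rightarrow> real) \<Rightarrow> real) set" for I where
  one: "(\<lambda>v. 1) \<in> spoly I"
| scale: "F \<in> spoly I \<Longrightarrow> (\<lambda>v. c * F v) \<in> spoly I"
| add: "F \<in> spoly I \<Longrightarrow> G \<in> spoly I \<Longrightarrow> (\<lambda>v. F v + G v) \<in> spoly I"
| var: "i \<in> I \<Longrightarrow> F \<in> spoly I \<Longrightarrow> (\<lambda>v. v i * F v) \<in> spoly I"

lemma spoly_const: "(\<lambda>v. c) \<in> spoly I"
  using spoly.scale[OF spoly.one, of c] by simp

lemma spoly_ident: "i \<in> I \<Longrightarrow> (\<lambda>v. v i) \<in> spoly I"
  using spoly.var[OF _ spoly.one, of i] by simp

lemma spoly_mult: "F \<in> spoly I \<Longrightarrow> G \<in> spoly I \<Longrightarrow> (\<lambda>v. F v * G v) \<in> spoly I"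
  by (induction F rule: spoly.induct) (auto simp: mult.assoc distrib_right intro: spoly.intros)

lemma spoly_power: "F \<in> spoly I \<Longrightarrow> (\<lambda>v. F v ^ k) \<in> spoly I"
  by (induction k) (auto intro: spoly_mult spoly.one)

lemma spoly_sum: "(\<And>j. j \<in> J \<Longrightarrow> F j \<in> spoly I) \<Longrightarrow> (\<lambda>v. \<Sum>j\<in>J. F j v) \<in> spoly I"
  by (induction J rule: infinite_finite_induct) (auto intro: spoly.add spoly_const)

text \<open>A substitute for equality of joint laws that involves one-dimensional moments only. The
  exponent equals the number of terms because \<open>prod_polarization\<close> writes a product of k
  factors through k-th powers of k-term forms; repetitions in \<open>l\<close> are allowed.\<close>

definition same_moments :: "'i set \<Rightarrow> 'b measure \<Rightarrow> ('b \<Rightarrow> 'i \<Rightarrow> real) \<Rightarrow> 'c measure \<Rightarrow> ('c \<Rightarrow> 'i \<Rightarrow> real) \<Rightarrow> bool" where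
  "same_moments I N V N' V' \<longleftrightarrow> (\<forall>k (t :: nat \<Rightarrow> real) l. (\<forall>i<k. l i \<in> I) \<longrightarrow>
     integrable N (\<lambda>\<omega>. (\<Sum>i<k. t i * V \<omega> (l i)) ^ k) \<and>
     integrable N' (\<lambda>\<omega>. (\<Sum>i<k. t i * V' \<omega> (l i)) ^ k) \<and>
     integral\<^sup>L N (\<lambda>\<omega>. (\<Sum>i<k. t i * V \<omega> (l i)) ^ k) = integral\<^sup>L N' (\<lambda>\<omega>. (\<Sum>i<k. t i * V' \<omega> (l i)) ^ k))"

lemma same_moments_prod:
  fixes k :: nat
  assumes "same_moments I N V N' V'" "\<forall>i<k. l i \<in> I"
  shows "integrable N (\<lambda>\<omega>. \<Prod>i<k. V \<omega> (l i)) \<and> integrable N' (\<lambda>\<omega>. \<Prod>i<k. V' \<omega> (l i)) \<and>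
    integral\<^sup>L N (\<lambda>\<omega>. \<Prod>i<k. V \<omega> (l i)) = integral\<^sup>L N' (\<lambda>\<omega>. \<Prod>i<k. V' \<omega> (l i))"
proof -
  obtain L :: "(real \<times> (nat \<Rightarrow> real)) list" where
    L: "\<forall>x. (\<Prod>i<k. x i) = (\<Sum>(c, t)\<leftarrow>L. c * (\<Sum>i<k. t i * x i) ^ k)"
    using prod_polarization[of k] ..
  have m: "integrable N (\<lambda>\<omega>. (\<Sum>i<k. t i * V \<omega> (l i)) ^ k)"
     "integrable N' (\<lambda>\<omega>. (\<Sum>i<k. t i * V' \<omega> (l i)) ^ k)"
     "integral\<^sup>L N (\<lambda>\<omega>. (\<Sum>i<k. t i * V \<omega> (l i)) ^ k) = integral\<^sup>L N' (\<lambda>\<omega>. (\<Sum>i<k. t i * V' \<omega> (l i)) ^ k)" for t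
    using assms unfolding same_moments_def by blast+
  show ?thesis unfolding L[rule_format]
    by (induction L) (auto simp: case_prod_beta m)
qed

lemma same_moments_spoly:
  assumes "same_moments I N V N' V'" "F \<in> spoly I"
  shows "integrable N (\<lambda>\<omega>. F (V \<omega>)) \<and> integrable N' (\<lambda>\<omega>. F (V' \<omega>)) \<and>
    integral\<^sup>L N (\<lambda>\<omega>. F (V \<omega>)) = integral\<^sup>L N' (\<lambda>\<omega>. F (V' \<omega>))"
proof -
  \<comment> \<open>Strengthened by a list of pending factors: \<open>var\<close> pushes its
    indeterminate onto \<open>ls\<close>, so that the case \<open>one\<close> is left with a plain
    monomial.\<close>
  have "set ls \<subseteq> I \<Longrightarrow> integrable N (\<lambda>\<omega>. F (V \<omega>) * (\<Prod>i\<leftarrow>ls. V \<omega> i)) \<and>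
    integrable N' (\<lambda>\<omega>. F (V' \<omega>) * (\<Prod>i\<leftarrow>ls. V' \<omega> i)) \<and>
    integral\<^sup>L N (\<lambda>\<omega>. F (V \<omega>) * (\<Prod>i\<leftarrow>ls. V \<omega> i)) =
    integral\<^sup>L N' (\<lambda>\<omega>. F (V' \<omega>) * (\<Prod>i\<leftarrow>ls. V' \<omega> i))" for ls
    using assms(2)
  proof (induction F arbitrary: ls rule: spoly.induct)
    case one
    have "(\<Prod>i\<leftarrow>ls. v i) = (\<Prod>i<length ls. v (ls ! i))" for v :: "'a \<Rightarrow> real"
      by (induction ls) (simp_all add: prod.lessThan_Suc_shift del: prod.lessThan_Suc)
    then show ?case
      using same_moments_prod[OF assms(1), of "length ls" "\<lambda>i. ls ! i"] one by (simp add: subset_code(1))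
  next
    case (scale F c)
    then show ?case by (simp add: mult.assoc)
  next
    case (add F G)
    then show ?case by (simp add: distrib_right)
  next
    case (var i F)
    have "v i * F v * (\<Prod>i\<leftarrow>ls. v i) = F v * (\<Prod>i\<leftarrow>i # ls. v i)" for v by simp
    then show ?case using var.IH[of "i # ls"] var.hyps var.prems by (simp only:) auto
  qed
  from this[of "[]"] show ?thesis by simp
qed

subsection \<open>Hermite polynomials\<close>

text \<open>The polynomials \<open>hermite\<close> as elements of \<open>real poly\<close>, so that
  \<open>pderiv\<close> and \<open>pcompose\<close> apply.\<close>

fun hpoly :: "nat \<Rightarrow> real poly" where
  "hpoly 0 = 1"
| "hpoly (Suc 0) = [:0, 1:]"
| "hpoly (Suc (Suc n)) = [:0, 1:] * hpoly (Suc n) - smult (real (Suc n)) (hpoly n)"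

lemma poly_hpoly [simp]: "poly (hpoly n) x = hermite n x"
  by (induction n rule: hpoly.induct) auto

lemma pderiv_hpoly: "pderiv (hpoly (Suc n)) = smult (real (Suc n)) (hpoly n)"
proof (induction n rule: hpoly.induct)
  case (3 n)
  have "pderiv (hpoly (Suc (Suc (Suc n))))
      = hpoly (Suc (Suc n)) + [:0, 1:] * pderiv (hpoly (Suc (Suc n))) - smult (real (Suc (Suc n))) (pderiv (hpoly (Suc n)))"
    by (simp add: pderiv_diff pderiv_mult pderiv_smult pderiv_pCons algebra_simps del: hpoly.simps(3)
        add: hpoly.simps(3)[of "Suc n"])
  also have "\<dots> = hpoly (Suc (Suc n)) + smult (real (Suc (Suc n))) ([:0, 1:] * hpoly (Suc n) - smult (real (Suc n)) (hpoly n))"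
    unfolding 3 by (simp add: smult_diff_right)
  also have "\<dots> = smult (real (Suc (Suc (Suc n)))) (hpoly (Suc (Suc n)))"
    by (simp only: hpoly.simps(3)[symmetric] of_nat_Suc[of "Suc (Suc n)"] smult_add_left smult_1_left add.commute)
  finally show ?case .
qed (auto simp: pderiv_pCons pderiv_diff pderiv_mult pderiv_smult)

lemma hermite_mult_ident: "x * hermite n x = hermite (Suc n) x + real n * hermite (n - 1) x"
  by (cases n) auto

definition hermite_span :: "nat \<Rightarrow> (real \<Rightarrow> real) set" where
  "hermite_span k = range (\<lambda>b x. \<Sum>n\<le>k. b n * hermite n x)"

lemma hermite_span_hermite: "n \<le> k \<Longrightarrow> hermite n \<in> hermite_span k"
  unfolding hermite_span_def
  by (rule image_eqI[of _ _ "\<lambda>j. if j = n then 1 else 0"]) (auto simp: if_distrib[of "\<lambda>c. c * _"] cong: if_cong)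

lemma hermite_span_add: "f \<in> hermite_span k \<Longrightarrow> g \<in> hermite_span k \<Longrightarrow> (\<lambda>x. f x + g x) \<in> hermite_span k"
  unfolding hermite_span_def
  by (auto simp: sum.distrib[symmetric] distrib_right[symmetric] intro: image_eqI[of _ _ "\<lambda>n. _ n + _ n"])

lemma hermite_span_scale: "f \<in> hermite_span k \<Longrightarrow> (\<lambda>x. c * f x) \<in> hermite_span k"
  unfolding hermite_span_def
  by (auto simp: sum_distrib_left mult.assoc[symmetric] intro: image_eqI[of _ _ "\<lambda>n. c * _ n"])

lemma hermite_span_sum:
  assumes "\<And>j. j \<in> J \<Longrightarrow> f j \<in> hermite_span k"
  shows "(\<lambda>x. \<Sum>j\<in>J. f j x) \<in> hermite_span k"
  using assms
proof (induction J rule: infinite_finite_induct)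
  case (insert j J)
  then show ?case by (auto intro: hermite_span_add)
qed (use hermite_span_scale[OF hermite_span_hermite[of 0], of _ 0] in auto)

text \<open>By induction, as multiplication by x maps He_n to He_(n+1) + n He_(n-1). The
  coefficients stay anonymous; later arguments use just that they are independent of x.\<close>

lemma power_eq_hermite_sum:
  "\<exists>b. \<forall>x. x ^ k = (\<Sum>n\<le>k. b n * hermite n x)"
proof -
  have "(\<lambda>x. x ^ k) \<in> hermite_span k"
  proof (induction k)
    case 0
    have "hermite 0 = (\<lambda>x. x ^ 0)" by auto
    then show ?case using hermite_span_hermite[of 0 0] by simp
  next
    case (Suc k)
    then obtain b where b: "\<And>x. x ^ k = (\<Sum>n\<le>k. b n * hermite n x)"
      by (auto simp: hermite_span_def fun_eq_iff)
    have "x ^ Suc k = (\<Sum>n\<le>k. b n * (hermite (Suc n) x + real n * hermite (n - 1) x))" for x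
      unfolding hermite_mult_ident[symmetric] by (simp add: b sum_distrib_left mult_ac)
    moreover have "(\<lambda>x. \<Sum>n\<le>k. b n * (hermite (Suc n) x + real n * hermite (n - 1) x)) \<in> hermite_span (Suc k)"
      by (intro hermite_span_sum hermite_span_scale hermite_span_add hermite_span_hermite) auto
    ultimately show ?case by presburger
  qed
  then show ?thesis by (auto simp: hermite_span_def fun_eq_iff)
qed

definition std_moment :: "nat \<Rightarrow> real" where
  "std_moment k = (\<integral>x. std_normal_density x * x ^ k \<partial>lborel)"

lemma std_moment_0 [simp]: "std_moment 0 = 1"
  using integral_std_normal_moment_even[of 0] by (simp add: std_moment_def)

text \<open>Integration by parts against the Gaussian density for monomials, read off from the
  closed formulas for even and odd moments. At k = 0 the factor \<open>real k\<close> neutralises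
  the truncated subtraction.\<close>

lemma std_moment_Suc: "std_moment (Suc k) = real k * std_moment (k - 1)"
proof (cases "even k")
  case True
  then obtain j where j: "k = 2 * j" by auto
  have "std_moment (Suc k) = 0"
    using integral_std_normal_moment_odd[of j] by (simp add: std_moment_def j)
  moreover have "real k * std_moment (k - 1) = 0"
  proof (cases j)
    case (Suc i)
    then show ?thesis using integral_std_normal_moment_odd[of i] by (simp add: std_moment_def j)
  qed (simp add: j)
  ultimately show ?thesis by simp
next
  case False
  then obtain j where j: "k = 2 * j + 1" by (auto elim: oddE)
  then have k: "Suc k = 2 * Suc j" "k - 1 = 2 * j" by auto
  have f: "fact (2 * Suc j) = (2 * (real j + 1)) * ((2 * real j + 1) * fact (2 * j) :: real)"
    by (simp add: algebra_simps)
  have "(2 * D) * (c * F) / ((2 * P) * (D * Q)) = c * (F / (P * Q))" if "D \<noteq> 0" for c D F P Q :: real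
    using that by simp
  note g = this[of "real j + 1" "2 * real j + 1" "fact (2 * j)" "2 ^ j" "fact j"]
  have "fact (2 * Suc j) / (2 ^ Suc j * fact (Suc j)) = (2 * real j + 1) * (fact (2 * j) / (2 ^ j * fact j))"
    unfolding f by (subst g[symmetric]) (auto simp: add.commute)
  then show ?thesis
    unfolding std_moment_def k integral_std_normal_moment_even
    by (simp only: j) simp
qed

subsection \<open>Moments in a Gaussian space\<close>

locale gaussian = prob_space M for M :: "'a measure" +
  fixes H :: "('a \<Rightarrow> real) set"
  assumes gaussian_space: "gaussian_space M H"
begin

lemma H_add: "f \<in> H \<Longrightarrow> g \<in> H \<Longrightarrow> (\<lambda>x. f x + g x) \<in> H"
  and H_scale: "f \<in> H \<Longrightarrow> (\<lambda>x. c * f x) \<in> H"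
  and H_zero: "(\<lambda>x. 0) \<in> H"
  using gaussian_space unfolding gaussian_space_def by auto

lemma H_lincomb: "(\<And>i. i \<in> J \<Longrightarrow> l i \<in> H) \<Longrightarrow> (\<lambda>x. \<Sum>i\<in>J. t i * l i x) \<in> H"
proof (induction J rule: infinite_finite_induct)
  case (insert j J)
  then show ?case using H_add[OF H_scale[of "l j" "t j"], of "\<lambda>x. \<Sum>i\<in>J. t i * l i x"] by auto
qed (auto intro: H_zero)

lemma H_measurable: "h \<in> H \<Longrightarrow> h \<in> borel_measurable M"
  using gaussian_space unfolding gaussian_space_def L2_def by auto

definition sd :: "('a \<Rightarrow> real) \<Rightarrow> real" where
  "sd h = sqrt (expectation (\<lambda>x. (h x)\<^sup>2))"

lemma sd_nonneg: "sd h \<ge> 0"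
  by (simp add: sd_def)

text \<open>The dichotomy in \<open>centered_gaussian\<close>, with the unknown standard deviation
  identified as \<open>sd h\<close>. Null elements have to be carried along because \<open>H\<close>
  consists of functions and not of classes.\<close>

lemma H_cases:
  assumes "h \<in> H"
  obtains "AE x in M. h x = 0" "sd h = 0"
  | "sd h > 0" "distributed M lborel (\<lambda>x. h x / sd h) std_normal_density"
proof -
  have [measurable]: "h \<in> borel_measurable M" by (rule H_measurable[OF assms])
  have "centered_gaussian M h"
    using assms gaussian_space unfolding gaussian_space_def by auto
  then consider "distr M borel h = return borel 0"
    | \<sigma> where "\<sigma> > 0" "distributed M lborel h (normal_density 0 \<sigma>)"
    unfolding centered_gaussian_def by auto
  then show ?thesis
  proof cases
    case 1
    have "AE y in distr M borel h. y = 0"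
      unfolding 1 by (subst AE_return) auto
    then have z: "AE x in M. h x = 0"
      by (subst (asm) AE_distr_iff) auto
    then have "expectation (\<lambda>x. (h x)\<^sup>2) = expectation (\<lambda>x. 0)"
      by (intro integral_cong_AE) auto
    then have "sd h = 0" by (simp add: sd_def)
    with z show ?thesis using that(1) by blast
  next
    case 2
    have e: "expectation h = 0" by (rule normal_distributed_expectation[OF 2])
    have "variance h = \<sigma>\<^sup>2" by (rule normal_distributed_variance[OF 2])
    then have "sd h = \<sigma>" using 2(1) by (simp add: sd_def e)
    moreover have "distributed M lborel (\<lambda>x. (h x - 0) / \<sigma>) std_normal_density"
      using normal_standard_normal_convert[OF 2(1), of h 0] 2(2) by simp
    ultimately show ?thesis using that(2) 2(1) by simp
  qed
qed

lemma H_moment: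
  assumes "h \<in> H"
  shows "integrable M (\<lambda>x. h x ^ k)" "expectation (\<lambda>x. h x ^ k) = sd h ^ k * std_moment k"
proof -
  have [measurable]: "h \<in> borel_measurable M" by (rule H_measurable[OF assms])
  have "integrable M (\<lambda>x. h x ^ k) \<and> expectation (\<lambda>x. h x ^ k) = sd h ^ k * std_moment k"
    using assms
  proof (cases h rule: H_cases)
    case 1
    then have ae: "AE x in M. h x ^ k = 0 ^ k" by auto
    have "integrable M (\<lambda>x. h x ^ k) \<longleftrightarrow> integrable M (\<lambda>x. 0 ^ k :: real)"
      by (intro integrable_cong_AE ae) auto
    moreover have "expectation (\<lambda>x. h x ^ k) = expectation (\<lambda>x. 0 ^ k)"
      by (intro integral_cong_AE ae) auto
    ultimately show ?thesis using 1 by (cases k) (auto simp: prob_space)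
  next
    case 2
    have i: "integrable M (\<lambda>x. (h x / sd h) ^ k)"
      using distributed_integrable[OF 2(2), of "\<lambda>x. x ^ k"] integrable_std_normal_moment[of k] by simp
    have e: "expectation (\<lambda>x. (h x / sd h) ^ k) = std_moment k"
      using distributed_integral[OF 2(2), of "\<lambda>x. x ^ k"] by (simp add: std_moment_def)
    have eq: "(\<lambda>x. h x ^ k) = (\<lambda>x. sd h ^ k * (h x / sd h) ^ k)"
      using 2(1) by (auto simp: power_mult_distrib[symmetric])
    show ?thesis unfolding eq using i e by simp
  qed
  then show "integrable M (\<lambda>x. h x ^ k)" "expectation (\<lambda>x. h x ^ k) = sd h ^ k * std_moment k"
    by auto
qed

section \<open>Unit vectors of \<open>H\<close>: integration by parts and Mehler's formula in one
  variable\<close>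

definition U :: "('a \<Rightarrow> real) set" where
  "U = {h \<in> H. expectation (\<lambda>x. (h x)\<^sup>2) = 1}"

lemma U_H: "h \<in> U \<Longrightarrow> h \<in> H" and U_sd: "h \<in> U \<Longrightarrow> sd h = 1"
  by (auto simp: U_def sd_def)

lemma H_normalize:
  assumes "h \<in> H" "sd h > 0"
  shows "(\<lambda>x. h x / sd h) \<in> U"
proof -
  have "expectation (\<lambda>x. (h x / sd h)\<^sup>2) = expectation (\<lambda>x. (h x)\<^sup>2) / (sd h)\<^sup>2"
    by (simp add: power_divide)
  also have "\<dots> = 1" using assms(2) by (simp add: sd_def)
  finally show ?thesis using H_scale[OF assms(1), of "1 / sd h"] by (simp add: U_def)
qed

lemma U_integrable: "h \<in> U \<Longrightarrow> integrable M (\<lambda>x. h x ^ k * poly q (h x))"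
proof (induction q arbitrary: k rule: pCons_induct)
  case (pCons a q)
  have "integrable M (\<lambda>x. a * h x ^ k + h x ^ Suc k * poly q (h x))"
    using pCons H_moment(1)[OF U_H] by (intro Bochner_Integration.integrable_add) (simp_all del: power_Suc)
  then show ?case by (simp add: algebra_simps)
qed auto

lemma U_integrable_poly: "h \<in> U \<Longrightarrow> integrable M (\<lambda>x. poly q (h x))"
  using U_integrable[of h 0] by simp

lemma integration_by_parts:
  assumes h: "h \<in> U"
  shows "expectation (\<lambda>x. h x * poly q (h x)) = expectation (\<lambda>x. poly (pderiv q) (h x))"
proof -
  \<comment> \<open>The factor h^k makes the induction on coefficients close:
    \<open>pCons a q\<close> stands for a + x q, which raises k by one. The contribution of the
    constant a is the recursion \<open>std_moment_Suc\<close>; the term with factor k is the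
    derivative of x^k.\<close>
  have "expectation (\<lambda>x. h x ^ Suc k * poly q (h x)) = expectation (\<lambda>x. h x ^ k * poly (pderiv q) (h x))
     + real k * expectation (\<lambda>x. h x ^ (k - 1) * poly q (h x))" for k
  proof (induction q arbitrary: k rule: pCons_induct)
    case (pCons a q)
    note [simp] = U_integrable[OF h] H_moment[OF U_H[OF h]] U_sd[OF h]
    have i: "integrable M (\<lambda>x. h x * (h x ^ k * poly q (h x)))" for k q
      using U_integrable[OF h, of "Suc k" q] by (simp add: mult.assoc)
    have "expectation (\<lambda>x. h x ^ Suc k * poly (pCons a q) (h x))
       = expectation (\<lambda>x. a * h x ^ Suc k + h x ^ Suc (Suc k) * poly q (h x))"
      by (simp add: algebra_simps)
    also have "\<dots> = a * std_moment (Suc k) + expectation (\<lambda>x. h x ^ Suc (Suc k) * poly q (h x))"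
      by (subst Bochner_Integration.integral_add) (simp_all del: power_Suc)
    also have "\<dots> = a * real k * std_moment (k - 1) + expectation (\<lambda>x. h x ^ Suc k * poly (pderiv q) (h x))
      + real (Suc k) * expectation (\<lambda>x. h x ^ k * poly q (h x))"
      by (simp only: pCons.IH std_moment_Suc diff_Suc_1 mult.assoc add.assoc)
    finally have L: "expectation (\<lambda>x. h x ^ Suc k * poly (pCons a q) (h x)) = \<dots>" .
    have "expectation (\<lambda>x. h x ^ k * poly (pderiv (pCons a q)) (h x))
      = expectation (\<lambda>x. h x ^ k * poly q (h x) + h x ^ Suc k * poly (pderiv q) (h x))"
      by (simp add: pderiv_pCons algebra_simps)
    also have "\<dots> = expectation (\<lambda>x. h x ^ k * poly q (h x)) + expectation (\<lambda>x. h x ^ Suc k * poly (pderiv q) (h x))"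
      by (subst Bochner_Integration.integral_add) (simp_all del: power_Suc)
    finally have R: "expectation (\<lambda>x. h x ^ k * poly (pderiv (pCons a q)) (h x)) = \<dots>" .
    have "real k * expectation (\<lambda>x. h x ^ (k - 1) * poly (pCons a q) (h x))
        = expectation (\<lambda>x. real k * a * h x ^ (k - 1) + real k * (h x ^ k * poly q (h x)))"
      by (cases k) (simp_all add: algebra_simps flip: integral_mult_right_zero)
    also have "\<dots> = real k * a * std_moment (k - 1) + real k * expectation (\<lambda>x. h x ^ k * poly q (h x))"
      by (subst Bochner_Integration.integral_add) simp_all
    finally show ?case unfolding L R by (simp add: algebra_simps del: power_Suc)
  qed simp
  from this[of 0] show ?thesis by simp
qed

text \<open>Put Q_n(y) = He_n(a x + b y). In the three-term recursion the summand with the factor b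
  y integrates by parts, using Q_(n+1)' = b (n + 1) Q_n, to b^2 (n + 1) E Q_n; as b^2 - 1 = -a^2,
  the expectations satisfy the Hermite recursion scaled by a.\<close>

lemma mehler_1d:
  assumes h: "h \<in> U" and ab: "a\<^sup>2 + b\<^sup>2 = 1"
  shows "integrable M (\<lambda>y. hermite n (a * x + b * h y))"
    "expectation (\<lambda>y. hermite n (a * x + b * h y)) = a ^ n * hermite n x"
proof -
  define Q where "Q n = pcompose (hpoly n) [:a * x, b:]" for n
  have Q: "hermite n (a * x + b * h y) = poly (Q n) (h y)" for n y
    by (simp add: Q_def poly_pcompose mult.commute)
  note int [simp] = U_integrable_poly[OF h]
  have int1 [simp]: "integrable M (\<lambda>y. h y * poly q (h y))" for q
    using U_integrable[OF h, of 1] by simp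
  show "integrable M (\<lambda>y. hermite n (a * x + b * h y))" unfolding Q by simp
  have dQ: "pderiv (Q (Suc n)) = smult (b * real (Suc n)) (Q n)" for n
    by (simp add: Q_def pderiv_pcompose pderiv_hpoly pcompose_smult pderiv_pCons mult.commute del: hpoly.simps)
  have "expectation (\<lambda>y. poly (Q n) (h y)) = a ^ n * hermite n x"
  proof (induction n rule: hpoly.induct)
    case 1
    show ?case by (simp add: Q_def prob_space pcompose_1)
  next
    case 2
    show ?case using H_moment[OF U_H[OF h], of 1] std_moment_Suc[of 0]
      by (simp add: Q_def pcompose_pCons prob_space)
  next
    case (3 n)
    have step: "poly (Q (Suc (Suc n))) y = a * x * poly (Q (Suc n)) y + b * (y * poly (Q (Suc n)) y) - real (Suc n) * poly (Q n) y" for y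
      by (simp add: Q_def poly_pcompose algebra_simps)
    have "expectation (\<lambda>y. poly (Q (Suc (Suc n))) (h y))
      = a * x * expectation (\<lambda>y. poly (Q (Suc n)) (h y)) + b * expectation (\<lambda>y. h y * poly (Q (Suc n)) (h y))
        - real (Suc n) * expectation (\<lambda>y. poly (Q n) (h y))"
      unfolding step by simp
    also have "b * expectation (\<lambda>y. h y * poly (Q (Suc n)) (h y)) = b\<^sup>2 * real (Suc n) * expectation (\<lambda>y. poly (Q n) (h y))"
      unfolding integration_by_parts[OF h] dQ by (simp add: power2_eq_square)
    also have "b\<^sup>2 = 1 - a\<^sup>2" using ab by simp
    finally show ?case unfolding 3
      by (simp add: algebra_simps power2_eq_square)
  qed
  then show "expectation (\<lambda>y. hermite n (a * x + b * h y)) = a ^ n * hermite n x" unfolding Q .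
qed

text \<open>Integration by parts lowers both indices: E He_(n+1) He_m = m E He_n He_(m-1). Distinct
  indices lead to a pair with exactly one index zero, where the expectation vanishes.\<close>

lemma hermite_orthogonal_1d:
  assumes h: "h \<in> U" and "n \<noteq> m"
  shows "expectation (\<lambda>x. hermite n (h x) * hermite m (h x)) = 0"
proof -
  note int [simp] = U_integrable_poly[OF h]
  have step: "expectation (\<lambda>x. hermite (Suc n) (h x) * hermite m (h x))
     = real m * expectation (\<lambda>x. hermite n (h x) * hermite (m - 1) (h x))" for n m
  proof -
    have dp: "pderiv (hpoly k) = smult (real k) (hpoly (k - 1))" for k
      by (cases k) (simp_all add: pderiv_hpoly del: hpoly.simps(2,3))
    have i: "integrable M (\<lambda>x. h x * poly q (h x))" for q
      using U_integrable[OF h, of 1] by simp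
    have "expectation (\<lambda>x. hermite (Suc n) (h x) * hermite m (h x))
      = expectation (\<lambda>x. h x * poly (hpoly n * hpoly m) (h x) - real n * poly (hpoly (n - 1) * hpoly m) (h x))"
    proof (rule Bochner_Integration.integral_cong[OF refl])
      fix x
      have e: "hermite (Suc n) (h x) = h x * hermite n (h x) - real n * hermite (n - 1) (h x)"
        using hermite_mult_ident[of "h x" n] by linarith
      show "hermite (Suc n) (h x) * hermite m (h x)
        = h x * poly (hpoly n * hpoly m) (h x) - real n * poly (hpoly (n - 1) * hpoly m) (h x)"
        unfolding e by (simp add: algebra_simps)
    qed
    also have "\<dots> = expectation (\<lambda>x. h x * poly (hpoly n * hpoly m) (h x)) - real n * expectation (\<lambda>x. poly (hpoly (n - 1) * hpoly m) (h x))"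
      by (subst Bochner_Integration.integral_diff) (simp_all only: i int integral_mult_right_zero integrable_mult_right simp_thms)
    also have "expectation (\<lambda>x. h x * poly (hpoly n * hpoly m) (h x))
       = expectation (\<lambda>x. real n * poly (hpoly (n - 1) * hpoly m) (h x) + real m * poly (hpoly n * hpoly (m - 1)) (h x))"
      unfolding integration_by_parts[OF h] pderiv_mult dp by (simp add: algebra_simps)
    also have "\<dots> = real n * expectation (\<lambda>x. poly (hpoly (n - 1) * hpoly m) (h x)) + real m * expectation (\<lambda>x. poly (hpoly n * hpoly (m - 1)) (h x))"
      by (subst Bochner_Integration.integral_add) (simp_all only: i int integral_mult_right_zero integrable_mult_right simp_thms)
    finally show ?thesis by simp
  qed
  show ?thesis using \<open>n \<noteq> m\<close>
  proof (induction n arbitrary: m)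
    case 0
    then obtain k where "m = Suc k" by (cases m) auto
    then show ?case using step[of k 0] by (simp add: mult.commute)
  next
    case (Suc n)
    show ?case
    proof (cases m)
      case (Suc k)
      then show ?thesis using step[of n m] Suc.IH[of k] Suc.prems by simp
    qed (use step[of n 0] in simp)
  qed
qed

end

section \<open>Correlated copies on the product space: orthogonality and contraction\<close>

lemma hermite_spoly: "i \<in> I \<Longrightarrow> (\<lambda>v. hermite n (v i)) \<in> spoly I"
proof (induction n rule: hpoly.induct)
  case (3 n)
  have "(\<lambda>v. v i * hermite (Suc n) (v i) + - real (Suc n) * hermite n (v i)) \<in> spoly I"
    using 3 by (intro spoly.intros) auto
  then show ?case by (simp only: hermite.simps mult_minus_left diff_conv_add_uminus)
qed (auto intro: spoly.one spoly_ident)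

text \<open>The graph of x^p lies above its tangent at u; this is Young's inequality in a form
  without absolute values.\<close>

lemma young_even:
  fixes u v :: real
  assumes "even p" "p > 0"
  shows "real p * (u ^ (p - 1) * v) \<le> real (p - 1) * u ^ p + v ^ p"
proof -
  define f where "f = (\<lambda>x::real. x ^ p)"
  have "f v - f u \<ge> real p * u ^ (p - 1) * (v - u)"
    unfolding f_def
  proof (rule convex_on_imp_above_tangent[where A = UNIV])
    show "((\<lambda>x. x ^ p) has_real_derivative real p * u ^ (p - 1)) (at u within UNIV)"
      by (auto intro!: derivative_eq_intros)
  qed (use convex_power_even[OF assms(1)] in auto)
  then have "v ^ p - u ^ p \<ge> real p * (u ^ (p - 1) * v) - real p * (u ^ (p - 1) * u)"
    by (simp add: f_def right_diff_distrib mult.assoc)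
  moreover have "u ^ (p - 1) * u = u ^ p"
    using assms(2) by (cases p) auto
  ultimately show ?thesis using assms(2)
    by (simp add: of_nat_diff left_diff_distrib)
qed

context gaussian
begin

sublocale pair: pair_prob_space M M ..

lemma U_hermite_integrable: "h \<in> U \<Longrightarrow> integrable M (\<lambda>x. hermite n (h x))"
  using U_integrable_poly[of h "hpoly n"] by simp

lemma integrable_pair_mult:
  fixes f g :: "'a \<Rightarrow> real"
  assumes "integrable M f" "integrable M g"
  shows "integrable (M \<Otimes>\<^sub>M M) (\<lambda>z. f (fst z) * g (snd z))"
proof (rule pair.Fubini_integrable)
  have [measurable]: "f \<in> borel_measurable M" "g \<in> borel_measurable M" using assms by auto
  show "(\<lambda>z. f (fst z) * g (snd z)) \<in> borel_measurable (M \<Otimes>\<^sub>M M)" by measurable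
  show "integrable M (\<lambda>x. \<integral>y. norm (f (fst (x, y)) * g (snd (x, y))) \<partial>M)"
    using assms by (simp add: abs_mult)
qed (use assms in auto)

text \<open>Expand the power in Hermite polynomials and apply Mehler's formula to the second copy:
  after averaging over both copies only the coefficient \<open>c 0\<close> survives, and it does not
  depend on a and b.\<close>

lemma mix_moment_unit:
  assumes h: "h \<in> U" and ab: "a\<^sup>2 + b\<^sup>2 = 1"
  shows "integrable (M \<Otimes>\<^sub>M M) (\<lambda>z. (a * h (fst z) + b * h (snd z)) ^ k)"
    "(\<integral>z. (a * h (fst z) + b * h (snd z)) ^ k \<partial>(M \<Otimes>\<^sub>M M)) = std_moment k"
proof -
  show i: "integrable (M \<Otimes>\<^sub>M M) (\<lambda>z. (a * h (fst z) + b * h (snd z)) ^ k)"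
    unfolding binomial_ring power_mult_distrib mult.assoc[symmetric]
  proof (intro Bochner_Integration.integrable_sum)
    fix j
    have "integrable (M \<Otimes>\<^sub>M M) (\<lambda>z. (of_nat (k choose j) * a ^ j * b ^ (k - j)) * (h (fst z) ^ j * h (snd z) ^ (k - j)))"
      by (intro integrable_mult_right integrable_pair_mult H_moment U_H h)
    then show "integrable (M \<Otimes>\<^sub>M M) (\<lambda>z. of_nat (k choose j) * a ^ j * h (fst z) ^ j * b ^ (k - j) * h (snd z) ^ (k - j))"
      by (simp add: mult_ac)
  qed
  obtain c where c: "\<forall>x. x ^ k = (\<Sum>n\<le>k. c n * hermite n x)"
    using power_eq_hermite_sum[of k] ..
  have z: "expectation (\<lambda>x. hermite n (h x)) = (if n = 0 then 1 else 0)" for n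
    using hermite_orthogonal_1d[OF h, of n 0] by (auto simp: prob_space)
  have S: "(\<Sum>n\<le>k. c n * (if n = 0 then 1 else 0)) = c 0"
    by (simp add: if_distrib cong: if_cong)
  have "(\<integral>z. (a * h (fst z) + b * h (snd z)) ^ k \<partial>(M \<Otimes>\<^sub>M M))
    = (\<integral>x. (\<integral>y. (a * h x + b * h y) ^ k \<partial>M) \<partial>M)"
    using pair.integral_fst'[OF i] by simp
  also have "\<dots> = (\<integral>x. (\<Sum>n\<le>k. c n * (a ^ n * hermite n (h x))) \<partial>M)"
    unfolding c[rule_format] by (simp add: mehler_1d[OF h ab])
  also have "\<dots> = (\<Sum>n\<le>k. c n * (a ^ n * (if n = 0 then 1 else 0)))"
    by (simp add: U_hermite_integrable[OF h] z)
  also have "\<dots> = (\<Sum>n\<le>k. c n * (if n = 0 then 1 else 0))"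
    by (intro sum.cong) auto
  also have "\<dots> = (\<integral>x. h x ^ k \<partial>M)"
    unfolding c[rule_format] by (simp add: U_hermite_integrable[OF h] z)
  finally show "(\<integral>z. (a * h (fst z) + b * h (snd z)) ^ k \<partial>(M \<Otimes>\<^sub>M M)) = std_moment k"
    by (simp add: H_moment[OF U_H[OF h]] U_sd[OF h])
qed

text \<open>Scaling by r = sqrt (c^2 + d^2) \<open>sd h\<close> reduces to unit vectors. If r = 0,
  either both coefficients or \<open>sd h\<close> vanish, and the combination is zero almost
  everywhere.\<close>

lemma mix_moment:
  assumes h: "h \<in> H"
  shows "integrable (M \<Otimes>\<^sub>M M) (\<lambda>z. (c * h (fst z) + d * h (snd z)) ^ k) \<and>
    (\<integral>z. (c * h (fst z) + d * h (snd z)) ^ k \<partial>(M \<Otimes>\<^sub>M M)) = (sqrt (c\<^sup>2 + d\<^sup>2) * sd h) ^ k * std_moment k"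
proof -
  note [measurable] = H_measurable[OF h]
  have m: "(\<lambda>z. c * h (fst z) + d * h (snd z)) \<in> borel_measurable (M \<Otimes>\<^sub>M M)"
    by measurable
  define r where "r = sqrt (c\<^sup>2 + d\<^sup>2) * sd h"
  have r0: "r \<ge> 0" by (simp add: r_def sd_nonneg)
  show ?thesis
  proof (cases "r = 0")
    case True
    have ae: "AE z in M \<Otimes>\<^sub>M M. (c * h (fst z) + d * h (snd z)) ^ k = 0 ^ k"
    proof -
      have "AE x in M. AE y in M. c * h (fst (x, y)) + d * h (snd (x, y)) = 0"
      proof (cases "sd h = 0")
        case False
        then have "c\<^sup>2 + d\<^sup>2 = 0" using True by (auto simp: r_def)
        then show ?thesis by (simp add: sum_power2_eq_zero_iff)
      next
        case True
        with h have z: "AE x in M. h x = 0" by (cases h rule: H_cases) simp_all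
        from z show ?thesis
        proof eventually_elim
          case (elim x)
          from z show ?case by eventually_elim (simp add: elim)
        qed
      qed
      then have "AE z in M \<Otimes>\<^sub>M M. c * h (fst z) + d * h (snd z) = 0"
      proof (rule pair.AE_pair_measure[rotated])
        show "{z \<in> space (M \<Otimes>\<^sub>M M). c * h (fst z) + d * h (snd z) = 0} \<in> sets (M \<Otimes>\<^sub>M M)"
        proof -
          have "(\<lambda>z. c * h (fst z) + d * h (snd z)) -` {0} \<inter> space (M \<Otimes>\<^sub>M M) \<in> sets (M \<Otimes>\<^sub>M M)"
            by (rule measurable_sets[OF m]) simp
          also have "(\<lambda>z. c * h (fst z) + d * h (snd z)) -` {0} \<inter> space (M \<Otimes>\<^sub>M M)
            = {z \<in> space (M \<Otimes>\<^sub>M M). c * h (fst z) + d * h (snd z) = 0}"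
            by blast
          finally show ?thesis .
        qed
      qed
      then show ?thesis by eventually_elim simp
    qed
    have "integrable (M \<Otimes>\<^sub>M M) (\<lambda>z. (c * h (fst z) + d * h (snd z)) ^ k)
      \<longleftrightarrow> integrable (M \<Otimes>\<^sub>M M) (\<lambda>z. 0 ^ k :: real)"
      using m by (intro integrable_cong_AE ae borel_measurable_power) simp_all
    moreover have "(\<integral>z. (c * h (fst z) + d * h (snd z)) ^ k \<partial>(M \<Otimes>\<^sub>M M)) = (\<integral>z. 0 ^ k \<partial>(M \<Otimes>\<^sub>M M))"
      using m by (intro integral_cong_AE ae borel_measurable_power) simp_all
    moreover have "(\<integral>z. 0 ^ k \<partial>(M \<Otimes>\<^sub>M M)) = (0 ^ k :: real)" "integrable (M \<Otimes>\<^sub>M M) (\<lambda>z. 0 ^ k :: real)"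
      using pair.prob_space by auto
    moreover have "(0 ^ k :: real) = r ^ k * std_moment k"
      using True by (cases k) auto
    ultimately show ?thesis unfolding r_def[symmetric] by simp
  next
    case False
    then have pos: "sd h > 0" "sqrt (c\<^sup>2 + d\<^sup>2) > 0" using r0
      by (auto simp: r_def sd_nonneg less_le)
    define a b where "a = c / sqrt (c\<^sup>2 + d\<^sup>2)" and "b = d / sqrt (c\<^sup>2 + d\<^sup>2)"
    have cd: "c\<^sup>2 + d\<^sup>2 > 0" using pos(2) by simp
    have ab: "a\<^sup>2 + b\<^sup>2 = 1"
      using cd by (auto simp: a_def b_def power_divide add_divide_distrib[symmetric])
    have eq: "(c * h (fst z) + d * h (snd z)) ^ k
      = r ^ k * (a * (h (fst z) / sd h) + b * (h (snd z) / sd h)) ^ k" for z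
    proof -
      have "c * h (fst z) + d * h (snd z) = r * (a * (h (fst z) / sd h) + b * (h (snd z) / sd h))"
        using pos by (simp add: r_def a_def b_def distrib_left)
      then show ?thesis by (simp only: power_mult_distrib)
    qed
    show ?thesis unfolding eq r_def[symmetric]
      using mix_moment_unit[OF H_normalize[OF h pos(1)] ab, of k] by simp
  qed
qed

text \<open>Mehler's coupling: a valuation of the indeterminates that rotates the first copy towards
  an independent second one. For 0 < a \<le> 1, averaging over the second coordinate is the
  Ornstein-Uhlenbeck semigroup at the time t with e^(-t) = a.\<close>

definition mix :: "real \<Rightarrow> 'a \<times> 'a \<Rightarrow> ('a \<Rightarrow> real) \<Rightarrow> real" where
  "mix a z h = a * h (fst z) + sqrt (1 - a\<^sup>2) * h (snd z)"

lemma same_moments_self: "same_moments H M (\<lambda>\<omega> h. h \<omega>) M (\<lambda>\<omega> h. h \<omega>)"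
  unfolding same_moments_def
  by (intro allI impI conjI refl H_moment(1)[where h = "\<lambda>\<omega>. \<Sum>i<_. _ i * _ i \<omega>"] H_lincomb) auto

lemma same_moments_mix:
  assumes "\<bar>a\<bar> \<le> 1"
  shows "same_moments H M (\<lambda>\<omega> h. h \<omega>) (M \<Otimes>\<^sub>M M) (mix a)"
  unfolding same_moments_def
proof (intro allI impI)
  fix k and t :: "nat \<Rightarrow> real" and l :: "nat \<Rightarrow> 'a \<Rightarrow> real"
  assume l: "\<forall>i<k. l i \<in> H"
  define h where "h = (\<lambda>\<omega>. \<Sum>i<k. t i * l i \<omega>)"
  have h: "h \<in> H" unfolding h_def using l by (intro H_lincomb) auto
  have e: "(\<Sum>i<k. t i * mix a z (l i)) = a * h (fst z) + sqrt (1 - a\<^sup>2) * h (snd z)" for z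
    by (simp add: mix_def h_def sum_distrib_left sum.distrib algebra_simps)
  have "a\<^sup>2 \<le> 1" using assms by (simp add: abs_square_le_1)
  then have "sqrt (a\<^sup>2 + (sqrt (1 - a\<^sup>2))\<^sup>2) = 1" by simp
  then show "integrable M (\<lambda>\<omega>. (\<Sum>i<k. t i * l i \<omega>) ^ k) \<and>
     integrable (M \<Otimes>\<^sub>M M) (\<lambda>\<omega>. (\<Sum>i<k. t i * mix a \<omega> (l i)) ^ k) \<and>
     expectation (\<lambda>\<omega>. (\<Sum>i<k. t i * l i \<omega>) ^ k) =
     integral\<^sup>L (M \<Otimes>\<^sub>M M) (\<lambda>\<omega>. (\<Sum>i<k. t i * mix a \<omega> (l i)) ^ k)"
    using mix_moment[OF h, of a "sqrt (1 - a\<^sup>2)" k] H_moment[OF h, of k]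
    unfolding e by (simp add: h_def)
qed

lemma spoly_integrable: "F \<in> spoly H \<Longrightarrow> integrable M (\<lambda>\<omega>. F (\<lambda>h. h \<omega>))"
  using same_moments_spoly[OF same_moments_self] by auto

text \<open>With \<rho> = E h k, the pair (h, k) has the moments of (h(x), \<rho> h(x) + sqrt (1 -
  \<rho>^2) h(y)), because moments of linear combinations depend on their variance alone. Mehler's
  formula in y turns the second factor into \<rho>^m He_m(h) and leaves the one-variable
  orthogonality.\<close>

lemma hermite_orthogonal:
  assumes h: "h \<in> U" and k: "k \<in> U" and "n \<noteq> m"
  shows "expectation (\<lambda>x. hermite n (h x) * hermite m (k x)) = 0"
proof -
  define \<rho> where "\<rho> = expectation (\<lambda>x. h x * k x)"
  have prodi: "integrable M (\<lambda>x. h x * k x)"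
  proof -
    have "(\<lambda>v. v h * (v k * 1)) \<in> spoly H" by (intro spoly.var spoly.one U_H h k)
    from spoly_integrable[OF this] show ?thesis by simp
  qed
  have sq: "expectation (\<lambda>x. (\<alpha> * h x + \<beta> * k x)\<^sup>2) = \<alpha>\<^sup>2 + 2 * \<alpha> * \<beta> * \<rho> + \<beta>\<^sup>2" for \<alpha> \<beta>
  proof -
    have u: "expectation (\<lambda>x. (h x)\<^sup>2) = 1" "expectation (\<lambda>x. (k x)\<^sup>2) = 1"
      using h k by (auto simp: U_def)
    have e: "(\<alpha> * h x + \<beta> * k x)\<^sup>2 = \<alpha>\<^sup>2 * (h x)\<^sup>2 + (2 * \<alpha> * \<beta> * (h x * k x) + \<beta>\<^sup>2 * (k x)\<^sup>2)" for x
      by (simp add: power2_eq_square algebra_simps)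
    show ?thesis unfolding e
      using H_moment(1)[OF U_H[OF h], of 2] H_moment(1)[OF U_H[OF k], of 2] prodi
      by (simp add: u \<rho>_def)
  qed
  \<comment> \<open>The variance of k - \<rho> h is 1 - \<rho>^2, which gives |\<rho>| \<le>
    1.\<close>
  have "0 \<le> expectation (\<lambda>x. (- \<rho> * h x + 1 * k x)\<^sup>2)" by (intro Bochner_Integration.integral_nonneg) auto
  then have rho: "\<rho>\<^sup>2 \<le> 1" unfolding sq by (simp add: power2_eq_square)
  \<comment> \<open>There are just two indeterminates, indexed by \<open>bool\<close>:
    \<open>True\<close> stands for h and \<open>False\<close> for k.\<close>
  have "same_moments UNIV M (\<lambda>\<omega> i. if i then h \<omega> else k \<omega>) (M \<Otimes>\<^sub>M M) (\<lambda>z i. if i then h (fst z) else mix \<rho> z h)"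
    unfolding same_moments_def
  proof (intro allI impI)
    fix N and t :: "nat \<Rightarrow> real" and l :: "nat \<Rightarrow> bool"
    define \<alpha> \<beta> where "\<alpha> = (\<Sum>i<N. if l i then t i else 0)" and "\<beta> = (\<Sum>i<N. if l i then 0 else t i)"
    have split: "(\<Sum>i<N. t i * (if l i then A else B)) = \<alpha> * A + \<beta> * B" for A B
      unfolding \<alpha>_def \<beta>_def sum_distrib_right sum.distrib[symmetric] by (intro sum.cong) auto
    define g where "g = (\<lambda>x. \<alpha> * h x + \<beta> * k x)"
    have g: "g \<in> H" unfolding g_def by (intro H_add H_scale U_H h k)
    have sdg: "sd g = sqrt (\<alpha>\<^sup>2 + 2 * \<alpha> * \<beta> * \<rho> + \<beta>\<^sup>2)"
      unfolding sd_def g_def sq ..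
    have e: "\<alpha> * h (fst z) + \<beta> * mix \<rho> z h = (\<alpha> + \<beta> * \<rho>) * h (fst z) + (\<beta> * sqrt (1 - \<rho>\<^sup>2)) * h (snd z)" for z
      by (simp add: mix_def algebra_simps)
    have v: "(\<alpha> + \<beta> * \<rho>)\<^sup>2 + (\<beta> * sqrt (1 - \<rho>\<^sup>2))\<^sup>2 = \<alpha>\<^sup>2 + 2 * \<alpha> * \<beta> * \<rho> + \<beta>\<^sup>2"
      using rho by (simp add: power_mult_distrib) (simp add: power2_eq_square algebra_simps)
    show "integrable M (\<lambda>\<omega>. (\<Sum>i<N. t i * (if l i then h \<omega> else k \<omega>)) ^ N) \<and>
        integrable (M \<Otimes>\<^sub>M M) (\<lambda>z. (\<Sum>i<N. t i * (if l i then h (fst z) else mix \<rho> z h)) ^ N) \<and>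
        expectation (\<lambda>\<omega>. (\<Sum>i<N. t i * (if l i then h \<omega> else k \<omega>)) ^ N) =
        integral\<^sup>L (M \<Otimes>\<^sub>M M) (\<lambda>z. (\<Sum>i<N. t i * (if l i then h (fst z) else mix \<rho> z h)) ^ N)"
      unfolding split e
      using mix_moment[OF U_H[OF h], of "\<alpha> + \<beta> * \<rho>" "\<beta> * sqrt (1 - \<rho>\<^sup>2)" N] H_moment[OF g, of N]
      unfolding v sdg U_sd[OF h] by (simp add: g_def)
  qed
  from same_moments_spoly[OF this spoly_mult[OF hermite_spoly hermite_spoly], of True False n m]
  have i: "integrable (M \<Otimes>\<^sub>M M) (\<lambda>z. hermite n (h (fst z)) * hermite m (mix \<rho> z h))"
    and e: "expectation (\<lambda>x. hermite n (h x) * hermite m (k x))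
      = (\<integral>z. hermite n (h (fst z)) * hermite m (mix \<rho> z h) \<partial>(M \<Otimes>\<^sub>M M))"
    by auto
  have "\<rho>\<^sup>2 + (sqrt (1 - \<rho>\<^sup>2))\<^sup>2 = 1" using rho by simp
  note mehler = mehler_1d[OF h this]
  note e
  also have "(\<integral>z. hermite n (h (fst z)) * hermite m (mix \<rho> z h) \<partial>(M \<Otimes>\<^sub>M M))
    = (\<integral>x. (\<integral>y. hermite n (h x) * hermite m (\<rho> * h x + sqrt (1 - \<rho>\<^sup>2) * h y) \<partial>M) \<partial>M)"
    using pair.integral_fst'[OF i] by (simp add: mix_def)
  also have "\<dots> = expectation (\<lambda>x. \<rho> ^ m * (hermite n (h x) * hermite m (h x)))"
    by (simp only: integral_mult_right_zero mehler) (simp only: mult_ac integral_mult_right_zero)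
  also have "\<dots> = 0" using hermite_orthogonal_1d[OF h \<open>n \<noteq> m\<close>] by simp
  finally show ?thesis .
qed

text \<open>The span whose closure is \<open>chaos\<close>, kept unevaluated: the same element can
  then be evaluated at a sample point and at \<open>mix\<close>.\<close>

definition chaos_poly :: "nat \<Rightarrow> ((('a \<Rightarrow> real) \<Rightarrow> real) \<Rightarrow> real) set" where
  "chaos_poly n = {(\<lambda>v. \<Sum>i<N. c i * hermite n (v (l i))) | (N :: nat) c l. \<forall>i<N. l i \<in> U}"

lemma chaos_poly_spoly: "F \<in> chaos_poly n \<Longrightarrow> F \<in> spoly H"
  unfolding chaos_poly_def by (auto intro!: spoly_sum spoly.scale hermite_spoly U_H)

lemma chaos_poly_mehler:
  assumes "F \<in> chaos_poly n" "\<bar>a\<bar> \<le> 1"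
  shows "integrable M (\<lambda>y. F (mix a (x, y)))"
    "expectation (\<lambda>y. F (mix a (x, y))) = a ^ n * F (\<lambda>h. h x)"
proof -
  obtain N c l where F: "F = (\<lambda>v. \<Sum>i<N. c i * hermite n (v (l i)))" "\<And>i. i < (N::nat) \<Longrightarrow> l i \<in> U"
    using assms(1) unfolding chaos_poly_def by blast
  have "a\<^sup>2 \<le> 1" using assms(2) by (simp add: abs_square_le_1)
  then have "a\<^sup>2 + (sqrt (1 - a\<^sup>2))\<^sup>2 = 1" by simp
  note mehler = mehler_1d[OF F(2) this]
  show "integrable M (\<lambda>y. F (mix a (x, y)))"
    unfolding F(1) mix_def by (intro Bochner_Integration.integrable_sum integrable_mult_right) (auto intro: mehler)
  have "expectation (\<lambda>y. F (mix a (x, y))) = (\<Sum>i<N. c i * (a ^ n * hermite n (l i x)))"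
    unfolding F(1) mix_def by (subst Bochner_Integration.integral_sum) (auto simp: mehler)
  then show "expectation (\<lambda>y. F (mix a (x, y))) = a ^ n * F (\<lambda>h. h x)"
    by (simp add: F(1) sum_distrib_left mult_ac)
qed

text \<open>By Mehler's formula the sum on the left at x is the mean over y of the sum on the right
  at \<open>mix \<rho> (x, y)\<close>; Jensen's inequality moves the convex p-th power inside, and
  \<open>mix \<rho>\<close> has the moments of the original family.\<close>

lemma ornstein_uhlenbeck_contraction:
  assumes A: "\<And>n. A n \<in> chaos_poly n" and \<rho>: "\<bar>\<rho>\<bar> \<le> 1" and p: "even p"
  shows "expectation (\<lambda>\<omega>. (\<Sum>n<d. \<rho> ^ n * A n (\<lambda>h. h \<omega>)) ^ p)
    \<le> expectation (\<lambda>\<omega>. (\<Sum>n<d. A n (\<lambda>h. h \<omega>)) ^ p)"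
proof -
  define \<Phi> where "\<Phi> v = (\<Sum>n<d. A n v)" for v
  have sp: "(\<lambda>v. \<Phi> v ^ p) \<in> spoly H"
    unfolding \<Phi>_def by (intro spoly_power spoly_sum chaos_poly_spoly[OF A])
  from same_moments_spoly[OF same_moments_mix[OF \<rho>] sp]
  have i: "integrable (M \<Otimes>\<^sub>M M) (\<lambda>z. \<Phi> (mix \<rho> z) ^ p)"
    and e: "expectation (\<lambda>\<omega>. \<Phi> (\<lambda>h. h \<omega>) ^ p) = (\<integral>z. \<Phi> (mix \<rho> z) ^ p \<partial>(M \<Otimes>\<^sub>M M))"
    by auto
  define u where "u x = (\<Sum>n<d. \<rho> ^ n * A n (\<lambda>h. h x))" for x
  have iu: "integrable M (\<lambda>y. \<Phi> (mix \<rho> (x, y)))" for x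
    unfolding \<Phi>_def by (intro Bochner_Integration.integrable_sum chaos_poly_mehler[OF A \<rho>])
  have u: "u x = expectation (\<lambda>y. \<Phi> (mix \<rho> (x, y)))" for x
    unfolding \<Phi>_def u_def
    by (subst Bochner_Integration.integral_sum) (auto simp: chaos_poly_mehler[OF A \<rho>])
  have "AE x in M. u x ^ p \<le> expectation (\<lambda>y. \<Phi> (mix \<rho> (x, y)) ^ p)"
    using pair.AE_integrable_fst'[OF i]
  proof eventually_elim
    case (elim x)
    show ?case unfolding u
      by (rule jensens_inequality[where I = UNIV and q = "\<lambda>x. x ^ p"])
        (use elim iu convex_power_even[OF p] in auto)
  qed
  moreover have "integrable M (\<lambda>x. u x ^ p)"
  proof -
    have "(\<lambda>v. (\<Sum>n<d. \<rho> ^ n * A n v) ^ p) \<in> spoly H"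
      by (intro spoly_power spoly_sum spoly.scale chaos_poly_spoly[OF A])
    from spoly_integrable[OF this] show ?thesis by (simp add: u_def)
  qed
  ultimately have "expectation (\<lambda>x. u x ^ p) \<le> expectation (\<lambda>x. expectation (\<lambda>y. \<Phi> (mix \<rho> (x, y)) ^ p))"
    using pair.integrable_fst'[OF i] by (intro integral_mono_AE) auto
  also have "\<dots> = expectation (\<lambda>\<omega>. \<Phi> (\<lambda>h. h \<omega>) ^ p)"
    using pair.integral_fst'[OF i] e by simp
  finally show ?thesis by (simp add: u_def \<Phi>_def)
qed

end

subsection \<open>Even moment norms\<close>

text \<open>Convexity at x / a and y / b with weights a / (a + b) and b / (a + b). With a and b
  close to the norms of x and y, integration turns it into Minkowski's inequality.\<close>

lemma weighted_power_convex:
  fixes a b x y :: real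
  assumes "even p" "a > 0" "b > 0" "p > 0"
  shows "(x + y) ^ p \<le> (a + b) ^ (p - 1) * (x ^ p / a ^ (p - 1) + y ^ p / b ^ (p - 1))"
proof -
  have c: "(s * x + t * y) ^ p \<le> s * x ^ p + t * y ^ p" if "s \<ge> 0" "t \<ge> 0" "s + t = 1" for s t x y :: real
    using convex_power_even[OF assms(1)] that unfolding convex_on_def by auto
  have s: "a / (a + b) + b / (a + b) = 1" using assms by (simp add: add_divide_distrib[symmetric])
  have "(a / (a + b) * (x / a) + b / (a + b) * (y / b)) ^ p \<le> a / (a + b) * (x / a) ^ p + b / (a + b) * (y / b) ^ p"
    by (rule c) (use assms s in auto)
  moreover have "a / (a + b) * (x / a) + b / (a + b) * (y / b) = (x + y) / (a + b)"
    using assms by (simp add: add_divide_distrib)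
  ultimately have "(x + y) ^ p / (a + b) ^ p \<le> a / (a + b) * (x / a) ^ p + b / (a + b) * (y / b) ^ p"
    by (simp add: power_divide)
  then have "(x + y) ^ p \<le> (a + b) ^ p * (a / (a + b) * (x / a) ^ p + b / (a + b) * (y / b) ^ p)"
    using assms by (simp add: pos_divide_le_eq mult.commute)
  also have "\<dots> = (a + b) ^ (p - 1) * (x ^ p / a ^ (p - 1) + y ^ p / b ^ (p - 1))"
  proof -
    obtain k where p: "p = Suc k" using assms(4) by (cases p) auto
    have "(a + b) * (a / (a + b) * (x / a) ^ p + b / (a + b) * (y / b) ^ p) = a * (x / a) ^ p + b * (y / b) ^ p"
      using assms(2,3) by (simp add: distrib_left)
    also have "\<dots> = x ^ p / a ^ k + y ^ p / b ^ k"
      using assms(2,3) by (simp add: p power_divide)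
    finally show ?thesis by (simp add: p mult.assoc mult.left_commute)
  qed
  finally show ?thesis .
qed

text \<open>For even p this is the L^p norm; leaving out the absolute value keeps u^p polynomial
  when u is.\<close>

definition nrm :: "'a measure \<Rightarrow> nat \<Rightarrow> ('a \<Rightarrow> real) \<Rightarrow> real" where
  "nrm M p u = root p (integral\<^sup>L M (\<lambda>x. u x ^ p))"

definition in_L :: "'a measure \<Rightarrow> nat \<Rightarrow> ('a \<Rightarrow> real) \<Rightarrow> bool" where
  "in_L M p u \<longleftrightarrow> u \<in> borel_measurable M \<and> integrable M (\<lambda>x. u x ^ p)"

lemma in_L_measurable: "in_L M p u \<Longrightarrow> u \<in> borel_measurable M"
  by (simp add: in_L_def)

lemma nrm_nonneg: "even p \<Longrightarrow> nrm M p u \<ge> 0"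
  by (cases "p = 0") (auto simp: nrm_def zero_le_even_power)

lemma nrm_power: "even p \<Longrightarrow> p > 0 \<Longrightarrow> nrm M p u ^ p = integral\<^sup>L M (\<lambda>x. u x ^ p)"
  unfolding nrm_def by (intro real_root_pow_pos2) (auto simp: zero_le_even_power)

lemma nrm_leI:
  assumes "even p" "p > 0" "c \<ge> 0" "integral\<^sup>L M (\<lambda>x. u x ^ p) \<le> c ^ p"
  shows "nrm M p u \<le> c"
  using assms by (metis nrm_power power_le_imp_le_base nrm_nonneg power_mono_iff)

lemma nrm_leD: "even p \<Longrightarrow> p > 0 \<Longrightarrow> nrm M p u \<le> c \<Longrightarrow> integral\<^sup>L M (\<lambda>x. u x ^ p) \<le> c ^ p"
  by (metis nrm_power power_mono nrm_nonneg)

lemma nrm_cong_AE: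
  assumes "AE x in M. u x = v x" "u \<in> borel_measurable M" "v \<in> borel_measurable M"
  shows "nrm M p u = nrm M p v"
  unfolding nrm_def using assms by (intro arg_cong[of _ _ "root p"] integral_cong_AE) auto

lemma in_L_cong_AE:
  assumes "AE x in M. u x = v x" "in_L M p u" "v \<in> borel_measurable M"
  shows "in_L M p v"
proof -
  have "integrable M (\<lambda>x. u x ^ p) = integrable M (\<lambda>x. v x ^ p)"
    using assms by (intro integrable_cong_AE) (auto simp: in_L_def)
  then show ?thesis using assms by (simp add: in_L_def)
qed

lemma nrm_scale:
  assumes "even p" "p > 0"
  shows "nrm M p (\<lambda>x. c * u x) = \<bar>c\<bar> * nrm M p u"
proof -
  have "root p (c ^ p) = \<bar>c\<bar>"
    using assms by (metis abs_ge_zero power_even_abs real_root_power_cancel)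
  then show ?thesis by (simp add: nrm_def power_mult_distrib real_root_mult)
qed

lemma in_L_scale: "in_L M p u \<Longrightarrow> in_L M p (\<lambda>x. c * u x)"
  by (auto simp: in_L_def power_mult_distrib)

lemma in_L_add:
  assumes "even p" "p > 0" "in_L M p u" "in_L M p v"
  shows "in_L M p (\<lambda>x. u x + v x)"
proof -
  have [measurable]: "u \<in> borel_measurable M" "v \<in> borel_measurable M"
    using assms by (auto simp: in_L_def)
  have "integrable M (\<lambda>x. 2 ^ (p - 1) * (u x ^ p + v x ^ p))"
    using assms by (auto simp: in_L_def)
  then have "integrable M (\<lambda>x. (u x + v x) ^ p)"
  proof (rule Bochner_Integration.integrable_bound)
    show "AE x in M. norm ((u x + v x) ^ p) \<le> norm (2 ^ (p - 1) * (u x ^ p + v x ^ p))"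
      using weighted_power_convex[OF assms(1), of 1 1] assms(1,2)
      by (auto simp: zero_le_even_power)
  qed measurable
  then show ?thesis by (simp add: in_L_def)
qed

lemma in_L_diff:
  "even p \<Longrightarrow> p > 0 \<Longrightarrow> in_L M p u \<Longrightarrow> in_L M p v \<Longrightarrow> in_L M p (\<lambda>x. u x - v x)"
  using in_L_add[of p M u "\<lambda>x. -1 * v x"] in_L_scale[of M p v "-1"] by simp

lemma nrm_triangle:
  assumes "even p" "p > 0" "in_L M p u" "in_L M p v"
  shows "nrm M p (\<lambda>x. u x + v x) \<le> nrm M p u + nrm M p v"
proof (rule field_le_epsilon)
  fix e :: real assume e: "e > 0"
  \<comment> \<open>The summand e / 2 keeps both weights positive when a norm vanishes.\<close>
  define a b where "a = nrm M p u + e / 2" and "b = nrm M p v + e / 2"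
  have ab: "a > 0" "b > 0"
    using nrm_nonneg[OF assms(1), of M u] nrm_nonneg[OF assms(1), of M v] e unfolding a_def b_def by linarith+
  have int: "integrable M (\<lambda>x. u x ^ p)" "integrable M (\<lambda>x. v x ^ p)" using assms by (auto simp: in_L_def)
  have bd: "integral\<^sup>L M (\<lambda>x. u x ^ p) \<le> a ^ p" "integral\<^sup>L M (\<lambda>x. v x ^ p) \<le> b ^ p"
    using e by (auto intro!: nrm_leD assms(1,2) simp: a_def b_def)
  obtain k where p: "p = Suc k" using assms(2) by (cases p) auto
  have "integral\<^sup>L M (\<lambda>x. (u x + v x) ^ p)
    \<le> integral\<^sup>L M (\<lambda>x. (a + b) ^ (p - 1) * (u x ^ p / a ^ (p - 1) + v x ^ p / b ^ (p - 1)))"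
    using in_L_add[OF assms] int weighted_power_convex[OF assms(1) ab assms(2)]
    by (intro integral_mono) (auto simp: in_L_def)
  also have "\<dots> = (a + b) ^ (p - 1) * (integral\<^sup>L M (\<lambda>x. u x ^ p) / a ^ (p - 1) + integral\<^sup>L M (\<lambda>x. v x ^ p) / b ^ (p - 1))"
    using int by simp
  also have "\<dots> \<le> (a + b) ^ (p - 1) * (a ^ p / a ^ (p - 1) + b ^ p / b ^ (p - 1))"
    using bd ab by (intro mult_left_mono add_mono divide_right_mono) auto
  also have "\<dots> = (a + b) ^ p" using ab by (simp add: p)
  finally have "nrm M p (\<lambda>x. u x + v x) \<le> a + b"
    using ab by (intro nrm_leI assms(1,2)) auto
  then show "nrm M p (\<lambda>x. u x + v x) \<le> nrm M p u + nrm M p v + e"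
    by (simp add: a_def b_def)
qed

lemma nrm_minus: "nrm M p (\<lambda>x. u x - v x) = nrm M p (\<lambda>x. v x - u x)" if "even p"
proof -
  have "(u x - v x) ^ p = (v x - u x) ^ p" for x
    using that by (metis minus_diff_eq power_minus_even)
  then show ?thesis by (simp add: nrm_def)
qed

lemma nrm_triangle_diff:
  assumes "even p" "p > 0" "in_L M p u" "in_L M p v"
  shows "nrm M p (\<lambda>x. u x - v x) \<le> nrm M p u + nrm M p v"
  using nrm_triangle[OF assms(1-3) in_L_scale[OF assms(4), of "-1"]] nrm_scale[OF assms(1,2), of M "-1" v]
  by simp

lemma nrm_triangle_via:
  assumes "even p" "p > 0" "in_L M p u" "in_L M p v" "in_L M p w"
  shows "nrm M p (\<lambda>x. u x - w x) \<le> nrm M p (\<lambda>x. u x - v x) + nrm M p (\<lambda>x. v x - w x)"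
  using nrm_triangle[OF assms(1,2) in_L_diff[OF assms(1-4)] in_L_diff[OF assms(1,2,4,5)]] by simp

text \<open>Integrated form of Cauchy--Schwarz applied to \<open>u \<cdot> u\<^sup>p\<^sup>-\<^sup>1\<close>: it interpolates the \<open>L\<^sup>p\<close> norm
  between \<open>L\<^sup>2\<close> and \<open>L\<^sup>2\<^sup>p\<^sup>-\<^sup>2\<close>.\<close>

lemma nrm_interpolation:
  assumes p: "even p" "p > 0" and u: "in_L M 2 u" "in_L M (2 * p - 2) u" "in_L M p u"
    and a: "nrm M 2 u \<le> a" "a > 0" and b: "nrm M (2 * p - 2) u \<le> b" "b > 0"
  shows "integral\<^sup>L M (\<lambda>x. u x ^ p) \<le> a * b ^ (p - 1)"
proof -
  obtain k where pk: "p = Suc k" using assms(2) by (cases p) auto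
  with p have k: "k > 0" by (cases k) auto
  have q: "2 * p - 2 = 2 * k" by (simp add: pk)
  \<comment> \<open>The weight for which both terms on the right get the same bound a b^k after
    integration.\<close>
  define t where "t = b ^ k / a"
  have t: "t > 0" using a b by (simp add: t_def)
  have pt: "2 * u x ^ p \<le> t * u x ^ 2 + u x ^ (2 * k) / t" for x
  proof -
    have "0 \<le> (t * u x - u x ^ k)\<^sup>2" by simp
    also have "\<dots> = t * (t * u x ^ 2) + (u x ^ k)\<^sup>2 - t * (2 * (u x * u x ^ k))"
      by (simp add: power2_eq_square algebra_simps)
    also have "(u x ^ k)\<^sup>2 = t * (u x ^ (2 * k) / t)"
      using t by (simp add: power_mult[symmetric] mult.commute[of 2])
    finally have "t * (2 * u x ^ p) \<le> t * (t * u x ^ 2 + u x ^ (2 * k) / t)"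
      by (simp only: pk power_Suc distrib_left)
    then show ?thesis using t by simp
  qed
  have "2 * integral\<^sup>L M (\<lambda>x. u x ^ p) = integral\<^sup>L M (\<lambda>x. 2 * u x ^ p)" by simp
  also have "\<dots> \<le> integral\<^sup>L M (\<lambda>x. t * u x ^ 2 + u x ^ (2 * k) / t)"
    using u pt unfolding q by (intro integral_mono) (auto simp: in_L_def)
  also have "\<dots> = t * integral\<^sup>L M (\<lambda>x. u x ^ 2) + integral\<^sup>L M (\<lambda>x. u x ^ (2 * k)) / t"
    using u unfolding q by (simp add: in_L_def)
  also have "\<dots> \<le> t * a ^ 2 + b ^ (2 * k) / t"
    using nrm_leD[OF _ _ a(1)] nrm_leD[OF _ _ b(1)] t k unfolding q
    by (intro add_mono mult_left_mono divide_right_mono) auto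
  also have "\<dots> = 2 * (a * b ^ k)"
  proof -
    have "b ^ (2 * k) = b ^ k * b ^ k" by (simp add: mult_2 power_add)
    moreover have "B / a * a ^ 2 + B * B / (B / a) = 2 * (a * B)" if "B > 0" for B
      using a(2) that by (simp add: power2_eq_square)
    ultimately show ?thesis using b(2) by (simp add: t_def)
  qed
  finally show ?thesis by (simp add: pk)
qed

context prob_space
begin

lemma in_L_mono:
  assumes "in_L M q u" "even p" "even q" "p \<le> q"
  shows "in_L M p u"
proof -
  have [measurable]: "u \<in> borel_measurable M" using assms by (auto simp: in_L_def)
  have pt: "y ^ p \<le> 1 + y ^ q" for y :: real
  proof (cases "\<bar>y\<bar> \<le> 1")
    case True
    then have "y ^ p \<le> 1" using assms(2) by (metis power_even_abs power_le_one abs_ge_zero)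
    then show ?thesis using assms(3) by (smt (verit) zero_le_even_power)
  next
    case False
    then have "\<bar>y\<bar> ^ p \<le> \<bar>y\<bar> ^ q" using assms(4) by (intro power_increasing) auto
    then show ?thesis using assms(2,3) by (simp add: power_even_abs)
  qed
  have "integrable M (\<lambda>x. 1 + u x ^ q)" using assms(1) by (auto simp: in_L_def)
  then have "integrable M (\<lambda>x. u x ^ p)"
    by (rule Bochner_Integration.integrable_bound)
       (use pt assms(2,3) in \<open>auto simp: zero_le_even_power\<close>)
  then show ?thesis by (simp add: in_L_def)
qed

text \<open>For d > 0 one has d^(q-p) y^p \<le> d^q + y^q, seen by comparing |y| with d; a d
  slightly above the q-norm gives the estimate. The factor 2 is the price of this elementary
  argument and enters later constants only.\<close>

lemma nrm_mono:
  assumes u: "in_L M q u" and p: "even p" "p > 0" and q: "even q" "p \<le> q"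
  shows "nrm M p u \<le> 2 * nrm M q u"
proof (rule field_le_epsilon)
  fix e :: real assume e: "e > 0"
  define d where "d = nrm M q u + e / 2"
  have d: "d > 0" using nrm_nonneg[OF q(1), of M u] e unfolding d_def by linarith
  have pt: "d ^ (q - p) * y ^ p \<le> d ^ q + y ^ q" for y
  proof (cases "\<bar>y\<bar> \<le> d")
    case True
    then have "\<bar>y\<bar> ^ p \<le> d ^ p" by (intro power_mono) auto
    then have "d ^ (q - p) * y ^ p \<le> d ^ (q - p) * d ^ p"
      using p d by (intro mult_left_mono) (auto simp: power_even_abs)
    also have "\<dots> = d ^ q" using q by (simp add: power_add[symmetric])
    finally show ?thesis using q(1) by (smt (verit) zero_le_even_power)
  next
    case False
    then have "d ^ (q - p) * \<bar>y\<bar> ^ p \<le> \<bar>y\<bar> ^ (q - p) * \<bar>y\<bar> ^ p"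
      using d by (intro mult_right_mono power_mono) auto
    then have "d ^ (q - p) * y ^ p \<le> \<bar>y\<bar> ^ (q - p) * \<bar>y\<bar> ^ p"
      using p(1) by (simp add: power_even_abs)
    also have "\<dots> = y ^ q" using q by (simp add: power_add[symmetric] power_even_abs)
    finally show ?thesis using d by (smt (verit) zero_less_power)
  qed
  have Iq: "integrable M (\<lambda>x. u x ^ q)" and Ip: "integrable M (\<lambda>x. u x ^ p)"
    using u in_L_mono[OF u p(1) q] by (auto simp: in_L_def)
  have "d ^ (q - p) * expectation (\<lambda>x. u x ^ p) = expectation (\<lambda>x. d ^ (q - p) * u x ^ p)" by simp
  also have "\<dots> \<le> expectation (\<lambda>x. d ^ q + u x ^ q)"
    using Iq Ip pt by (intro integral_mono) auto
  also have "\<dots> = d ^ q + expectation (\<lambda>x. u x ^ q)"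
    using Iq by (simp add: prob_space)
  also have "\<dots> \<le> d ^ q + d ^ q"
    using e p(2) q by (intro add_left_mono nrm_leD) (auto simp: d_def)
  also have "\<dots> = d ^ (q - p) * (2 * d ^ p)"
    using q by (simp add: power_add[symmetric])
  finally have "expectation (\<lambda>x. u x ^ p) \<le> 2 * d ^ p"
    using d by simp
  also have "\<dots> \<le> 2 ^ p * d ^ p"
    using d p self_le_power[of "2::real" p] by (intro mult_right_mono) auto
  also have "\<dots> = (2 * d) ^ p" by (simp add: power_mult_distrib)
  finally have "nrm M p u \<le> 2 * d" using d by (intro nrm_leI p) auto
  then show "nrm M p u \<le> 2 * nrm M q u + e" by (simp add: d_def)
qed

end

subsection \<open>Chaos multipliers\<close>

lemma sum_lessThan_append:
  fixes f g :: "nat \<Rightarrow> real"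
  shows "(\<Sum>i<N. f i) + (\<Sum>i<K. g i) = (\<Sum>i<N + K. if i < N then f i else g (i - N))"
proof -
  have "(\<Sum>i<N + K. if i < N then f i else g (i - N))
    = (\<Sum>i<N. if i < N then f i else g (i - N)) + (\<Sum>i\<in>{N..<N + K}. if i < N then f i else g (i - N))"
    by (subst sum.union_disjoint[symmetric]) (auto intro: sum.cong)
  also have "(\<Sum>i\<in>{N..<N + K}. if i < N then f i else g (i - N)) = (\<Sum>i<K. g i)"
    by (rule sum.reindex_bij_witness[of _ "\<lambda>i. i + N" "\<lambda>i. i - N"]) auto
  finally show ?thesis by simp
qed

definition val :: "((('a \<Rightarrow> real) \<Rightarrow> real) \<Rightarrow> real) \<Rightarrow> 'a \<Rightarrow> real" where
  "val F \<omega> = F (\<lambda>h. h \<omega>)"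

context gaussian
begin

lemma chaos_polyI:
  "F = (\<lambda>v. \<Sum>i<N. c i * hermite n (v (l i))) \<Longrightarrow> \<forall>i<N::nat. l i \<in> U \<Longrightarrow> F \<in> chaos_poly n"
  unfolding chaos_poly_def by blast

lemma chaos_poly_zero: "(\<lambda>v. 0) \<in> chaos_poly n"
  unfolding chaos_poly_def by (auto intro!: exI[of _ 0])

lemma chaos_poly_scale: "F \<in> chaos_poly n \<Longrightarrow> (\<lambda>v. a * F v) \<in> chaos_poly n"
proof -
  assume "F \<in> chaos_poly n"
  then obtain N c l where F: "F = (\<lambda>v. \<Sum>i<N. c i * hermite n (v (l i)))" "\<forall>i<N::nat. l i \<in> U"
    unfolding chaos_poly_def by blast
  show ?thesis
    by (rule chaos_polyI[where N = N and c = "\<lambda>i. a * c i" and l = l]) (use F in \<open>auto simp: sum_distrib_left mult.assoc\<close>)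
qed

lemma chaos_poly_add:
  assumes "F \<in> chaos_poly n" "G \<in> chaos_poly n"
  shows "(\<lambda>v. F v + G v) \<in> chaos_poly n"
proof -
  obtain N c l where F: "F = (\<lambda>v. \<Sum>i<N. c i * hermite n (v (l i)))" "\<forall>i<N::nat. l i \<in> U"
    using assms(1) unfolding chaos_poly_def by blast
  obtain N' c' l' where G: "G = (\<lambda>v. \<Sum>i<N'. c' i * hermite n (v (l' i)))" "\<forall>i<N'::nat. l' i \<in> U"
    using assms(2) unfolding chaos_poly_def by blast
  have "(\<lambda>v. F v + G v) = (\<lambda>v. \<Sum>i<N + N'. (if i < N then c i else c' (i - N)) *
      hermite n (v (if i < N then l i else l' (i - N))))"
    unfolding F(1) G(1) sum_lessThan_append by (intro ext sum.cong) auto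
  moreover have "\<forall>i<N + N'. (if i < N then l i else l' (i - N)) \<in> U"
    using F(2) G(2) by auto
  ultimately show ?thesis by (rule chaos_polyI)
qed

text \<open>A polynomial functional together with a chosen chaos decomposition of finite length.
  Multipliers act on this formal datum; that the outcome agrees with \<open>ou_pow\<close> is shown
  in \<open>ou_pow_AE\<close>.\<close>

definition graded :: "(nat \<Rightarrow> (('a \<Rightarrow> real) \<Rightarrow> real) \<Rightarrow> real) set" where
  "graded = {A. (\<forall>n. A n \<in> chaos_poly n) \<and> (\<exists>d. \<forall>n\<ge>d. A n = (\<lambda>v. 0))}"

definition ev :: "(nat \<Rightarrow> (('a \<Rightarrow> real) \<Rightarrow> real) \<Rightarrow> real) \<Rightarrow> 'a \<Rightarrow> real" where
  "ev A \<omega> = (\<Sum>n | A n \<noteq> (\<lambda>v. 0). A n (\<lambda>h. h \<omega>))"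

definition mul :: "(nat \<Rightarrow> real) \<Rightarrow> (nat \<Rightarrow> 'v \<Rightarrow> real) \<Rightarrow> nat \<Rightarrow> 'v \<Rightarrow> real" where
  "mul m A = (\<lambda>n v. m n * A n v)"

definition gadd :: "(nat \<Rightarrow> 'v \<Rightarrow> real) \<Rightarrow> (nat \<Rightarrow> 'v \<Rightarrow> real) \<Rightarrow> nat \<Rightarrow> 'v \<Rightarrow> real" where
  "gadd A B = (\<lambda>n v. A n v + B n v)"

lemma ev_eq:
  assumes "\<forall>n\<ge>d. A n = (\<lambda>v. 0)"
  shows "ev A \<omega> = (\<Sum>n<d. A n (\<lambda>h. h \<omega>))"
  unfolding ev_def
proof (rule sum.mono_neutral_left)
  show "{n. A n \<noteq> (\<lambda>v. 0)} \<subseteq> {..<d}" using assms by (auto simp: not_le[symmetric])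
  show "\<forall>i\<in>{..<d} - {n. A n \<noteq> (\<lambda>v. 0)}. A i (\<lambda>h. h \<omega>) = 0" by auto
qed simp

lemma graded_poly: "A \<in> graded \<Longrightarrow> A n \<in> chaos_poly n"
  by (simp add: graded_def)

lemma graded_bound:
  assumes "A \<in> graded"
  obtains d where "\<forall>n\<ge>d. A n = (\<lambda>v. 0)"
  using assms by (auto simp: graded_def)

lemma graded_mul: "A \<in> graded \<Longrightarrow> mul m A \<in> graded"
  unfolding graded_def mul_def by (auto simp: chaos_poly_scale) (metis mult_zero_right)

lemma graded_gadd:
  assumes "A \<in> graded" "B \<in> graded"
  shows "gadd A B \<in> graded"
proof -
  obtain d e where d: "\<forall>n\<ge>d. A n = (\<lambda>v. 0)" and e: "\<forall>n\<ge>e. B n = (\<lambda>v. 0)"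
    using assms graded_bound by metis
  then have "\<exists>d. \<forall>n\<ge>d. gadd A B n = (\<lambda>v. 0)" by (intro exI[of _ "max d e"]) (simp add: gadd_def)
  moreover have "\<forall>n. gadd A B n \<in> chaos_poly n"
    using assms by (simp add: gadd_def chaos_poly_add graded_def)
  ultimately show ?thesis unfolding graded_def by blast
qed

lemma ev_mul_eq:
  assumes "\<forall>n\<ge>d. A n = (\<lambda>v. 0)"
  shows "ev (mul m A) \<omega> = (\<Sum>n<d. m n * A n (\<lambda>h. h \<omega>))"
  by (subst ev_eq[of d]) (use assms in \<open>auto simp: mul_def\<close>)

lemma ev_gadd:
  assumes "A \<in> graded" "B \<in> graded"
  shows "ev (gadd A B) \<omega> = ev A \<omega> + ev B \<omega>"
proof -
  obtain d e where d: "\<forall>n\<ge>d. A n = (\<lambda>v. 0)" and e: "\<forall>n\<ge>e. B n = (\<lambda>v. 0)"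
    using assms graded_bound by metis
  have "ev (gadd A B) \<omega> = (\<Sum>n<max d e. gadd A B n (\<lambda>h. h \<omega>))"
    "ev A \<omega> = (\<Sum>n<max d e. A n (\<lambda>h. h \<omega>))"
    "ev B \<omega> = (\<Sum>n<max d e. B n (\<lambda>h. h \<omega>))"
    by (intro ev_eq; use d e in \<open>auto simp: gadd_def\<close>)+
  then show ?thesis by (simp add: gadd_def sum.distrib)
qed

lemma mul_mul: "mul m (mul m' A) = mul (\<lambda>n. m n * m' n) A"
  by (simp add: mul_def mult.assoc)

lemma mul_add: "mul (\<lambda>n. m n + m' n) A = gadd (mul m A) (mul m' A)"
  by (simp add: mul_def gadd_def distrib_right)

lemma ev_scale:
  assumes "A \<in> graded"
  shows "ev (mul (\<lambda>n. c) A) \<omega> = c * ev A \<omega>"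
proof -
  obtain d where d: "\<forall>n\<ge>d. A n = (\<lambda>v. 0)" by (rule graded_bound[OF assms])
  show ?thesis unfolding ev_mul_eq[OF d] ev_eq[OF d] by (simp add: sum_distrib_left)
qed

lemma spoly_measurable:
  assumes "F \<in> spoly H"
  shows "(\<lambda>\<omega>. F (\<lambda>h. h \<omega>)) \<in> borel_measurable M"
  using borel_measurable_integrable[OF spoly_integrable[OF assms]] .

lemma spoly_in_L:
  assumes "F \<in> spoly H"
  shows "in_L M p (\<lambda>\<omega>. F (\<lambda>h. h \<omega>))"
  using spoly_measurable[OF assms] spoly_integrable[OF spoly_power[OF assms, of p]] by (simp add: in_L_def)

lemma val_in_L: "F \<in> spoly H \<Longrightarrow> in_L M p (val F)"
  using spoly_in_L[of F p] by (simp add: val_def[abs_def])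

lemma ev_val: "\<forall>n\<ge>d. A n = (\<lambda>v. 0) \<Longrightarrow> ev A \<omega> = (\<Sum>n<d. val (A n) \<omega>)"
  by (simp add: ev_eq val_def)

lemma ev_mul_val: "\<forall>n\<ge>d. A n = (\<lambda>v. 0) \<Longrightarrow> ev (mul m A) \<omega> = (\<Sum>n<d. m n * val (A n) \<omega>)"
  by (simp add: ev_mul_eq val_def)

lemma ev_in_L:
  assumes A: "A \<in> graded"
  shows "in_L M p (ev A)"
proof -
  obtain d where d: "\<forall>n\<ge>d. A n = (\<lambda>v. 0)" by (rule graded_bound[OF A])
  have "(\<lambda>v. \<Sum>n<d. A n v) \<in> spoly H"
    by (intro spoly_sum chaos_poly_spoly[OF graded_poly[OF A]])
  from spoly_in_L[OF this] show ?thesis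
    unfolding ev_eq[OF d, abs_def] .
qed

text \<open>One constant serves every even p. Closure under sums and products lets polynomials in
  the resolvents be estimated from the resolvents themselves.\<close>

definition Lp_multiplier :: "(nat \<Rightarrow> real) \<Rightarrow> real \<Rightarrow> bool" where
  "Lp_multiplier m K \<longleftrightarrow> K \<ge> 0 \<and> (\<forall>A\<in>graded. \<forall>p. even p \<longrightarrow> p > 0 \<longrightarrow> nrm M p (ev (mul m A)) \<le> K * nrm M p (ev A))"

lemma Lp_multiplierD: "Lp_multiplier m K \<Longrightarrow> A \<in> graded \<Longrightarrow> even p \<Longrightarrow> p > 0 \<Longrightarrow> nrm M p (ev (mul m A)) \<le> K * nrm M p (ev A)"
  and Lp_multiplier_nonneg: "Lp_multiplier m K \<Longrightarrow> K \<ge> 0"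
  by (simp_all add: Lp_multiplier_def)

lemma Lp_multiplier_const: "Lp_multiplier (\<lambda>n. c) \<bar>c\<bar>"
proof -
  have "ev (mul (\<lambda>n. c) A) = (\<lambda>\<omega>. c * ev A \<omega>)" if "A \<in> graded" for A
    using ev_scale[OF that] by auto
  then show ?thesis by (auto simp: Lp_multiplier_def nrm_scale)
qed

lemma Lp_multiplier_mult: 
  assumes "Lp_multiplier m K" "Lp_multiplier m' K'"
  shows "Lp_multiplier (\<lambda>n. m n * m' n) (K * K')"
  unfolding Lp_multiplier_def mul_mul[symmetric]
proof (intro conjI ballI allI impI)
  fix A p assume A: "A \<in> graded" and p: "even p" "(p::nat) > 0"
  have "nrm M p (ev (mul m (mul m' A))) \<le> K * nrm M p (ev (mul m' A))"
    by (rule Lp_multiplierD[OF assms(1) graded_mul[OF A] p])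
  also have "\<dots> \<le> K * (K' * nrm M p (ev A))"
    by (intro mult_left_mono Lp_multiplierD[OF assms(2) A p] Lp_multiplier_nonneg[OF assms(1)])
  finally show "nrm M p (ev (mul m (mul m' A))) \<le> K * K' * nrm M p (ev A)" by simp
qed (use assms Lp_multiplier_nonneg in auto)

lemma Lp_multiplier_add:
  assumes "Lp_multiplier m K" "Lp_multiplier m' K'"
  shows "Lp_multiplier (\<lambda>n. m n + m' n) (K + K')"
  unfolding Lp_multiplier_def mul_add
proof (intro conjI ballI allI impI)
  fix A p assume A: "A \<in> graded" and p: "even p" "(p::nat) > 0"
  have "ev (gadd (mul m A) (mul m' A)) = (\<lambda>\<omega>. ev (mul m A) \<omega> + ev (mul m' A) \<omega>)"
    using ev_gadd graded_mul A by auto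
  then have "nrm M p (ev (gadd (mul m A) (mul m' A))) \<le> nrm M p (ev (mul m A)) + nrm M p (ev (mul m' A))"
    using nrm_triangle[OF p ev_in_L[OF graded_mul[OF A]] ev_in_L[OF graded_mul[OF A]]] by simp
  also have "\<dots> \<le> (K + K') * nrm M p (ev A)"
    using Lp_multiplierD[OF assms(1) A p] Lp_multiplierD[OF assms(2) A p] by (simp add: distrib_right)
  finally show "nrm M p (ev (gadd (mul m A) (mul m' A))) \<le> (K + K') * nrm M p (ev A)" .
qed (use assms Lp_multiplier_nonneg in auto)

lemma Lp_multiplier_power: "Lp_multiplier m K \<Longrightarrow> Lp_multiplier (\<lambda>n. m n ^ k) (K ^ k)"
proof (induction k)
  case 0
  show ?case using Lp_multiplier_const[of 1] by simp
next
  case (Suc k)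
  then show ?case using Lp_multiplier_mult[of m K "\<lambda>n. m n ^ k" "K ^ k"] by simp
qed

lemma Lp_multiplier_scale: "Lp_multiplier m K \<Longrightarrow> Lp_multiplier (\<lambda>n. c * m n) (\<bar>c\<bar> * K)"
  by (rule Lp_multiplier_mult[OF Lp_multiplier_const])

lemma Lp_multiplier_diff: "Lp_multiplier m K \<Longrightarrow> Lp_multiplier m' K' \<Longrightarrow> Lp_multiplier (\<lambda>n. m n - m' n) (K + K')"
  using Lp_multiplier_add[of m K "\<lambda>n. -1 * m' n" "\<bar>-1\<bar> * K'"] Lp_multiplier_scale[of m' K' "-1"] by simp

lemma Lp_multiplier_sum: "(\<And>j. j \<in> J \<Longrightarrow> Lp_multiplier (m j) (K j)) \<Longrightarrow> Lp_multiplier (\<lambda>n. \<Sum>j\<in>J. m j n) (\<Sum>j\<in>J. K j)"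
  by (induction J rule: infinite_finite_induct) (use Lp_multiplier_const[of 0] in \<open>auto intro: Lp_multiplier_add\<close>)

text \<open>Testing against \<open>u\<^sup>p\<^sup>-\<^sup>1\<close> reduces the averaging to scalar integrals.\<close>

lemma Lp_multiplier_average:
  fixes w \<rho> :: "real \<Rightarrow> real"
  assumes w: "\<And>x. w x \<ge> 0" and \<rho>: "\<And>x. \<bar>\<rho> x\<bar> \<le> 1"
    and m: "\<And>n. has_bochner_integral lborel (\<lambda>x. w x * \<rho> x ^ n) (m n)" and m0: "m 0 \<le> 1"
  shows "Lp_multiplier m 1"
  unfolding Lp_multiplier_def
proof (intro conjI ballI allI impI)
  fix A p assume A: "A \<in> graded" and p: "even p" "(p::nat) > 0"
  obtain d where d: "\<forall>n\<ge>d. A n = (\<lambda>v. 0)" by (rule graded_bound[OF A])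
  define F where "F v = (\<Sum>n<d. m n * A n v)" for v
  have F: "F \<in> spoly H" unfolding F_def
    by (intro spoly_sum spoly.scale chaos_poly_spoly[OF graded_poly[OF A]])
  define u where "u \<omega> = F (\<lambda>h. h \<omega>)" for \<omega>
  have u: "ev (mul m A) = u" by (auto simp: u_def F_def ev_mul_eq[OF d])
  define a where "a n \<omega> = A n (\<lambda>h. h \<omega>)" for n \<omega>
  define c where "c n = real p * expectation (\<lambda>\<omega>. u \<omega> ^ (p - 1) * a n \<omega>)" for n
  define K where "K = real (p - 1) * expectation (\<lambda>\<omega>. u \<omega> ^ p) + expectation (\<lambda>\<omega>. ev A \<omega> ^ p)"
  have K: "K \<ge> 0" unfolding K_def
    using p(1) by (intro add_nonneg_nonneg mult_nonneg_nonneg Bochner_Integration.integral_nonneg) (auto simp: zero_le_even_power)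
  have iu: "integrable M (\<lambda>\<omega>. u \<omega> ^ p)" using spoly_integrable[OF spoly_power[OF F]] by (simp add: u_def)
  have ia: "integrable M (\<lambda>\<omega>. u \<omega> ^ (p - 1) * a n \<omega>)" for n
  proof -
    have "(\<lambda>v. F v ^ (p - 1) * A n v) \<in> spoly H"
      by (intro spoly_mult spoly_power F chaos_poly_spoly[OF graded_poly[OF A]])
    from spoly_integrable[OF this] show ?thesis by (simp add: u_def a_def)
  qed
  have cs: "(\<Sum>n<d. c n * k n) = expectation (\<lambda>\<omega>. real p * (u \<omega> ^ (p - 1) * (\<Sum>n<d. k n * a n \<omega>)))" for k
  proof -
    have "expectation (\<lambda>\<omega>. real p * (u \<omega> ^ (p - 1) * (\<Sum>n<d. k n * a n \<omega>)))
      = expectation (\<lambda>\<omega>. \<Sum>n<d. (real p * k n) * (u \<omega> ^ (p - 1) * a n \<omega>))"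
      by (intro Bochner_Integration.integral_cong refl) (simp add: sum_distrib_left mult_ac)
    also have "\<dots> = (\<Sum>n<d. expectation (\<lambda>\<omega>. (real p * k n) * (u \<omega> ^ (p - 1) * a n \<omega>)))"
      by (intro Bochner_Integration.integral_sum integrable_mult_right ia)
    also have "\<dots> = (\<Sum>n<d. c n * k n)"
      by (intro sum.cong refl) (simp add: c_def)
    finally show ?thesis ..
  qed
  \<comment> \<open>For a single r this is Young's inequality followed by the contraction of the
    semigroup; integrating against \<open>w\<close> then costs the total mass \<open>m 0\<close>,
    which is at most 1.\<close>
  have bound: "(\<Sum>n<d. c n * r ^ n) \<le> K" if r: "\<bar>r\<bar> \<le> 1" for r
  proof -
    define v where "v \<omega> = (\<Sum>n<d. r ^ n * a n \<omega>)" for \<omega>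
    have V: "(\<lambda>v. \<Sum>n<d. r ^ n * A n v) \<in> spoly H"
      by (intro spoly_sum spoly.scale chaos_poly_spoly[OF graded_poly[OF A]])
    have iv: "integrable M (\<lambda>\<omega>. v \<omega> ^ p)" "integrable M (\<lambda>\<omega>. u \<omega> ^ (p - 1) * v \<omega>)"
      using spoly_integrable[OF spoly_power[OF V]] spoly_integrable[OF spoly_mult[OF spoly_power[OF F] V]]
      by (simp_all add: v_def a_def u_def)
    have "(\<Sum>n<d. c n * r ^ n) = expectation (\<lambda>\<omega>. real p * (u \<omega> ^ (p - 1) * v \<omega>))"
      unfolding cs v_def ..
    also have "\<dots> \<le> expectation (\<lambda>\<omega>. real (p - 1) * u \<omega> ^ p + v \<omega> ^ p)"
      using young_even[OF p] iu iv by (intro integral_mono) auto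
    also have "\<dots> = real (p - 1) * expectation (\<lambda>\<omega>. u \<omega> ^ p) + expectation (\<lambda>\<omega>. v \<omega> ^ p)"
      using iu iv by simp
    also have "expectation (\<lambda>\<omega>. v \<omega> ^ p) \<le> expectation (\<lambda>\<omega>. ev A \<omega> ^ p)"
      using ornstein_uhlenbeck_contraction[OF graded_poly[OF A] r p(1), of d]
      by (simp add: v_def a_def ev_eq[OF d])
    finally show ?thesis by (simp add: K_def)
  qed
  have "has_bochner_integral lborel (\<lambda>x. \<Sum>n<d. c n * (w x * \<rho> x ^ n)) (\<Sum>n<d. c n * m n)"
    by (intro has_bochner_integral_sum has_bochner_integral_mult_right m)
  moreover have "has_bochner_integral lborel (\<lambda>x. K * (w x * \<rho> x ^ 0)) (K * m 0)"
    by (intro has_bochner_integral_mult_right m)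
  moreover have "(\<Sum>n<d. c n * (w x * \<rho> x ^ n)) \<le> K * (w x * \<rho> x ^ 0)" for x
  proof -
    have "(\<Sum>n<d. c n * (w x * \<rho> x ^ n)) = w x * (\<Sum>n<d. c n * \<rho> x ^ n)"
      by (simp add: sum_distrib_left mult_ac)
    also have "\<dots> \<le> w x * K" by (intro mult_left_mono bound \<rho> w)
    finally show ?thesis by (simp add: mult.commute)
  qed
  ultimately have "(\<Sum>n<d. c n * m n) \<le> K * m 0"
    unfolding has_bochner_integral_iff by (metis (no_types, lifting) integral_mono)
  also have "\<dots> \<le> K" using mult_left_mono[OF m0 K] by simp
  finally have "(\<Sum>n<d. c n * m n) \<le> K" .
  moreover have "(\<Sum>n<d. c n * m n) = real p * expectation (\<lambda>\<omega>. u \<omega> ^ p)"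
  proof -
    have "u \<omega> ^ (p - 1) * (\<Sum>n<d. m n * a n \<omega>) = u \<omega> ^ p" for \<omega>
      using p(2) by (cases p) (auto simp: u_def F_def a_def)
    then show ?thesis unfolding cs by simp
  qed
  \<comment> \<open>The pairing equals p E u^p, and p - 1 of these copies cancel against the first
    term of \<open>K\<close>.\<close>
  ultimately have "expectation (\<lambda>\<omega>. u \<omega> ^ p) \<le> expectation (\<lambda>\<omega>. ev A \<omega> ^ p)"
    using p(2) by (simp add: K_def of_nat_diff algebra_simps)
  then show "nrm M p (ev (mul m A)) \<le> 1 * nrm M p (ev A)"
    unfolding u nrm_def using p(2) by simp
qed simp

text \<open>The value l / (l + 1 + n) is the integral of l e^(-(l+1) t) e^(-n t) over t > 0; the
  total mass l / (l + 1) is at most 1.\<close>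

lemma Lp_multiplier_resolvent:
  assumes "l > 0"
  shows "Lp_multiplier (\<lambda>n. l / (l + 1 + real n)) 1"
proof (rule Lp_multiplier_average)
  define w where "w x = (if x < 0 then 0 else l * exp (- (l + 1) * x))" for x :: real
  define \<rho> where "\<rho> x = (if x < 0 then 0 else exp (- x))" for x :: real
  show "w x \<ge> 0" "\<bar>\<rho> x\<bar> \<le> 1" for x using assms by (auto simp: w_def \<rho>_def)
  show "has_bochner_integral lborel (\<lambda>x. w x * \<rho> x ^ n) (l / (l + 1 + real n))" for n
  proof -
    define L where "L = l + 1 + real n"
    have L: "L > 0" using assms by (simp add: L_def)
    interpret E: prob_space "density lborel (exponential_density L)"
      by (rule prob_space_exponential_density[OF L])
    have "has_bochner_integral lborel (exponential_density L) 1"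
    proof (rule has_bochner_integral_nn_integral)
      show "(\<integral>\<^sup>+ x. ennreal (exponential_density L x) \<partial>lborel) = ennreal 1"
        using E.emeasure_space_1 by (simp add: emeasure_density)
    qed (use L in \<open>auto simp: exponential_density_def\<close>)
    then have "has_bochner_integral lborel (\<lambda>x. l / L * exponential_density L x) (l / L * 1)"
      by (intro has_bochner_integral_mult_right)
    moreover have "l / L * exponential_density L x = w x * \<rho> x ^ n" for x
    proof (cases "x < 0")
      case False
      have "exp (- (l + 1) * x) * exp (- x) ^ n = exp (- (x * L))"
        by (simp add: exp_of_nat_mult[symmetric] exp_add[symmetric] L_def algebra_simps)
      then show ?thesis using False L
        by (simp add: exponential_density_def w_def \<rho>_def)
    qed (simp add: exponential_density_def w_def)
    ultimately show ?thesis by (simp add: L_def)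
  qed
qed (use assms in auto)

text \<open>The number (1 + n)^(-1/2) is the integral of e^(-(1+n) x^2) / sqrt pi, an average of the
  semigroup at the times x^2. The substitution t = x^2 has removed the singularity of the usual
  Gamma integral at 0.\<close>

lemma Lp_multiplier_inverse_sqrt: "Lp_multiplier (\<lambda>n. (1 + real n) powr (- 1 / 2)) 1"
proof (rule Lp_multiplier_average)
  define w where "w x = exp (- x\<^sup>2) / sqrt pi" for x :: real
  define \<rho> where "\<rho> x = exp (- x\<^sup>2)" for x :: real
  show "w x \<ge> 0" "\<bar>\<rho> x\<bar> \<le> 1" for x by (auto simp: w_def \<rho>_def)
  show "has_bochner_integral lborel (\<lambda>x. w x * \<rho> x ^ n) ((1 + real n) powr (- 1 / 2))" for n
  proof -
    \<comment> \<open>Chosen with 2 s^2 = 1 / (1 + n), so that the normal density is a multiple of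
      e^(-(1+n) x^2).\<close>
    define s where "s = 1 / sqrt (2 * (1 + real n))"
    have s: "s > 0" by (simp add: s_def)
    have s2: "2 * s\<^sup>2 = 1 / (1 + real n)" by (simp add: s_def power_divide divide_simps)
    have "has_bochner_integral lborel (normal_density 0 s) 1"
      using s by (simp add: has_bochner_integral_iff)
    then have "has_bochner_integral lborel (\<lambda>x. (1 + real n) powr (- 1 / 2) * normal_density 0 s x) ((1 + real n) powr (- 1 / 2) * 1)"
      by (intro has_bochner_integral_mult_right)
    moreover have "(1 + real n) powr (- 1 / 2) * normal_density 0 s x = w x * \<rho> x ^ n" for x
    proof -
      have "normal_density 0 s x = 1 / sqrt (pi * (2 * s\<^sup>2)) * exp (- (x\<^sup>2 / (2 * s\<^sup>2)))"
        by (simp add: normal_density_def mult_ac)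
      also have "\<dots> = sqrt (1 + real n) / sqrt pi * exp (- (x\<^sup>2 * (1 + real n)))"
        unfolding s2 by (simp add: real_sqrt_divide real_sqrt_mult)
      also have "(1 + real n) powr (- 1 / 2) * \<dots> = exp (- (x\<^sup>2 * (1 + real n))) / sqrt pi"
        by (simp add: powr_minus powr_half_sqrt[symmetric] field_simps)
      also have "\<dots> = w x * \<rho> x ^ n"
        by (simp add: w_def \<rho>_def exp_of_nat_mult[symmetric] exp_add[symmetric] algebra_simps)
      finally show ?thesis .
    qed
    ultimately show ?thesis by simp
  qed
qed simp

lemma Lp_multiplier_inverse_powr: "Lp_multiplier (\<lambda>n. (1 + real n) powr (- real r / 2)) 1"
proof -
  have "Lp_multiplier (\<lambda>n. ((1 + real n) powr (- 1 / 2)) ^ r) (1 ^ r)"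
    by (rule Lp_multiplier_power[OF Lp_multiplier_inverse_sqrt])
  then show ?thesis by (simp add: powr_power)
qed

end

subsection \<open>Polynomial functionals and the powers of \<open>1 - L\<close>\<close>

lemma lincomb_scale:
  assumes "f \<in> lincomb S"
  shows "(\<lambda>x. a * f x) \<in> lincomb S"
proof -
  obtain n c g where f: "f = (\<lambda>x. \<Sum>i<n. c i * g i x)" "\<forall>i<n::nat. g i \<in> S"
    using assms unfolding lincomb_def by blast
  have "(\<lambda>x. a * f x) = (\<lambda>x. \<Sum>i<n. (a * c i) * g i x)"
    by (simp add: f(1) sum_distrib_left mult.assoc)
  with f(2) show ?thesis unfolding lincomb_def mem_Collect_eq by (intro exI conjI)
qed

lemma lincomb_add:
  assumes "f \<in> lincomb S" "f' \<in> lincomb S"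
  shows "(\<lambda>x. f x + f' x) \<in> lincomb S"
proof -
  obtain n c g where f: "f = (\<lambda>x. \<Sum>i<n. c i * g i x)" "\<forall>i<n::nat. g i \<in> S"
    using assms(1) unfolding lincomb_def by blast
  obtain n' c' g' where f': "f' = (\<lambda>x. \<Sum>i<n'. c' i * g' i x)" "\<forall>i<n'::nat. g' i \<in> S"
    using assms(2) unfolding lincomb_def by blast
  have "(\<lambda>x. f x + f' x) = (\<lambda>x. \<Sum>i<n + n'. (if i < n then c i else c' (i - n)) *
      (if i < n then g i else g' (i - n)) x)"
    unfolding f(1) f'(1) sum_lessThan_append by (intro ext sum.cong) auto
  moreover have "\<forall>i<n + n'. (if i < n then g i else g' (i - n)) \<in> S"
    using f(2) f'(2) by auto
  ultimately show ?thesis unfolding lincomb_def mem_Collect_eq by (intro exI conjI)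
qed

lemma lincomb_base: "g \<in> S \<Longrightarrow> g \<in> lincomb S"
proof -
  assume "g \<in> S"
  moreover have "g = (\<lambda>x. \<Sum>i<Suc 0. 1 * g x)" by simp
  ultimately show ?thesis unfolding lincomb_def mem_Collect_eq
    by (intro exI[of _ "Suc 0"] exI[of _ "\<lambda>_. 1"] exI[of _ "\<lambda>_. g"]) auto
qed

lemma spoly_poly_functionals:
  assumes "F \<in> spoly H"
  shows "val F \<in> poly_functionals H"
  using assms
proof (induction F rule: spoly.induct)
  case one
  show ?case unfolding poly_functionals_def
    by (intro lincomb_base CollectI exI[of _ "0::nat"] exI[of _ "\<lambda>_ _. 0"]) (simp add: val_def fun_eq_iff)
next
  case (scale F c)
  then show ?case using lincomb_scale[of "val F" _ c]
    by (simp add: val_def[abs_def] poly_functionals_def)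
next
  case (add F G)
  then show ?case using lincomb_add[of "val F" _ "val G"]
    by (simp add: val_def[abs_def] poly_functionals_def)
next
  case (var h F)
  then obtain n c g where f: "val F = (\<lambda>x. \<Sum>i<n. c i * g i x)"
    "\<forall>i<n::nat. g i \<in> {(\<lambda>x. \<Prod>i<k. h i x) | (k::nat) h. \<forall>i<k. h i \<in> H}"
    unfolding poly_functionals_def lincomb_def by blast
  have "(\<lambda>x. h x * g i x) \<in> {(\<lambda>x. \<Prod>i<k. h i x) | (k::nat) h. \<forall>i<k. h i \<in> H}" if "i < n" for i
  proof -
    obtain k hs where k: "g i = (\<lambda>x. \<Prod>i<k. hs i x)" "\<forall>i<k::nat. hs i \<in> H"
      using f(2) \<open>i < n\<close> by blast
    have "(\<lambda>x. h x * g i x) = (\<lambda>x. \<Prod>i<Suc k. case_nat h hs i x)"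
      unfolding k(1) by (simp add: prod.lessThan_Suc_shift del: prod.lessThan_Suc)
    moreover have "\<forall>i<Suc k. case_nat h hs i \<in> H"
      using k(2) var by (auto split: nat.split)
    ultimately show ?thesis by blast
  qed
  moreover have "h \<omega> * val F \<omega> = (\<Sum>i<n. c i * (h \<omega> * g i \<omega>))" for \<omega>
    using fun_cong[OF f(1), of \<omega>] by (simp add: sum_distrib_left mult.left_commute)
  moreover have "val (\<lambda>v. v h * F v) \<omega> = h \<omega> * val F \<omega>" for \<omega> by (simp add: val_def)
  ultimately show ?case unfolding poly_functionals_def lincomb_def mem_Collect_eq
    by (intro exI[of _ n] exI[of _ c] exI[of _ "\<lambda>i x. h x * g i x"]) auto
qed

lemma poly_functionals_cases:
  assumes "\<phi> \<in> poly_functionals H"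
  obtains n c k h where "\<phi> = (\<lambda>x. \<Sum>i<n. c i * (\<Prod>j<k i. h i j x))" "\<forall>i<n::nat. \<forall>j<k i :: nat. h i j \<in> H"
proof -
  obtain n c g where f: "\<phi> = (\<lambda>x. \<Sum>i<n. c i * g i x)"
    "\<forall>i<n::nat. g i \<in> {(\<lambda>x. \<Prod>i<k. h i x) | (k::nat) h. \<forall>i<k. h i \<in> H}"
    using assms unfolding poly_functionals_def lincomb_def by blast
  then have "\<forall>i. \<exists>k h. i < n \<longrightarrow> g i = (\<lambda>x. \<Prod>j<k::nat. h j x) \<and> (\<forall>j<k. h j \<in> H)" by blast
  from choice[OF this] obtain k where
    "\<forall>i. \<exists>h. i < n \<longrightarrow> g i = (\<lambda>x. \<Prod>j<k i::nat. h j x) \<and> (\<forall>j<k i. h j \<in> H)" ..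
  from choice[OF this] obtain h where
    kh: "\<forall>i. i < n \<longrightarrow> g i = (\<lambda>x. \<Prod>j<k i::nat. h i j x) \<and> (\<forall>j<k i. h i j \<in> H)" ..
  show ?thesis
  proof (rule that)
    show "\<phi> = (\<lambda>x. \<Sum>i<n. c i * (\<Prod>j<k i. h i j x))"
      unfolding f(1) using kh by (intro ext sum.cong) auto
    show "\<forall>i<n. \<forall>j<k i. h i j \<in> H" using kh by blast
  qed
qed

lemma poly_functionals_spoly:
  assumes "\<phi> \<in> poly_functionals H"
  shows "\<exists>F\<in>spoly H. \<phi> = val F"
proof -
  obtain n c k h where \<phi>: "\<phi> = (\<lambda>x. \<Sum>i<n. c i * (\<Prod>j<k i. h i j x))" "\<forall>i<n::nat. \<forall>j<k i :: nat. h i j \<in> H"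
    by (rule poly_functionals_cases[OF assms])
  have "(\<lambda>v. \<Prod>j<N. v (l j)) \<in> spoly H" if "\<forall>j<N::nat. l j \<in> H" for N l
    using that
  proof (induction N)
    case (Suc N)
    then have "(\<lambda>v. v (l N) * (\<Prod>j<N. v (l j))) \<in> spoly H" by (intro spoly.var) auto
    then show ?case by (simp add: mult.commute)
  qed (simp add: spoly.one)
  then have "(\<lambda>v. \<Sum>i<n. c i * (\<Prod>j<k i. v (h i j))) \<in> spoly H"
    using \<phi>(2) by (intro spoly_sum spoly.scale) auto
  moreover have "\<phi> = val (\<lambda>v. \<Sum>i<n. c i * (\<Prod>j<k i. v (h i j)))"
    by (simp add: \<phi>(1) val_def[abs_def])
  ultimately show ?thesis by blast
qed

section \<open>Pairings in L^2, chaos components and the action of \<open>ou_pow\<close>\<close>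

context prob_space
begin

lemma L2_in_L: "f \<in> L2 M \<longleftrightarrow> in_L M 2 f"
  by (simp add: L2_def in_L_def)

lemma integrable_mult_L2:
  assumes "in_L M 2 f" "in_L M 2 g"
  shows "integrable M (\<lambda>x. f x * g x)"
proof (rule Bochner_Integration.integrable_bound)
  show "integrable M (\<lambda>x. (f x)\<^sup>2 + (g x)\<^sup>2)" using assms by (simp add: in_L_def)
  show "(\<lambda>x. f x * g x) \<in> borel_measurable M"
    using assms by (auto simp: in_L_def intro: borel_measurable_times)
  show "AE x in M. norm (f x * g x) \<le> norm ((f x)\<^sup>2 + (g x)\<^sup>2)"
  proof (rule AE_I2)
    fix x
    have "2 * \<bar>f x * g x\<bar> \<le> (f x)\<^sup>2 + (g x)\<^sup>2"
      using sum_squares_bound[of "\<bar>f x\<bar>" "\<bar>g x\<bar>"] by (simp add: abs_mult)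
    then show "norm (f x * g x) \<le> norm ((f x)\<^sup>2 + (g x)\<^sup>2)" by simp
  qed
qed

lemma AE_zero_of_L2:
  assumes "in_L M 2 f" "expectation (\<lambda>x. (f x)\<^sup>2) = 0"
  shows "AE x in M. f x = 0"
  using integral_nonneg_eq_0_iff_AE[of M "\<lambda>x. (f x)\<^sup>2"] assms by (simp add: in_L_def)

text \<open>The weighted inequality 2 |f w| \<le> t f^2 + w^2 / t bounds 2 |c| by t E f^2 for every
  t > 0 once k tends to infinity. The constant value c suits pairings that do not change along an
  approximating sequence.\<close>

lemma expectation_mult_tendsto_zero:
  assumes f: "in_L M 2 f" and w: "\<And>k. in_L M 2 (w k)"
    and lim: "(\<lambda>k. expectation (\<lambda>x. (w k x)\<^sup>2)) \<longlonglongrightarrow> 0" and c: "\<And>k. expectation (\<lambda>x. f x * w k x) = c"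
  shows "c = 0"
proof -
  have "2 * \<bar>c\<bar> \<le> t * expectation (\<lambda>x. (f x)\<^sup>2)" if t: "t > 0" for t
  proof -
    have "2 * \<bar>c\<bar> \<le> t * expectation (\<lambda>x. (f x)\<^sup>2) + expectation (\<lambda>x. (w k x)\<^sup>2) / t" for k
    proof -
      have "2 * \<bar>c\<bar> = \<bar>expectation (\<lambda>x. 2 * (f x * w k x))\<bar>" by (simp add: c abs_mult)
      also have "\<dots> \<le> expectation (\<lambda>x. \<bar>2 * (f x * w k x)\<bar>)" by (rule integral_abs_bound)
      also have "\<dots> \<le> expectation (\<lambda>x. t * (f x)\<^sup>2 + (w k x)\<^sup>2 / t)"
      proof (rule integral_mono)
        show "integrable M (\<lambda>x. \<bar>2 * (f x * w k x)\<bar>)"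
          using integrable_mult_L2[OF f w] by simp
        show "integrable M (\<lambda>x. t * (f x)\<^sup>2 + (w k x)\<^sup>2 / t)"
          using f w[of k] by (simp add: in_L_def)
        fix x
        have "0 \<le> (t * \<bar>f x\<bar> - \<bar>w k x\<bar>)\<^sup>2" by simp
        also have "\<dots> = t * (t * (f x)\<^sup>2 + (w k x)\<^sup>2 / t - \<bar>2 * (f x * w k x)\<bar>)"
          using t by (simp add: power2_diff abs_mult power_mult_distrib algebra_simps) (simp add: power2_eq_square)
        finally show "\<bar>2 * (f x * w k x)\<bar> \<le> t * (f x)\<^sup>2 + (w k x)\<^sup>2 / t"
          using t by (simp add: zero_le_mult_iff)
      qed
      also have "\<dots> = t * expectation (\<lambda>x. (f x)\<^sup>2) + expectation (\<lambda>x. (w k x)\<^sup>2) / t"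
        using f w[of k] by (simp add: in_L_def)
      finally show ?thesis .
    qed
    moreover have "(\<lambda>k. t * expectation (\<lambda>x. (f x)\<^sup>2) + expectation (\<lambda>x. (w k x)\<^sup>2) / t)
        \<longlonglongrightarrow> t * expectation (\<lambda>x. (f x)\<^sup>2) + 0 / t"
      by (intro tendsto_intros lim) (use t in auto)
    ultimately show ?thesis
      using LIMSEQ_le_const[of "\<lambda>k. t * expectation (\<lambda>x. (f x)\<^sup>2) + expectation (\<lambda>x. (w k x)\<^sup>2) / t"
        "t * expectation (\<lambda>x. (f x)\<^sup>2)" "2 * \<bar>c\<bar>"] by auto
  qed
  note b = this
  define V where "V = expectation (\<lambda>x. (f x)\<^sup>2)"
  have V: "V \<ge> 0" unfolding V_def by simp
  show "c = 0"
  proof (rule ccontr)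
    assume "c \<noteq> 0"
    \<comment> \<open>The choice t = |c| / (V + 1) bounds 2 |c| by |c|; the added 1 covers V =
      0.\<close>
    then have "2 * \<bar>c\<bar> \<le> \<bar>c\<bar> / (V + 1) * V"
      unfolding V_def[symmetric] using V \<open>c \<noteq> 0\<close> by (intro b[folded V_def]) auto
    also have "\<dots> \<le> \<bar>c\<bar>" using V by (simp add: divide_simps mult_left_mono)
    finally show False using \<open>c \<noteq> 0\<close> by simp
  qed
qed

end

context gaussian
begin

lemma chaos_poly_eval_lincomb:
  "lincomb {(\<lambda>x. hermite n (h x)) | h. h \<in> H \<and> expectation (\<lambda>x. (h x)\<^sup>2) = 1}
    = val ` chaos_poly n"
proof (intro equalityI subsetI)
  fix f assume "f \<in> lincomb {(\<lambda>x. hermite n (h x)) | h. h \<in> H \<and> expectation (\<lambda>x. (h x)\<^sup>2) = 1}"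
  then obtain N c g where f: "f = (\<lambda>x. \<Sum>i<N. c i * g i x)" "\<forall>i<N::nat. \<exists>h. g i = (\<lambda>x. hermite n (h x)) \<and> h \<in> U"
    unfolding lincomb_def U_def by blast
  then obtain l where l: "\<forall>i<N. g i = (\<lambda>x. hermite n (l i x)) \<and> l i \<in> U" by metis
  define F where "F v = (\<Sum>i<N. c i * hermite n (v (l i)))" for v
  have "F \<in> chaos_poly n" using l by (intro chaos_polyI[where N = N and c = c and l = l]) (auto simp: F_def fun_eq_iff)
  moreover have "f = val F"
    unfolding f(1) F_def val_def using l by (intro ext sum.cong) auto
  ultimately show "f \<in> val ` chaos_poly n" by blast
next
  fix f assume "f \<in> val ` chaos_poly n"
  then obtain N c l where l: "f = (\<lambda>\<omega>. \<Sum>i<N. c i * hermite n (l i \<omega>))" "\<forall>i<N::nat. l i \<in> U"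
    unfolding chaos_poly_def val_def[abs_def] by blast
  then show "f \<in> lincomb {(\<lambda>x. hermite n (h x)) | h. h \<in> H \<and> expectation (\<lambda>x. (h x)\<^sup>2) = 1}"
    unfolding lincomb_def mem_Collect_eq U_def
    by (intro exI[of _ N] exI[of _ c] exI[of _ "\<lambda>i x. hermite n (l i x)"]) auto
qed

lemma chaosE:
  assumes "u \<in> chaos M H n"
  obtains s where "in_L M 2 u" "\<And>k. s k \<in> chaos_poly n"
    "(\<lambda>k. expectation (\<lambda>x. (u x - val (s k) x)\<^sup>2)) \<longlonglongrightarrow> 0"
proof -
  have u: "in_L M 2 u" using assms by (auto simp: chaos_def l2_closure_def L2_in_L)
  obtain s where s: "\<forall>k. s k \<in> val ` chaos_poly n"
    "(\<lambda>k. expectation (\<lambda>x. (u x - s k x)\<^sup>2)) \<longlonglongrightarrow> 0"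
    using assms unfolding chaos_def l2_closure_def chaos_poly_eval_lincomb by auto
  then have "\<forall>k. \<exists>F. F \<in> chaos_poly n \<and> s k = val F" by auto
  then obtain F where F: "\<forall>k. F k \<in> chaos_poly n \<and> s k = val (F k)"
    using choice by meson
  show ?thesis using that[OF u, of F] F s(2) by auto
qed

lemma chaosI:
  assumes "in_L M 2 u" "\<And>k. s k \<in> chaos_poly n"
    "(\<lambda>k. expectation (\<lambda>x. (u x - val (s k) x)\<^sup>2)) \<longlonglongrightarrow> 0"
  shows "u \<in> chaos M H n"
  unfolding chaos_def l2_closure_def chaos_poly_eval_lincomb mem_Collect_eq L2_in_L
  using assms by (intro conjI exI[of _ "\<lambda>k. val (s k)"] allI imageI)

lemma chaos_poly_in_L: "F \<in> chaos_poly n \<Longrightarrow> in_L M p (val F)"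
  by (rule val_in_L[OF chaos_poly_spoly])

lemma chaos_poly_chaos: "F \<in> chaos_poly n \<Longrightarrow> val F \<in> chaos M H n"
  by (rule chaosI[where s = "\<lambda>_. F"]) (auto intro: chaos_poly_in_L)

lemma chaos_in_L: "u \<in> chaos M H n \<Longrightarrow> in_L M 2 u"
  by (auto elim: chaosE)

text \<open>Differences are the test elements in the uniqueness argument of
  \<open>chaos_comp_AE\<close>. Linearity passes to the closure by (a - b)^2 \<le> 2 a^2 + 2
  b^2.\<close>

lemma chaos_diff:
  assumes "u \<in> chaos M H n" "v \<in> chaos M H n"
  shows "(\<lambda>x. u x - v x) \<in> chaos M H n"
proof -
  obtain s where "in_L M 2 u" and s: "\<And>k. s k \<in> chaos_poly n" "(\<lambda>k. expectation (\<lambda>x. (u x - val (s k) x)\<^sup>2)) \<longlonglongrightarrow> 0"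
    by (rule chaosE[OF assms(1)]) blast
  obtain t where "in_L M 2 v" and t: "\<And>k. t k \<in> chaos_poly n" "(\<lambda>k. expectation (\<lambda>x. (v x - val (t k) x)\<^sup>2)) \<longlonglongrightarrow> 0"
    by (rule chaosE[OF assms(2)]) blast
  note uv = chaos_in_L[OF assms(1)] chaos_in_L[OF assms(2)]
  define w where "w k v = s k v + (- 1) * t k v" for k v
  have vw: "val (w k) x = val (s k) x - val (t k) x" for k x by (simp add: val_def w_def)
  have w: "w k \<in> chaos_poly n" for k
    unfolding w_def by (intro chaos_poly_add chaos_poly_scale s t)
  show ?thesis
  proof (rule chaosI)
    show "in_L M 2 (\<lambda>x. u x - v x)" by (rule in_L_diff) (use uv in auto)
    show "w k \<in> chaos_poly n" for k by (rule w)
    show "(\<lambda>k. expectation (\<lambda>x. (u x - v x - val (w k) x)\<^sup>2)) \<longlonglongrightarrow> 0"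
    proof (rule tendsto_sandwich[OF _ _ tendsto_const])
      show "(\<lambda>k. 2 * expectation (\<lambda>x. (u x - val (s k) x)\<^sup>2) + 2 * expectation (\<lambda>x. (v x - val (t k) x)\<^sup>2)) \<longlonglongrightarrow> 0"
        using tendsto_add[OF tendsto_mult_left[OF s(2), of 2] tendsto_mult_left[OF t(2), of 2]] by simp
      show "\<forall>\<^sub>F k in sequentially. expectation (\<lambda>x. (u x - v x - val (w k) x)\<^sup>2)
        \<le> 2 * expectation (\<lambda>x. (u x - val (s k) x)\<^sup>2) + 2 * expectation (\<lambda>x. (v x - val (t k) x)\<^sup>2)"
      proof (rule always_eventually, rule allI)
        fix k
        have sq: "(a - b)\<^sup>2 \<le> 2 * a\<^sup>2 + 2 * b\<^sup>2" for a b :: real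
          using zero_le_power2[of "a + b"] by (simp add: power2_eq_square algebra_simps)
        have d1: "in_L M 2 (\<lambda>x. u x - val (s k) x)"
          by (rule in_L_diff) (use uv chaos_poly_in_L[OF s(1)] in auto)
        have d2: "in_L M 2 (\<lambda>x. v x - val (t k) x)"
          by (rule in_L_diff) (use uv chaos_poly_in_L[OF t(1)] in auto)
        have d3: "in_L M 2 (\<lambda>x. (u x - val (s k) x) - (v x - val (t k) x))"
          by (rule in_L_diff) (use d1 d2 in auto)
        have "expectation (\<lambda>x. (u x - v x - val (w k) x)\<^sup>2)
          = expectation (\<lambda>x. ((u x - val (s k) x) - (v x - val (t k) x))\<^sup>2)"
          by (simp add: vw algebra_simps)
        also have "\<dots> \<le> expectation (\<lambda>x. 2 * (u x - val (s k) x)\<^sup>2 + 2 * (v x - val (t k) x)\<^sup>2)"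
        proof (rule integral_mono)
          fix x
          show "((u x - val (s k) x) - (v x - val (t k) x))\<^sup>2 \<le> 2 * (u x - val (s k) x)\<^sup>2 + 2 * (v x - val (t k) x)\<^sup>2"
            by (rule sq)
        qed (use d1 d2 d3 in \<open>auto simp: in_L_def\<close>)
        also have "\<dots> = 2 * expectation (\<lambda>x. (u x - val (s k) x)\<^sup>2) + 2 * expectation (\<lambda>x. (v x - val (t k) x)\<^sup>2)"
          using d1 d2 by (simp add: in_L_def)
        finally show "expectation (\<lambda>x. (u x - v x - val (w k) x)\<^sup>2)
          \<le> 2 * expectation (\<lambda>x. (u x - val (s k) x)\<^sup>2) + 2 * expectation (\<lambda>x. (v x - val (t k) x)\<^sup>2)" .
      qed
    qed simp
  qed
qed

lemma chaos_poly_orthogonal: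
  assumes F: "F \<in> chaos_poly n" and G: "G \<in> chaos_poly m" and "n \<noteq> m"
  shows "expectation (\<lambda>\<omega>. val F \<omega> * val G \<omega>) = 0"
proof -
  obtain N c l where F: "F = (\<lambda>v. \<Sum>i<N. c i * hermite n (v (l i)))" "\<And>i. i < (N::nat) \<Longrightarrow> l i \<in> U"
    using F unfolding chaos_poly_def by blast
  obtain N' c' l' where G: "G = (\<lambda>v. \<Sum>i<N'. c' i * hermite m (v (l' i)))" "\<And>i. i < (N'::nat) \<Longrightarrow> l' i \<in> U"
    using G unfolding chaos_poly_def by blast
  have i: "integrable M (\<lambda>\<omega>. hermite n (h \<omega>) * hermite m (k \<omega>))" if "h \<in> U" "k \<in> U" for h k
    using spoly_integrable[OF spoly_mult[OF hermite_spoly[OF U_H[OF that(1)]] hermite_spoly[OF U_H[OF that(2)]]]] .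
  have "expectation (\<lambda>\<omega>. val F \<omega> * val G \<omega>)
    = expectation (\<lambda>\<omega>. \<Sum>i<N. \<Sum>j<N'. c i * c' j * (hermite n (l i \<omega>) * hermite m (l' j \<omega>)))"
    unfolding F(1) G(1) val_def sum_product by (simp add: mult_ac)
  also have "\<dots> = (\<Sum>i<N. \<Sum>j<N'. c i * c' j * expectation (\<lambda>\<omega>. hermite n (l i \<omega>) * hermite m (l' j \<omega>)))"
  proof -
    have "expectation (\<lambda>\<omega>. \<Sum>j<N'. c i * c' j * (hermite n (l i \<omega>) * hermite m (l' j \<omega>)))
      = (\<Sum>j<N'. c i * c' j * expectation (\<lambda>\<omega>. hermite n (l i \<omega>) * hermite m (l' j \<omega>)))" if "i < N" for i
      using that by (subst Bochner_Integration.integral_sum) (auto intro!: integrable_mult_right i F(2) G(2))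
    moreover have "expectation (\<lambda>\<omega>. \<Sum>i<N. \<Sum>j<N'. c i * c' j * (hermite n (l i \<omega>) * hermite m (l' j \<omega>)))
      = (\<Sum>i<N. expectation (\<lambda>\<omega>. \<Sum>j<N'. c i * c' j * (hermite n (l i \<omega>) * hermite m (l' j \<omega>))))"
      by (intro Bochner_Integration.integral_sum Bochner_Integration.integrable_sum integrable_mult_right i F(2) G(2)) auto
    ultimately show ?thesis by simp
  qed
  also have "\<dots> = 0"
    using hermite_orthogonal[OF F(2) G(2) \<open>n \<noteq> m\<close>] by simp
  finally show ?thesis .
qed

text \<open>Orthogonality of polynomial elements passes to the closure: replacing u by its distance
  to an approximant does not change the pairing with F, and this distance tends to zero in
  L^2.\<close>

lemma chaos_orthogonal:
  assumes F: "F \<in> chaos_poly m" and u: "u \<in> chaos M H n" and "m \<noteq> n"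
  shows "expectation (\<lambda>\<omega>. val F \<omega> * u \<omega>) = 0"
proof -
  obtain s where "in_L M 2 u" and s: "\<And>k. s k \<in> chaos_poly n" "(\<lambda>k. expectation (\<lambda>x. (u x - val (s k) x)\<^sup>2)) \<longlonglongrightarrow> 0"
    by (rule chaosE[OF u]) blast
  note uL = chaos_in_L[OF u] and FL = chaos_poly_in_L[OF F, of 2] and sL = chaos_poly_in_L[OF s(1), of 2]
  show ?thesis
  proof (rule expectation_mult_tendsto_zero[OF FL _ s(2)])
    show "in_L M 2 (\<lambda>x. u x - val (s k) x)" for k
      by (rule in_L_diff) (use uL sL in auto)
    show "expectation (\<lambda>x. val F x * (u x - val (s k) x)) = expectation (\<lambda>\<omega>. val F \<omega> * u \<omega>)" for k
      using integrable_mult_L2[OF FL uL] integrable_mult_L2[OF FL sL]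
      by (simp add: right_diff_distrib chaos_poly_orthogonal[OF F s(1) \<open>m \<noteq> n\<close>])
  qed
qed

text \<open>Stated through the orthogonality relation of \<open>chaos_comp\<close> and not as an
  equation \<phi> = \<open>ev A\<close>. The relation also fits an empty \<open>U\<close>, where all
  chaoses are null and the zero sequence decomposes every polynomial functional.\<close>

definition decomposes :: "('a \<Rightarrow> real) \<Rightarrow> (nat \<Rightarrow> (('a \<Rightarrow> real) \<Rightarrow> real) \<Rightarrow> real) \<Rightarrow> bool" where
  "decomposes \<phi> A \<longleftrightarrow> in_L M 2 \<phi> \<and> A \<in> graded \<and>
     (\<forall>n. \<forall>u\<in>chaos M H n. expectation (\<lambda>\<omega>. (\<phi> \<omega> - val (A n) \<omega>) * u \<omega>) = 0)"

lemma decomposesI: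
  assumes A: "A \<in> graded" and \<phi>: "in_L M 2 \<phi>" and ae: "AE \<omega> in M. \<phi> \<omega> = ev A \<omega>"
  shows "decomposes \<phi> A"
  unfolding decomposes_def
proof (intro conjI allI ballI A \<phi>)
  fix n u assume u: "u \<in> chaos M H n"
  obtain d where d: "\<forall>n\<ge>d. A n = (\<lambda>v. 0)" by (rule graded_bound[OF A])
  define e where "e = max d (Suc n)"
  have e: "\<forall>n\<ge>e. A n = (\<lambda>v. 0)" "n < e" using d by (auto simp: e_def)
  have i: "integrable M (\<lambda>\<omega>. val (A k) \<omega> * u \<omega>)" for k
    by (rule integrable_mult_L2[OF chaos_poly_in_L[OF graded_poly[OF A]] chaos_in_L[OF u]])
  have [measurable]: "\<phi> \<in> borel_measurable M" "u \<in> borel_measurable M" "\<And>k. (val (A k)) \<in> borel_measurable M"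
    using \<phi> chaos_in_L[OF u] chaos_poly_in_L[OF graded_poly[OF A]] by (auto simp: in_L_def)
  have "expectation (\<lambda>\<omega>. (\<phi> \<omega> - val (A n) \<omega>) * u \<omega>) = expectation (\<lambda>\<omega>. \<Sum>k\<in>{..<e} - {n}. val (A k) \<omega> * u \<omega>)"
  proof (rule integral_cong_AE)
    show "AE \<omega> in M. (\<phi> \<omega> - val (A n) \<omega>) * u \<omega> = (\<Sum>k\<in>{..<e} - {n}. val (A k) \<omega> * u \<omega>)"
      using ae
    proof eventually_elim
      case (elim \<omega>)
      have "ev A \<omega> = val (A n) \<omega> + (\<Sum>k\<in>{..<e} - {n}. val (A k) \<omega>)"
        unfolding ev_val[OF e(1)] using e(2) by (intro sum.remove) auto
      then show ?case using elim by (simp add: sum_distrib_right)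
    qed
  qed measurable
  also have "\<dots> = (\<Sum>k\<in>{..<e} - {n}. expectation (\<lambda>\<omega>. val (A k) \<omega> * u \<omega>))"
    by (rule Bochner_Integration.integral_sum) (rule i)
  also have "\<dots> = 0"
    by (intro sum.neutral) (auto intro: chaos_orthogonal[OF graded_poly[OF A] u])
  finally show "expectation (\<lambda>\<omega>. (\<phi> \<omega> - val (A n) \<omega>) * u \<omega>) = 0" .
qed

text \<open>As \<open>val (A n)\<close> is a witness, the chosen function satisfies the defining
  relation; the difference of the two lies in the chaos and is orthogonal to itself. Equality holds
  almost everywhere only, since the choice is free on null sets.\<close>

lemma chaos_comp_AE:
  assumes "decomposes \<phi> A"
  shows "chaos_comp M H n \<phi> \<in> chaos M H n" "AE \<omega> in M. chaos_comp M H n \<phi> \<omega> = val (A n) \<omega>"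
proof -
  have A: "A \<in> graded" and \<phi>: "in_L M 2 \<phi>"
    and o: "\<And>u. u \<in> chaos M H n \<Longrightarrow> expectation (\<lambda>\<omega>. (\<phi> \<omega> - val (A n) \<omega>) * u \<omega>) = 0"
    using assms by (auto simp: decomposes_def)
  define g where "g = chaos_comp M H n \<phi>"
  define a where "a = (val (A n))"
  have a: "a \<in> chaos M H n" unfolding a_def by (rule chaos_poly_chaos[OF graded_poly[OF A]])
  have "\<exists>g. g \<in> chaos M H n \<and> (\<forall>u\<in>chaos M H n. expectation (\<lambda>x. (\<phi> x - g x) * u x) = 0)"
    using a o by (auto simp: a_def)
  from someI_ex[OF this] have g: "g \<in> chaos M H n"
    and go: "\<And>u. u \<in> chaos M H n \<Longrightarrow> expectation (\<lambda>x. (\<phi> x - g x) * u x) = 0"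
    unfolding g_def chaos_comp_def by auto
  define w where "w x = g x - a x" for x
  have w: "w \<in> chaos M H n" unfolding w_def using chaos_diff[OF g a] .
  note L = chaos_in_L[OF w] chaos_in_L[OF g] chaos_in_L[OF a]
  have "in_L M 2 (\<lambda>x. \<phi> x - a x)" "in_L M 2 (\<lambda>x. \<phi> x - g x)"
    using \<phi> L by (auto intro: in_L_diff)
  note i = this[THEN integrable_mult_L2[OF _ L(1)]]
  have "expectation (\<lambda>x. (w x)\<^sup>2) = expectation (\<lambda>x. (\<phi> x - a x) * w x - (\<phi> x - g x) * w x)"
    by (simp add: w_def power2_eq_square algebra_simps)
  also have "\<dots> = 0" using i go[OF w] o[OF w] by (simp add: a_def)
  finally have "AE x in M. w x = 0" by (intro AE_zero_of_L2 L)
  then show "AE \<omega> in M. chaos_comp M H n \<phi> \<omega> = val (A n) \<omega>"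
    by (simp add: w_def g_def a_def)
  show "chaos_comp M H n \<phi> \<in> chaos M H n" using g by (simp add: g_def)
qed

text \<open>From the length of \<open>A\<close> on, the partial sums are a.e. equal to
  \<open>ev\<close> of the multiplied decomposition. So an L^2 limit exists, and the chosen one must
  agree with it a.e.\<close>

lemma ou_pow_AE:
  assumes "decomposes \<phi> A"
  shows "ou_pow M H r \<phi> \<in> borel_measurable M"
    "AE \<omega> in M. ou_pow M H r \<phi> \<omega> = ev (mul (\<lambda>n. (1 + real n) powr (r / 2)) A) \<omega>"
proof -
  define m where "m = (\<lambda>n. (1 + real n) powr (r / 2))"
  have A: "A \<in> graded" using assms by (simp add: decomposes_def)
  obtain d where d: "\<forall>n\<ge>d. A n = (\<lambda>v. 0)" by (rule graded_bound[OF A])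
  define S where "S N \<omega> = (\<Sum>n<N. m n * chaos_comp M H n \<phi> \<omega>)" for N \<omega>
  note G = graded_mul[OF A, of m]
  have [measurable]: "chaos_comp M H n \<phi> \<in> borel_measurable M" for n
    using chaos_in_L[OF chaos_comp_AE(1)[OF assms]] by (simp add: in_L_def)
  have [measurable]: "S N \<in> borel_measurable M" for N unfolding S_def by measurable
  have [measurable]: "ev (mul m A) \<in> borel_measurable M" using ev_in_L[OF G, of 2] by (simp add: in_L_def)
  have S: "AE \<omega> in M. S N \<omega> = ev (mul m A) \<omega>" if "N \<ge> d" for N
  proof -
    have z: "\<forall>n\<ge>N. A n = (\<lambda>v. 0)" using d that by auto
    have "AE \<omega> in M. \<forall>n\<in>{..<N}. chaos_comp M H n \<phi> \<omega> = val (A n) \<omega>"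
      by (intro AE_finite_allI chaos_comp_AE(2)[OF assms]) auto
    then show ?thesis by eventually_elim (simp add: S_def ev_mul_val[OF z])
  qed
  have "(\<lambda>N. expectation (\<lambda>x. (ev (mul m A) x - S N x)\<^sup>2)) \<longlonglongrightarrow> 0"
  proof (rule tendsto_eventually)
    have "expectation (\<lambda>x. (ev (mul m A) x - S N x)\<^sup>2) = 0" if "N \<ge> d" for N
    proof -
      have "expectation (\<lambda>x. (ev (mul m A) x - S N x)\<^sup>2) = expectation (\<lambda>x. 0)"
        by (rule integral_cong_AE) (use S[OF that] in auto)
      then show ?thesis by simp
    qed
    then show "\<forall>\<^sub>F N in sequentially. expectation (\<lambda>x. (ev (mul m A) x - S N x)\<^sup>2) = 0"
      unfolding eventually_sequentially by blast
  qed
  then have "\<exists>g. g \<in> L2 M \<and> (\<lambda>N. expectation (\<lambda>x. (g x - S N x)\<^sup>2)) \<longlonglongrightarrow> 0"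
    using ev_in_L[OF G] unfolding L2_in_L by blast
  from someI_ex[OF this]
  have g: "in_L M 2 (ou_pow M H r \<phi>)" "(\<lambda>N. expectation (\<lambda>x. (ou_pow M H r \<phi> x - S N x)\<^sup>2)) \<longlonglongrightarrow> 0"
    unfolding ou_pow_def S_def m_def L2_in_L by auto
  show [measurable]: "ou_pow M H r \<phi> \<in> borel_measurable M" using g by (simp add: in_L_def)
  have "\<forall>\<^sub>F N in sequentially. expectation (\<lambda>x. (ou_pow M H r \<phi> x - S N x)\<^sup>2)
      = expectation (\<lambda>x. (ou_pow M H r \<phi> x - ev (mul m A) x)\<^sup>2)"
    unfolding eventually_sequentially
  proof (intro exI[of _ d] allI impI)
    fix N assume "d \<le> N"
    show "expectation (\<lambda>x. (ou_pow M H r \<phi> x - S N x)\<^sup>2)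
      = expectation (\<lambda>x. (ou_pow M H r \<phi> x - ev (mul m A) x)\<^sup>2)"
      by (rule integral_cong_AE) (use S[OF \<open>d \<le> N\<close>] in auto)
  qed
  then have "(\<lambda>N::nat. expectation (\<lambda>x. (ou_pow M H r \<phi> x - ev (mul m A) x)\<^sup>2)) \<longlonglongrightarrow> 0"
    using g(2) by (rule Lim_transform_eventually[rotated])
  then have "expectation (\<lambda>x. (ou_pow M H r \<phi> x - ev (mul m A) x)\<^sup>2) = 0"
    by (simp add: LIMSEQ_const_iff)
  moreover have "in_L M 2 (\<lambda>x. ou_pow M H r \<phi> x - ev (mul m A) x)"
    by (rule in_L_diff) (use g(1) ev_in_L[OF G] in auto)
  ultimately have "AE x in M. ou_pow M H r \<phi> x - ev (mul m A) x = 0"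
    by (intro AE_zero_of_L2)
  then show "AE \<omega> in M. ou_pow M H r \<phi> \<omega> = ev (mul (\<lambda>n. (1 + real n) powr (r / 2)) A) \<omega>"
    by (simp add: m_def)
qed

lemma poly_functionals_in_L: "\<phi> \<in> poly_functionals H \<Longrightarrow> in_L M p \<phi>"
  using poly_functionals_spoly val_in_L by blast

lemma ev_poly_functionals:
  assumes A: "A \<in> graded"
  shows "ev A \<in> poly_functionals H"
proof -
  obtain d where d: "\<forall>n\<ge>d. A n = (\<lambda>v. 0)" by (rule graded_bound[OF A])
  have "(\<lambda>v. \<Sum>n<d. A n v) \<in> spoly H"
    by (intro spoly_sum chaos_poly_spoly[OF graded_poly[OF A]])
  from spoly_poly_functionals[OF this] show ?thesis
    unfolding val_def[abs_def] ev_eq[OF d, abs_def] .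
qed

text \<open>Random variables with a finite chaos decomposition up to null sets. Powers of unit
  vectors belong to it by Hermite expansion, and polarization carries this over to products.\<close>

definition graded_AE :: "('a \<Rightarrow> real) set" where
  "graded_AE = {\<phi>. \<exists>A\<in>graded. AE \<omega> in M. \<phi> \<omega> = ev A \<omega>}"

lemma graded_AE_add: "\<phi> \<in> graded_AE \<Longrightarrow> \<psi> \<in> graded_AE \<Longrightarrow> (\<lambda>\<omega>. \<phi> \<omega> + \<psi> \<omega>) \<in> graded_AE"
proof -
  assume "\<phi> \<in> graded_AE" "\<psi> \<in> graded_AE"
  then obtain A B where AB: "A \<in> graded" "B \<in> graded" "AE \<omega> in M. \<phi> \<omega> = ev A \<omega>" "AE \<omega> in M. \<psi> \<omega> = ev B \<omega>"
    by (auto simp: graded_AE_def)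
  from AB(3,4) have "AE \<omega> in M. \<phi> \<omega> + \<psi> \<omega> = ev (gadd A B) \<omega>"
    by eventually_elim (simp add: ev_gadd AB)
  with graded_gadd[OF AB(1,2)] show ?thesis by (auto simp: graded_AE_def)
qed

lemma graded_AE_scale: "\<phi> \<in> graded_AE \<Longrightarrow> (\<lambda>\<omega>. c * \<phi> \<omega>) \<in> graded_AE"
proof -
  assume "\<phi> \<in> graded_AE"
  then obtain A where A: "A \<in> graded" "AE \<omega> in M. \<phi> \<omega> = ev A \<omega>"
    by (auto simp: graded_AE_def)
  from A(2) have "AE \<omega> in M. c * \<phi> \<omega> = ev (mul (\<lambda>n. c) A) \<omega>"
    by eventually_elim (simp add: ev_scale A)
  with graded_mul[OF A(1)] show ?thesis unfolding graded_AE_def by blast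
qed

lemma graded_AE_unit_power:
  assumes h: "h \<in> U"
  shows "(\<lambda>\<omega>. h \<omega> ^ k) \<in> graded_AE"
proof -
  obtain b where b: "\<forall>x. x ^ k = (\<Sum>n\<le>k. b n * hermite n x)"
    using power_eq_hermite_sum[of k] ..
  define A where "A n v = (if n \<le> k then b n * hermite n (v h) else 0)" for n and v :: "('a \<Rightarrow> real) \<Rightarrow> real"
  have "A n \<in> chaos_poly n" for n
    by (rule chaos_polyI[where N = 1 and c = "\<lambda>_. if n \<le> k then b n else 0" and l = "\<lambda>_. h"]) (auto simp: A_def h)
  moreover have z: "\<forall>n\<ge>Suc k. A n = (\<lambda>v. 0)" by (auto simp: A_def)
  ultimately have "A \<in> graded" unfolding graded_def by blast
  moreover have "h \<omega> ^ k = ev A \<omega>" for \<omega>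
    unfolding ev_eq[OF z] b[rule_format] by (intro sum.cong) (auto simp: A_def)
  ultimately show ?thesis unfolding graded_AE_def by auto
qed

text \<open>For a null element the power is a.e. the constant 0^k, and constants are multiples of
  He_0 of a unit vector; this is where \<open>U\<close> must be inhabited.\<close>

lemma graded_AE_power:
  assumes U: "U \<noteq> {}" and h: "h \<in> H"
  shows "(\<lambda>\<omega>. h \<omega> ^ k) \<in> graded_AE"
  using h
proof (cases h rule: H_cases)
  case 1
  obtain g where g: "g \<in> U" using U by auto
  have "(\<lambda>\<omega>. 0 ^ k * g \<omega> ^ 0) \<in> graded_AE"
    by (rule graded_AE_scale[OF graded_AE_unit_power[OF g]])
  then obtain A where A: "A \<in> graded" "AE \<omega> in M. 0 ^ k = ev A \<omega>"
    by (auto simp: graded_AE_def)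
  from 1(1) A(2) have "AE \<omega> in M. h \<omega> ^ k = ev A \<omega>" by eventually_elim simp
  with A(1) show ?thesis by (auto simp: graded_AE_def)
next
  case 2
  have "(\<lambda>\<omega>. sd h ^ k * (h \<omega> / sd h) ^ k) \<in> graded_AE"
    by (rule graded_AE_scale[OF graded_AE_unit_power[OF H_normalize[OF h 2(1)]]])
  then show ?thesis using 2(1) by (simp add: power_mult_distrib[symmetric])
qed

lemma graded_AE_prod:
  fixes k :: nat
  assumes U: "U \<noteq> {}" and h: "\<forall>i<k. h i \<in> H"
  shows "(\<lambda>\<omega>. \<Prod>i<k. h i \<omega>) \<in> graded_AE"
proof -
  obtain L :: "(real \<times> (nat \<Rightarrow> real)) list" where
    L: "\<forall>x. (\<Prod>i<k. x i) = (\<Sum>(c, t)\<leftarrow>L. c * (\<Sum>i<k. t i * x i) ^ k)"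
    using prod_polarization[of k] ..
  have one: "(\<lambda>\<omega>. c * (\<Sum>i<k. t i * h i \<omega>) ^ k) \<in> graded_AE" for c t
    using h by (intro graded_AE_scale graded_AE_power[OF U] H_lincomb) auto
  have "(\<lambda>\<omega>. \<Sum>(c, t)\<leftarrow>L. c * (\<Sum>i<k. t i * h i \<omega>) ^ k) \<in> graded_AE"
  proof (induction L)
    case Nil
    show ?case using graded_AE_scale[OF one, of 0] by simp
  next
    case (Cons p L)
    then show ?case by (cases p) (auto intro: graded_AE_add[OF one])
  qed
  then show ?thesis unfolding L[rule_format] .
qed

lemma poly_functionals_graded:
  assumes U: "U \<noteq> {}" and \<phi>: "\<phi> \<in> poly_functionals H"
  obtains A where "A \<in> graded" "AE \<omega> in M. \<phi> \<omega> = ev A \<omega>" "decomposes \<phi> A"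
proof -
  obtain n c k h where e: "\<phi> = (\<lambda>x. \<Sum>i<n. c i * (\<Prod>j<k i. h i j x))" "\<forall>i<n::nat. \<forall>j<k i :: nat. h i j \<in> H"
    by (rule poly_functionals_cases[OF \<phi>])
  have z: "(\<lambda>\<omega>. 0) \<in> graded_AE"
    using graded_AE_scale[OF graded_AE_prod[OF U, where k = 0 and h = "\<lambda>_ _. 0"], of 0] by simp
  have "m \<le> n \<Longrightarrow> (\<lambda>x. \<Sum>i<m. c i * (\<Prod>j<k i. h i j x)) \<in> graded_AE" for m
  proof (induction m)
    case (Suc m)
    then show ?case using e(2)
      by (simp, intro graded_AE_add graded_AE_scale graded_AE_prod[OF U]) auto
  qed (simp add: z)
  then have "\<phi> \<in> graded_AE" unfolding e(1) by simp
  then obtain A where A: "A \<in> graded" "AE \<omega> in M. \<phi> \<omega> = ev A \<omega>" unfolding graded_AE_def by blast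
  then show ?thesis using that decomposesI[OF A(1) poly_functionals_in_L[OF \<phi>] A(2)] by blast
qed

text \<open>Without unit vectors the chaos polynomials are empty sums and elements of the chaoses
  are null, so the zero sequence decomposes \<phi>.\<close>

lemma ou_pow_degenerate:
  assumes U: "U = {}" and \<phi>: "\<phi> \<in> poly_functionals H"
  shows "ou_pow M H r \<phi> \<in> borel_measurable M" "AE \<omega> in M. ou_pow M H r \<phi> \<omega> = 0"
proof -
  have cp: "F = (\<lambda>v. 0)" if F: "F \<in> chaos_poly n" for F n
  proof -
    obtain N c l where N: "F = (\<lambda>v. \<Sum>i<N. c i * hermite n (v (l i)))" "\<forall>i<N::nat. l i \<in> U"
      using F unfolding chaos_poly_def by blast
    then have "N = 0" using U by (cases N) auto
    then show ?thesis using N by simp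
  qed
  define A where "A = (\<lambda>(n::nat) (v::('a \<Rightarrow> real) \<Rightarrow> real). 0 :: real)"
  have A: "A \<in> graded" by (auto simp: A_def graded_def chaos_poly_zero)
  have "decomposes \<phi> A" unfolding decomposes_def
  proof (intro conjI A poly_functionals_in_L[OF \<phi>] allI ballI)
    fix n u assume u: "u \<in> chaos M H n"
    obtain s where "in_L M 2 u" and s: "\<And>k. s k \<in> chaos_poly n" "(\<lambda>k. expectation (\<lambda>x. (u x - val (s k) x)\<^sup>2)) \<longlonglongrightarrow> 0"
      by (rule chaosE[OF u]) blast
    have "(\<lambda>k::nat. expectation (\<lambda>x. (u x)\<^sup>2)) \<longlonglongrightarrow> 0"
      using s(2) cp[OF s(1)] by (simp add: val_def)
    then have "AE x in M. u x = 0"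
      by (intro AE_zero_of_L2 chaos_in_L[OF u]) (simp add: LIMSEQ_const_iff)
    then have "expectation (\<lambda>\<omega>. (\<phi> \<omega> - val (A n) \<omega>) * u \<omega>) = expectation (\<lambda>\<omega>. 0)"
      using chaos_in_L[OF u] poly_functionals_in_L[OF \<phi>, of 2]
      by (intro integral_cong_AE) (auto simp: A_def in_L_def val_def)
    then show "expectation (\<lambda>\<omega>. (\<phi> \<omega> - val (A n) \<omega>) * u \<omega>) = 0" by simp
  qed
  note ou = ou_pow_AE[OF this]
  show "ou_pow M H r \<phi> \<in> borel_measurable M" by (rule ou)
  have "ev (mul m A) \<omega> = 0" for m \<omega> by (simp add: ev_def mul_def A_def)
  then show "AE \<omega> in M. ou_pow M H r \<phi> \<omega> = 0" using ou(2) by simp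
qed

end

subsection \<open>Density of polynomial functionals in \<open>L\<^sup>q\<close>\<close>

lemma nrm_tendsto_dominated:
  assumes q: "even q" "q > 0" and g: "g \<in> borel_measurable M" and s: "\<And>i. s i \<in> borel_measurable M"
    and w: "in_L M q w" and bound: "\<And>i. AE x in M. \<bar>s i x\<bar> \<le> w x"
    and lim: "AE x in M. (\<lambda>i. s i x) \<longlonglongrightarrow> g x"
  shows "in_L M q g" "(\<lambda>i. nrm M q (\<lambda>x. g x - s i x)) \<longlonglongrightarrow> 0"
proof -
  have [measurable]: "w \<in> borel_measurable M" using w by (simp add: in_L_def)
  note [measurable] = g s
  have bound': "AE x in M. \<forall>i. \<bar>s i x\<bar> \<le> w x" using bound by (simp add: AE_all_countable)
  have gw: "AE x in M. \<bar>g x\<bar> \<le> w x"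
    using bound' lim
  proof eventually_elim
    case (elim x)
    then show ?case
      by (intro LIMSEQ_le_const2[OF tendsto_rabs[OF elim(2)]]) auto
  qed
  have iw: "integrable M (\<lambda>x. (2 * w x) ^ q)" using in_L_scale[OF w, of 2] by (simp add: in_L_def)
  have "integrable M (\<lambda>x. g x ^ q)"
  proof (rule Bochner_Integration.integrable_bound)
    show "integrable M (\<lambda>x. w x ^ q)" using w by (simp add: in_L_def)
    show "AE x in M. norm (g x ^ q) \<le> norm (w x ^ q)"
      using gw
    proof eventually_elim
      case (elim x)
      then have "\<bar>g x\<bar> ^ q \<le> w x ^ q" by (intro power_mono) auto
      then show ?case using q by (simp add: power_even_abs power_abs[symmetric])
    qed
  qed measurable
  then show "in_L M q g" by (simp add: in_L_def)
  have "(\<lambda>i. integral\<^sup>L M (\<lambda>x. (g x - s i x) ^ q)) \<longlonglongrightarrow> integral\<^sup>L M (\<lambda>x. 0)"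
  proof (rule integral_dominated_convergence[OF _ _ iw])
    show "AE x in M. (\<lambda>i. (g x - s i x) ^ q) \<longlonglongrightarrow> 0"
      using lim
    proof eventually_elim
      case (elim x)
      have "(\<lambda>i. (g x - s i x) ^ q) \<longlonglongrightarrow> (g x - g x) ^ q" by (intro tendsto_intros elim)
      then show ?case using q by (simp add: power_0_left)
    qed
    fix i
    show "AE x in M. norm ((g x - s i x) ^ q) \<le> (2 * w x) ^ q"
      using gw bound[of i]
    proof eventually_elim
      case (elim x)
      then have "\<bar>g x - s i x\<bar> ^ q \<le> (2 * w x) ^ q" by (intro power_mono) auto
      then show ?case by (simp add: power_abs)
    qed
  qed measurable
  then have "(\<lambda>i. root q (integral\<^sup>L M (\<lambda>x. (g x - s i x) ^ q))) \<longlonglongrightarrow> root q 0"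
    by (intro tendsto_real_root) simp
  then show "(\<lambda>i. nrm M q (\<lambda>x. g x - s i x)) \<longlonglongrightarrow> 0" by (simp add: nrm_def)
qed

lemma in_L_abs: "in_L M q f \<Longrightarrow> even q \<Longrightarrow> in_L M q (\<lambda>x. \<bar>f x\<bar>)"
  by (auto simp: in_L_def power_even_abs intro: borel_measurable_abs)

context gaussian
begin

text \<open>Completing the square turns e^(a x) times the standard density into e^(a^2/2) times the
  normal density with mean a. The exponential moments supply the dominating function for the power
  series of sine and cosine.\<close>

lemma H_exp_integrable:
  assumes h: "h \<in> H"
  shows "integrable M (\<lambda>x. exp (c * h x))"
  using h
proof (cases h rule: H_cases)
  case 1
  note [measurable] = H_measurable[OF h]
  have "integrable M (\<lambda>x. exp (c * h x)) = integrable M (\<lambda>x. 1 :: real)"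
    using 1(1) by (intro integrable_cong_AE) auto
  then show ?thesis by simp
next
  case 2
  define a where "a = c * sd h"
  have eq: "std_normal_density x * exp (a * x) = exp (a\<^sup>2 / 2) * normal_density a 1 x" for x
    by (simp add: normal_density_def exp_add[symmetric] power2_eq_square field_simps)
  have "integrable lborel (\<lambda>x. std_normal_density x * exp (a * x))"
    unfolding eq by (intro integrable_mult_right integrable_normal_density) simp
  then have "integrable M (\<lambda>x. exp (a * (h x / sd h)))"
    using distributed_integrable[OF 2(2), of "\<lambda>x. exp (a * x)"] by simp
  then show ?thesis using 2(1) by (simp add: a_def)
qed

lemma H_exp_abs_in_L:
  assumes h: "h \<in> H"
  shows "in_L M q (\<lambda>x. exp \<bar>h x\<bar>)"
proof -
  note [measurable] = H_measurable[OF h]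
  have "integrable M (\<lambda>x. exp (real q * h x) + exp (- real q * h x))"
    using H_exp_integrable[OF h] by (intro Bochner_Integration.integrable_add)
  then have "integrable M (\<lambda>x. exp \<bar>h x\<bar> ^ q)"
  proof (rule Bochner_Integration.integrable_bound)
    show "AE x in M. norm (exp \<bar>h x\<bar> ^ q) \<le> norm (exp (real q * h x) + exp (- real q * h x))"
    proof (rule AE_I2)
      fix x
      have "exp \<bar>h x\<bar> ^ q = exp (real q * \<bar>h x\<bar>)" by (simp add: exp_of_nat_mult)
      also have "\<dots> \<le> exp (real q * h x) + exp (- real q * h x)"
        by (cases "h x \<ge> 0") auto
      finally show "norm (exp \<bar>h x\<bar> ^ q) \<le> norm (exp (real q * h x) + exp (- real q * h x))" by simp
    qed
  qed measurable
  then show ?thesis by (simp add: in_L_def)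
qed

text \<open>The L^q closure of the polynomial functionals; the aim is that it is all of L^q. The way
  leads through bounded trigonometric functionals to indicators.\<close>

definition approx :: "nat \<Rightarrow> ('a \<Rightarrow> real) set" where
  "approx q = {g. in_L M q g \<and> (\<forall>e>0. \<exists>\<phi>\<in>poly_functionals H. nrm M q (\<lambda>x. g x - \<phi> x) < e)}"

lemma approxD: "g \<in> approx q \<Longrightarrow> in_L M q g"
  "g \<in> approx q \<Longrightarrow> e > 0 \<Longrightarrow> \<exists>\<phi>\<in>poly_functionals H. nrm M q (\<lambda>x. g x - \<phi> x) < e"
  by (auto simp: approx_def)

lemma poly_functionals_approx: "\<phi> \<in> poly_functionals H \<Longrightarrow> q > 0 \<Longrightarrow> \<phi> \<in> approx q"
  unfolding approx_def using poly_functionals_in_L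
  by (auto intro!: bexI[of _ \<phi>] simp: nrm_def power_0_left)

context
  fixes q :: nat
  assumes q: "even q" "q > 0"
begin

lemma approx_limit:
  assumes g: "in_L M q g" and a: "\<And>e. e > 0 \<Longrightarrow> \<exists>s\<in>approx q. nrm M q (\<lambda>x. g x - s x) < e"
  shows "g \<in> approx q"
  unfolding approx_def
proof (intro CollectI conjI g allI impI)
  fix e :: real assume "e > 0"
  then obtain s where s: "s \<in> approx q" "nrm M q (\<lambda>x. g x - s x) < e / 2" using a[of "e / 2"] by auto
  obtain \<phi> where \<phi>: "\<phi> \<in> poly_functionals H" "nrm M q (\<lambda>x. s x - \<phi> x) < e / 2"
    using approxD(2)[OF s(1), of "e / 2"] \<open>e > 0\<close> by auto
  have "nrm M q (\<lambda>x. g x - \<phi> x) \<le> nrm M q (\<lambda>x. g x - s x) + nrm M q (\<lambda>x. s x - \<phi> x)"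
    by (rule nrm_triangle_via[OF q g approxD(1)[OF s(1)] poly_functionals_in_L[OF \<phi>(1)]])
  then show "\<exists>\<phi>\<in>poly_functionals H. nrm M q (\<lambda>x. g x - \<phi> x) < e"
    using s \<phi> by (intro bexI[of _ \<phi>]) auto
qed

lemma approx_dominated:
  assumes "g \<in> borel_measurable M" and s: "\<And>i::nat. s i \<in> approx q"
    and "in_L M q w" and "\<And>i. AE x in M. \<bar>s i x\<bar> \<le> w x" and "AE x in M. (\<lambda>i. s i x) \<longlonglongrightarrow> g x"
  shows "g \<in> approx q"
proof -
  note D = nrm_tendsto_dominated[OF q assms(1) in_L_measurable[OF approxD(1)[OF s]] assms(3-5)]
  show ?thesis
  proof (rule approx_limit[OF D(1)])
    fix e :: real assume "e > 0"
    then have "\<forall>\<^sub>F i in sequentially. nrm M q (\<lambda>x. g x - s i x) < e"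
      using order_tendstoD(2)[OF D(2)] by blast
    then show "\<exists>s\<in>approx q. nrm M q (\<lambda>x. g x - s x) < e"
      using s eventually_happens' sequentially_bot by blast
  qed
qed

lemma approx_add:
  assumes "f \<in> approx q" "g \<in> approx q"
  shows "(\<lambda>x. f x + g x) \<in> approx q"
  unfolding approx_def
proof (intro CollectI conjI allI impI)
  note L = approxD(1)[OF assms(1)] approxD(1)[OF assms(2)]
  show "in_L M q (\<lambda>x. f x + g x)" by (rule in_L_add[OF q L])
  fix e :: real assume "e > 0"
  then obtain \<phi> \<psi> where p: "\<phi> \<in> poly_functionals H" "nrm M q (\<lambda>x. f x - \<phi> x) < e / 2"
    "\<psi> \<in> poly_functionals H" "nrm M q (\<lambda>x. g x - \<psi> x) < e / 2"
    using approxD(2)[OF assms(1), of "e / 2"] approxD(2)[OF assms(2), of "e / 2"] by auto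
  note P = poly_functionals_in_L[OF p(1), of q] poly_functionals_in_L[OF p(3), of q]
  have "nrm M q (\<lambda>x. f x + g x - (\<phi> x + \<psi> x)) = nrm M q (\<lambda>x. (f x - \<phi> x) + (g x - \<psi> x))"
    by (simp add: algebra_simps)
  also have "\<dots> \<le> nrm M q (\<lambda>x. f x - \<phi> x) + nrm M q (\<lambda>x. g x - \<psi> x)"
    by (rule nrm_triangle[OF q in_L_diff[OF q L(1) P(1)] in_L_diff[OF q L(2) P(2)]])
  finally have "nrm M q (\<lambda>x. f x + g x - (\<phi> x + \<psi> x)) < e" using p by simp
  moreover have "(\<lambda>x. \<phi> x + \<psi> x) \<in> poly_functionals H"
    using p lincomb_add unfolding poly_functionals_def by blast
  ultimately show "\<exists>\<phi>\<in>poly_functionals H. nrm M q (\<lambda>x. f x + g x - \<phi> x) < e"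
    by (rule rev_bexI[rotated])
qed

lemma approx_scale:
  assumes "f \<in> approx q"
  shows "(\<lambda>x. c * f x) \<in> approx q"
  unfolding approx_def
proof (intro CollectI conjI allI impI)
  note L = approxD(1)[OF assms]
  show "in_L M q (\<lambda>x. c * f x)" by (rule in_L_scale[OF L])
  fix e :: real assume e: "e > 0"
  have "e / (\<bar>c\<bar> + 1) > 0" using e by (simp add: add_nonneg_pos)
  then obtain \<phi> where p: "\<phi> \<in> poly_functionals H" "nrm M q (\<lambda>x. f x - \<phi> x) < e / (\<bar>c\<bar> + 1)"
    using approxD(2)[OF assms] by blast
  have "nrm M q (\<lambda>x. c * f x - c * \<phi> x) = \<bar>c\<bar> * nrm M q (\<lambda>x. f x - \<phi> x)"
    using nrm_scale[OF q, of M c "\<lambda>x. f x - \<phi> x"] by (simp add: right_diff_distrib)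
  also have "\<dots> \<le> \<bar>c\<bar> * (e / (\<bar>c\<bar> + 1))" using p(2) by (intro mult_left_mono) auto
  also have "\<dots> < e" using e by (simp add: divide_simps add_nonneg_pos)
  finally have "nrm M q (\<lambda>x. c * f x - c * \<phi> x) < e" .
  moreover have "(\<lambda>x. c * \<phi> x) \<in> poly_functionals H"
    using p lincomb_scale unfolding poly_functionals_def by blast
  ultimately show "\<exists>\<phi>\<in>poly_functionals H. nrm M q (\<lambda>x. c * f x - \<phi> x) < e"
    by (rule rev_bexI[rotated])
qed

lemma approx_cong_AE:
  assumes "f \<in> approx q" "AE x in M. f x = g x" "g \<in> borel_measurable M"
  shows "g \<in> approx q"
proof (rule approx_dominated[where s = "\<lambda>_. f" and w = "\<lambda>x. \<bar>f x\<bar>"])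
  show "in_L M q (\<lambda>x. \<bar>f x\<bar>)"
    using in_L_abs[OF approxD(1)[OF assms(1)] q(1)] .
  show "AE x in M. (\<lambda>i. f x) \<longlonglongrightarrow> g x"
    using assms(2) by eventually_elim simp
qed (use assms in simp_all)

text \<open>All partial sums are dominated by e^|h|, which lies in every L^q, so the series
  converges in L^q and not just pointwise.\<close>

lemma approx_power_series:
  assumes h: "h \<in> H" and c: "\<And>k. \<bar>c k\<bar> \<le> inverse (fact k)" and lim: "\<And>y. (\<lambda>k. c k *\<^sub>R y ^ k) sums f y"
    and f: "f \<in> borel_measurable borel"
  shows "(\<lambda>x. f (h x)) \<in> approx q"
proof (rule approx_dominated[where s = "\<lambda>n x. \<Sum>k<n. c k * h x ^ k"])
  note [measurable] = H_measurable[OF h] f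
  show "(\<lambda>x. f (h x)) \<in> borel_measurable M" by measurable
  show "in_L M q (\<lambda>x. exp \<bar>h x\<bar>)" by (rule H_exp_abs_in_L[OF h])
  fix n
  have "(\<lambda>v. \<Sum>k<n. c k * v h ^ k) \<in> spoly H"
    by (intro spoly_sum spoly.scale spoly_power spoly_ident h)
  from spoly_poly_functionals[OF this]
  show "(\<lambda>x. \<Sum>k<n. c k * h x ^ k) \<in> approx q"
    using q by (intro poly_functionals_approx) (simp_all add: val_def[abs_def])
  show "AE x in M. \<bar>\<Sum>k<n. c k * h x ^ k\<bar> \<le> exp \<bar>h x\<bar>"
  proof (rule AE_I2)
    fix x
    have "\<bar>\<Sum>k<n. c k * h x ^ k\<bar> \<le> (\<Sum>k<n. \<bar>h x\<bar> ^ k /\<^sub>R fact k)"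
      using c by (intro order_trans[OF sum_abs] sum_mono) (simp add: abs_mult power_abs mult_right_mono)
    also have "\<dots> \<le> (\<Sum>k. \<bar>h x\<bar> ^ k /\<^sub>R fact k)"
      using exp_converges[of "\<bar>h x\<bar>"] by (intro sum_le_suminf) (auto simp: sums_iff)
    also have "\<dots> = exp \<bar>h x\<bar>" using exp_converges[of "\<bar>h x\<bar>"] by (simp add: sums_iff)
    finally show "\<bar>\<Sum>k<n. c k * h x ^ k\<bar> \<le> exp \<bar>h x\<bar>" .
  qed
  show "AE x in M. (\<lambda>n. \<Sum>k<n. c k * h x ^ k) \<longlonglongrightarrow> f (h x)"
    using lim by (auto simp: sums_def)
qed

lemma approx_cos: "h \<in> H \<Longrightarrow> (\<lambda>x. cos (h x)) \<in> approx q"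
  by (rule approx_power_series[OF _ _ cos_converges])
     (simp_all add: cos_coeff_def abs_mult power_abs divide_inverse)

lemma approx_sin: "h \<in> H \<Longrightarrow> (\<lambda>x. sin (h x)) \<in> approx q"
  by (rule approx_power_series[OF _ _ sin_converges])
     (simp_all add: sin_coeff_def abs_mult power_abs divide_inverse)

end

section \<open>Trigonometric functionals and their uniform closure\<close>

inductive_set trig :: "('a \<Rightarrow> real) set" where
  cos: "h \<in> H \<Longrightarrow> (\<lambda>x. cos (h x)) \<in> trig"
| sin: "h \<in> H \<Longrightarrow> (\<lambda>x. sin (h x)) \<in> trig"
| scale: "f \<in> trig \<Longrightarrow> (\<lambda>x. c * f x) \<in> trig"
| add: "f \<in> trig \<Longrightarrow> g \<in> trig \<Longrightarrow> (\<lambda>x. f x + g x) \<in> trig"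

lemma H_diff: "f \<in> H \<Longrightarrow> g \<in> H \<Longrightarrow> (\<lambda>x. f x - g x) \<in> H"
  using H_add[of f "\<lambda>x. -1 * g x"] H_scale[of g "-1"] by simp

text \<open>The product formulas for sine and cosine lead to h + k and h - k, again in
  \<open>H\<close>; the span is therefore an algebra of bounded functions.\<close>

lemma trig_mult:
  assumes "f \<in> trig" "g \<in> trig"
  shows "(\<lambda>x. f x * g x) \<in> trig"
proof -
  have half: "(\<lambda>x. (f x + g x) / 2) \<in> trig" "(\<lambda>x. (f x - g x) / 2) \<in> trig" if "f \<in> trig" "g \<in> trig" for f g
    using trig.scale[OF trig.add[OF that], of "1/2"]
      trig.scale[OF trig.add[OF that(1) trig.scale[OF that(2), of "-1"]], of "1/2"] by simp_all
  have c: "(\<lambda>x. cos (h x) * g x) \<in> trig" "(\<lambda>x. sin (h x) * g x) \<in> trig" if h: "h \<in> H" for h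
    using assms(2)
  proof (induction g rule: trig.induct)
    case (cos k)
    {
      case 1
      show ?case unfolding cos_times_cos by (intro half trig.cos H_add H_diff h cos)
    next
      case 2
      show ?case unfolding sin_times_cos by (intro half trig.sin H_add H_diff h cos)
    }
  next
    case (sin k)
    {
      case 1
      show ?case unfolding cos_times_sin by (intro half trig.sin H_add H_diff h sin)
    next
      case 2
      show ?case unfolding sin_times_sin by (intro half trig.cos H_add H_diff h sin)
    }
  next
    case (scale g c)
    {
      case 1
      show ?case using trig.scale[OF scale.IH(1), of c] by (simp add: mult.left_commute)
    next
      case 2
      show ?case using trig.scale[OF scale.IH(2), of c] by (simp add: mult.left_commute)
    }
  next
    case (add g g')
    {
      case 1
      show ?case using trig.add[OF add.IH(1) add.IH(3)] by (simp add: distrib_left)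
    next
      case 2
      show ?case using trig.add[OF add.IH(2) add.IH(4)] by (simp add: distrib_left)
    }
  qed
  show ?thesis using assms(1)
  proof (induction f rule: trig.induct)
    case (scale f a)
    show ?case using trig.scale[OF scale.IH, of a] by (simp add: mult.assoc)
  next
    case (add f f')
    show ?case using trig.add[OF add.IH] by (simp add: distrib_right)
  qed (use c in auto)
qed

lemma trig_const: "(\<lambda>x. c) \<in> trig"
  using trig.scale[OF trig.cos[OF H_zero], of c] by simp

lemma trig_bounded:
  assumes "f \<in> trig"
  shows "\<exists>C. \<forall>x. \<bar>f x\<bar> \<le> C"
  using assms
proof (induction f rule: trig.induct)
  case (scale f c)
  then obtain C where "\<And>x. \<bar>f x\<bar> \<le> C" by auto
  then have "\<And>x. \<bar>c * f x\<bar> \<le> \<bar>c\<bar> * C" by (simp add: abs_mult mult_left_mono)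
  then show ?case by blast
next
  case (add f g)
  then obtain C D where "\<And>x. \<bar>f x\<bar> \<le> C" "\<And>x. \<bar>g x\<bar> \<le> D" by auto
  then have "\<And>x. \<bar>f x + g x\<bar> \<le> C + D" by (meson abs_triangle_ineq add_mono order_trans)
  then show ?case by blast
qed (auto intro: exI[of _ 1])

lemma trig_approx: "even q \<Longrightarrow> q > 0 \<Longrightarrow> f \<in> trig \<Longrightarrow> f \<in> approx q"
proof -
  assume q: "even q" "q > 0"
  show "f \<in> approx q" if "f \<in> trig"
    using that
    by (induction f rule: trig.induct)
      (blast intro: approx_cos[OF q] approx_sin[OF q] approx_scale[OF q] approx_add[OF q])+
qed

text \<open>The uniform closure keeps boundedness and adds stability under continuous functions, in
  particular max and min.\<close>

definition trig_closure :: "('a \<Rightarrow> real) set" where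
  "trig_closure = {f. \<forall>e>0. \<exists>t\<in>trig. \<forall>x. \<bar>f x - t x\<bar> < e}"

lemma trig_closureI_trig: "f \<in> trig \<Longrightarrow> f \<in> trig_closure"
  unfolding trig_closure_def by (auto intro!: bexI[of _ f])

lemma trig_closureD: "f \<in> trig_closure \<Longrightarrow> e > 0 \<Longrightarrow> \<exists>t\<in>trig. \<forall>x. \<bar>f x - t x\<bar> < e"
  by (simp add: trig_closure_def)

lemma trig_closure_bounded:
  assumes "f \<in> trig_closure"
  obtains C where "C > 0" "\<And>x. \<bar>f x\<bar> \<le> C"
proof -
  obtain t where t: "t \<in> trig" "\<forall>x. \<bar>f x - t x\<bar> < 1"
    using assms by (auto simp: trig_closure_def dest: spec[of _ 1])
  obtain C where C: "\<forall>x. \<bar>t x\<bar> \<le> C" using trig_bounded[OF t(1)] by blast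
  have "\<bar>f x\<bar> \<le> \<bar>C\<bar> + 1" for x using t(2)[rule_format, of x] C[rule_format, of x] by linarith
  then show ?thesis by (intro that[of "\<bar>C\<bar> + 1"]) auto
qed

lemma trig_closure_add:
  assumes "f \<in> trig_closure" "g \<in> trig_closure"
  shows "(\<lambda>x. f x + g x) \<in> trig_closure"
  unfolding trig_closure_def
proof (intro CollectI allI impI)
  fix e :: real assume "e > 0"
  then obtain s t where st: "s \<in> trig" "\<forall>x. \<bar>f x - s x\<bar> < e / 2" "t \<in> trig" "\<forall>x. \<bar>g x - t x\<bar> < e / 2"
    using trig_closureD[OF assms(1), of "e / 2"] trig_closureD[OF assms(2), of "e / 2"] by auto
  have "\<bar>f x + g x - (s x + t x)\<bar> < e" for x
    using st(2)[rule_format, of x] st(4)[rule_format, of x] by linarith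
  with trig.add[OF st(1,3)] show "\<exists>t\<in>trig. \<forall>x. \<bar>f x + g x - t x\<bar> < e"
    by (intro bexI[of _ "\<lambda>x. s x + t x"]) auto
qed

lemma trig_closure_mult:
  assumes f: "f \<in> trig_closure" and g: "g \<in> trig_closure"
  shows "(\<lambda>x. f x * g x) \<in> trig_closure"
  unfolding trig_closure_def
proof (intro CollectI allI impI)
  fix e :: real assume e: "e > 0"
  obtain C where C: "C > 0" "\<And>x. \<bar>f x\<bar> \<le> C" using trig_closure_bounded[OF f] by blast
  obtain t where t: "t \<in> trig" "\<forall>x. \<bar>g x - t x\<bar> < e / (2 * C)"
    using g C(1) e unfolding trig_closure_def by (auto dest: spec[of _ "e / (2 * C)"])
  obtain D0 where D0: "\<forall>x. \<bar>t x\<bar> \<le> D0" using trig_bounded[OF t(1)] by blast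
  define D where "D = \<bar>D0\<bar> + 1"
  have D: "D > 0" "\<And>x. \<bar>t x\<bar> \<le> D"
    unfolding D_def by (auto intro: order_trans[OF D0[rule_format]])
  obtain s where s: "s \<in> trig" "\<forall>x. \<bar>f x - s x\<bar> < e / (2 * D)"
    using f D(1) e unfolding trig_closure_def by (auto dest: spec[of _ "e / (2 * D)"])
  have "\<bar>f x * g x - s x * t x\<bar> < e" for x
  proof -
    have "\<bar>f x * g x - s x * t x\<bar> = \<bar>f x * (g x - t x) + (f x - s x) * t x\<bar>" by (simp add: algebra_simps)
    also have "\<dots> \<le> \<bar>f x\<bar> * \<bar>g x - t x\<bar> + \<bar>f x - s x\<bar> * \<bar>t x\<bar>"
      by (rule order_trans[OF abs_triangle_ineq]) (simp add: abs_mult)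
    also have "\<dots> \<le> C * \<bar>g x - t x\<bar> + \<bar>f x - s x\<bar> * D"
      using C(2) D(2) by (intro add_mono mult_left_mono mult_right_mono) auto
    also have "\<dots> < C * (e / (2 * C)) + (e / (2 * D)) * D"
      using t(2) s(2) C(1) D(1) by (intro add_strict_mono mult_strict_left_mono mult_strict_right_mono) auto
    also have "\<dots> = e" using C(1) D(1) by simp
    finally show ?thesis .
  qed
  with trig_mult[OF s(1) t(1)] show "\<exists>t\<in>trig. \<forall>x. \<bar>f x * g x - t x\<bar> < e"
    by (intro bexI[of _ "\<lambda>x. s x * t x"]) auto
qed

text \<open>Since f takes values in some [-C, C], Weierstrass approximates \<psi> there by
  polynomials, and these preserve the closed algebra.\<close>

lemma trig_closure_comp:
  assumes f: "f \<in> trig_closure" and \<psi>: "continuous_on UNIV (\<psi> :: real \<Rightarrow> real)"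
  shows "(\<lambda>x. \<psi> (f x)) \<in> trig_closure"
  unfolding trig_closure_def
proof (intro CollectI allI impI)
  fix e :: real assume e: "e > 0"
  obtain C where C: "C > 0" "\<And>x. \<bar>f x\<bar> \<le> C" using trig_closure_bounded[OF f] by blast
  have range: "f x \<in> {- C..C}" for x using C(2)[of x] by auto
  obtain P where P: "real_polynomial_function P" "\<And>y. y \<in> {- C..C} \<Longrightarrow> \<bar>\<psi> y - P y\<bar> < e / 2"
    using Stone_Weierstrass_real_polynomial_function[of "{- C..C}" \<psi> "e / 2"] e
      continuous_on_subset[OF \<psi>] by auto
  have "(\<lambda>x. P (f x)) \<in> trig_closure"
    using P(1)
  proof (induction P rule: real_polynomial_function.induct)
    case (linear P)
    then interpret bounded_linear P .
    have "P y = P 1 * y" for y using scaleR[of y 1] by simp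
    then have "(\<lambda>x. P (f x)) = (\<lambda>x. P 1 * f x)" by metis
    then show ?case using trig_closure_mult[OF trig_closureI_trig[OF trig_const[of "P 1"]] f] by simp
  next
    case (const c)
    show ?case by (rule trig_closureI_trig[OF trig_const])
  qed (auto intro: trig_closure_add trig_closure_mult)
  then obtain t where t: "t \<in> trig" "\<forall>x. \<bar>P (f x) - t x\<bar> < e / 2"
    using e unfolding trig_closure_def by (auto dest: spec[of _ "e / 2"])
  have "\<bar>\<psi> (f x) - t x\<bar> < e" for x
    using P(2)[OF range, of x] t(2)[rule_format, of x] by linarith
  with t(1) show "\<exists>t\<in>trig. \<forall>x. \<bar>\<psi> (f x) - t x\<bar> < e" by auto
qed

lemma trig_measurable: "f \<in> trig \<Longrightarrow> f \<in> borel_measurable M"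
proof (induction f rule: trig.induct)
  case (cos h)
  note [measurable] = H_measurable[OF cos]
  show ?case by measurable
next
  case (sin h)
  note [measurable] = H_measurable[OF sin]
  show ?case by measurable
qed (rule borel_measurable_times borel_measurable_add; simp)+

lemma trig_closure_measurable:
  assumes "f \<in> trig_closure"
  shows "f \<in> borel_measurable M"
proof -
  have "\<forall>n. \<exists>t. t \<in> trig \<and> (\<forall>x. \<bar>f x - t x\<bar> < 1 / real (Suc n))"
    using assms unfolding trig_closure_def by (auto simp: Bex_def)
  from choice[OF this] obtain t where t: "\<forall>n. t n \<in> trig \<and> (\<forall>x. \<bar>f x - t n x\<bar> < 1 / real (Suc n))" ..
  show ?thesis
  proof (rule borel_measurable_LIMSEQ_real)
    show "t n \<in> borel_measurable M" for n using t trig_measurable by blast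
    fix x
    have "(\<lambda>n. 1 / real (Suc n)) \<longlonglongrightarrow> 0" by (rule LIMSEQ_Suc[OF lim_1_over_n])
    then have "(\<lambda>n. t n x - f x) \<longlonglongrightarrow> 0"
      by (rule Lim_null_comparison[rotated]) (use t in \<open>auto intro!: always_eventually less_imp_le simp: abs_minus_commute\<close>)
    then show "(\<lambda>n. t n x) \<longlonglongrightarrow> f x" by (rule LIM_zero_cancel)
  qed
qed

section \<open>From indicators of generating sets to all of L^q\<close>

context
  fixes q :: nat
  assumes q: "even q" "q > 0"
begin

lemma bounded_in_L: "f \<in> borel_measurable M \<Longrightarrow> (\<And>x. \<bar>f x\<bar> \<le> C) \<Longrightarrow> in_L M q f"
proof -
  assume [measurable]: "f \<in> borel_measurable M" and C: "\<And>x. \<bar>f x\<bar> \<le> C"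
  have "\<bar>f x\<bar> ^ q \<le> C ^ q" for x using C by (intro power_mono) auto
  then have "integrable M (\<lambda>x. f x ^ q)"
    by (intro integrable_const_bound[of _ "C ^ q"]) (auto simp: power_abs)
  then show ?thesis by (simp add: in_L_def)
qed

lemma trig_closure_approx:
  assumes "f \<in> trig_closure"
  shows "f \<in> approx q"
proof -
  obtain C where C: "C > 0" "\<And>x. \<bar>f x\<bar> \<le> C" using trig_closure_bounded[OF assms] by blast
  note m = trig_closure_measurable[OF assms]
  show ?thesis
  proof (rule approx_limit[OF q bounded_in_L[OF m C(2)]])
    fix e :: real assume e: "e > 0"
    obtain t where t: "t \<in> trig" "\<forall>x. \<bar>f x - t x\<bar> < e / 2"
      using assms e unfolding trig_closure_def by (auto dest: spec[of _ "e / 2"])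
    note [measurable] = m trig_measurable[OF t(1)]
    have le: "\<bar>f x - t x\<bar> ^ q \<le> (e / 2) ^ q" for x using t(2) by (intro power_mono) (auto intro: less_imp_le)
    have "expectation (\<lambda>x. (f x - t x) ^ q) \<le> expectation (\<lambda>x. (e / 2) ^ q)"
    proof (rule integral_mono)
      show "integrable M (\<lambda>x. (f x - t x) ^ q)"
        using bounded_in_L[of "\<lambda>x. f x - t x" "e / 2"] t(2) by (auto simp: in_L_def less_imp_le)
    qed (use le q in \<open>auto simp: power_even_abs\<close>)
    then have "nrm M q (\<lambda>x. f x - t x) \<le> e / 2"
      using e by (intro nrm_leI q) (auto simp: prob_space)
    with trig_approx[OF q t(1)] show "\<exists>s\<in>approx q. nrm M q (\<lambda>x. f x - s x) < e"
      using e by (intro bexI[of _ t]) auto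
  qed
qed

text \<open>A generator that is stable under intersections and whose indicators are pointwise limits
  of bounded elements of \<open>approx\<close>.\<close>

definition trig_sets :: "'a set set" where
  "trig_sets = {{x \<in> space M. f x > 0} | f. f \<in> trig_closure}"

lemma trig_setsI: "f \<in> trig_closure \<Longrightarrow> {x \<in> space M. f x > 0} \<in> trig_sets"
  unfolding trig_sets_def by blast

lemma trig_sets_approx:
  assumes "A \<in> trig_sets"
  shows "A \<in> sets M" "indicator A \<in> approx q"
proof -
  obtain f where f: "A = {x \<in> space M. f x > 0}" "f \<in> trig_closure"
    using assms by (auto simp: trig_sets_def)
  note [measurable] = trig_closure_measurable[OF f(2)]
  show [measurable]: "A \<in> sets M" unfolding f(1) by measurable
  show "indicator A \<in> approx q"
  proof (rule approx_dominated[OF q, where s = "\<lambda>n x. min 1 (real n * max 0 (f x))" and w = "\<lambda>x. 1"])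
    show "(\<lambda>x. min 1 (real n * max 0 (f x))) \<in> approx q" for n
      by (intro trig_closure_approx trig_closure_comp[OF f(2)] continuous_intros)
    show "in_L M q (\<lambda>x. 1)" by (rule bounded_in_L[of _ 1]) auto
    show "AE x in M. (\<lambda>n. min 1 (real n * max 0 (f x))) \<longlonglongrightarrow> indicator A x"
    proof (rule AE_I2)
      fix x assume x: "x \<in> space M"
      show "(\<lambda>n. min 1 (real n * max 0 (f x))) \<longlonglongrightarrow> indicator A x"
      proof (cases "f x > 0")
        case True
        obtain N :: nat where N: "1 / f x < real N" using reals_Archimedean2 by blast
        have "min 1 (real n * max 0 (f x)) = 1" if "n \<ge> N" for n
        proof -
          have "1 / f x < real n" using N that by (meson less_le_trans of_nat_le_iff)
          then have "1 < real n * f x" using True by (simp add: divide_less_eq)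
          then show ?thesis using True by simp
        qed
        then have "\<forall>\<^sub>F n in sequentially. min 1 (real n * max 0 (f x)) = 1"
          unfolding eventually_sequentially by blast
        then show ?thesis using True x by (simp add: f(1) tendsto_eventually)
      qed (simp add: f(1))
    qed
  qed (auto simp: min_def)
qed

lemma trig_sets_Int_stable: "Int_stable trig_sets"
proof (rule Int_stableI)
  fix A B assume "A \<in> trig_sets" "B \<in> trig_sets"
  then obtain f g where f: "A = {x \<in> space M. f x > 0}" "f \<in> trig_closure" and g: "B = {x \<in> space M. g x > 0}" "g \<in> trig_closure"
    by (auto simp: trig_sets_def)
  define k where "k x = max 0 (f x) * max 0 (g x)" for x
  have "k \<in> trig_closure" unfolding k_def
    by (intro trig_closure_mult trig_closure_comp[where \<psi> = "\<lambda>y. max 0 y"] f(2) g(2) continuous_intros)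
  moreover have "A \<inter> B = {x \<in> space M. k x > 0}"
    unfolding f(1) g(1) k_def by (auto simp: zero_less_mult_iff less_max_iff_disj)
  ultimately show "A \<inter> B \<in> trig_sets" by (auto simp: trig_sets_def)
qed

lemma trig_sets_Pow: "trig_sets \<subseteq> Pow (space M)"
  by (auto simp: trig_sets_def)

text \<open>Dynkin's argument: \<open>approx\<close> is a linear space containing constants, and
  dominated convergence with bound 1 handles countable disjoint unions.\<close>

lemma trig_sigma_approx:
  assumes "A \<in> sigma_sets (space M) trig_sets"
  shows "A \<in> sets M \<and> indicator A \<in> approx q"
  using trig_sets_Int_stable trig_sets_Pow assms
proof (induction rule: sigma_sets_induct_disjoint)
  case (basic A)
  then show ?case using trig_sets_approx by blast
next
  case empty
  have "(\<lambda>x. 0) \<in> approx q" using trig_closure_approx[OF trig_closureI_trig[OF trig_const]] .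
  then show ?case by (simp add: indicator_def[abs_def])
next
  case (compl A)
  have "(\<lambda>x. 1 + (- 1) * indicator A x) \<in> approx q"
    using compl by (intro approx_add[OF q] approx_scale[OF q] trig_closure_approx[OF trig_closureI_trig[OF trig_const]]) auto
  then have "indicator (space M - A) \<in> approx q"
    by (rule approx_cong_AE[OF q]) (use compl in \<open>auto simp: indicator_def\<close>)
  then show ?case using compl by auto
next
  case (union A)
  then have [measurable]: "A i \<in> sets M" and a: "indicator (A i) \<in> approx q" for i by auto
  have sum: "(\<lambda>x. \<Sum>i<n. indicator (A i) x :: real) = indicator (\<Union>i<n. A i)" for n
    using union(1) by (auto simp: fun_eq_iff indicator_UN_disjoint disjoint_family_on_def)
  have part: "indicator (\<Union>i<n. A i) \<in> approx q" for n
    unfolding sum[symmetric]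
  proof (induction n)
    case 0
    show ?case using trig_closure_approx[OF trig_closureI_trig[OF trig_const[of 0]]] by simp
  next
    case (Suc n)
    then show ?case using approx_add[OF q _ a[of n]] by simp
  qed
  have "indicator (\<Union>i. A i) \<in> approx q"
  proof (rule approx_dominated[OF q _ part])
    show "in_L M q (\<lambda>x. 1)" by (rule bounded_in_L[of _ 1]) auto
    show "AE x in M. (\<lambda>n. indicator (\<Union>i<n. A i) x) \<longlonglongrightarrow> (indicator (\<Union>i. A i) x :: real)"
      by (intro AE_I2 LIMSEQ_indicator_UN)
  qed (auto simp: indicator_def)
  then show ?case by auto
qed

text \<open>An unbounded h is outside \<open>trig_closure\<close>, but it is the pointwise limit of
  n sin (h / n) and hence measurable for the generated sigma-algebra.\<close>

lemma H_preimage_trig_sigma: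
  assumes h: "h \<in> H" and S: "S \<in> sets borel"
  shows "h -` S \<inter> space M \<in> sigma_sets (space M) trig_sets"
proof -
  define N where "N = sigma (space M) trig_sets"
  have sN: "sets N = sigma_sets (space M) trig_sets" "space N = space M"
    by (auto simp: N_def trig_sets_def intro!: sets_measure_of space_measure_of)
  have tm: "t \<in> borel_measurable N" if t: "t \<in> trig_closure" for t
    unfolding borel_measurable_iff_greater
  proof
    fix a
    have "(\<lambda>x. t x + (- a)) \<in> trig_closure"
      by (intro trig_closure_add t trig_closureI_trig[OF trig_const])
    from trig_setsI[OF this] have "{x \<in> space M. t x + (- a) > 0} \<in> trig_sets" .
    moreover have "{x \<in> space M. t x + (- a) > 0} = {w \<in> space M. a < t w}" by auto
    ultimately show "{w \<in> space N. a < t w} \<in> sets N" unfolding sN by (auto intro: sigma_sets.Basic)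
  qed
  have "h \<in> borel_measurable N"
  proof (rule borel_measurable_LIMSEQ_real)
    fix n :: nat
    have "(\<lambda>x. 1 / real (Suc n) * h x) \<in> H" using H_scale[OF h, of "1 / real (Suc n)"] .
    from trig_closureI_trig[OF trig.scale[OF trig.sin[OF this], of "real (Suc n)"]]
    have "(\<lambda>x. real (Suc n) * sin (1 / real (Suc n) * h x)) \<in> trig_closure" .
    from tm[OF this] show "(\<lambda>x. real (Suc n) * sin (1 / real (Suc n) * h x)) \<in> borel_measurable N" .
  next
    fix x
    show "(\<lambda>n. real (Suc n) * sin (1 / real (Suc n) * h x)) \<longlonglongrightarrow> h x"
    proof (cases "h x = 0")
      case False
      have "((\<lambda>y. (sin (0 + y) - sin 0) / y) \<longlongrightarrow> cos 0) (at (0::real))"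
        using DERIV_sin[of "0::real"] unfolding DERIV_def .
      then have "((\<lambda>y. sin y / y) \<longlongrightarrow> 1) (at (0::real))"
        by (simp only: sin_zero cos_zero diff_zero add_0)
      moreover have "filterlim (\<lambda>n. 1 / real (Suc n) * h x) (at 0) sequentially"
        unfolding filterlim_at
      proof
        have "(\<lambda>n. 1 / real (Suc n) * h x) \<longlonglongrightarrow> 0 * h x"
          by (intro tendsto_mult tendsto_const LIMSEQ_Suc[OF lim_1_over_n])
        then show "(\<lambda>n. 1 / real (Suc n) * h x) \<longlonglongrightarrow> 0" by simp
      qed (use False in auto)
      ultimately have "(\<lambda>n. sin (1 / real (Suc n) * h x) / (1 / real (Suc n) * h x)) \<longlonglongrightarrow> 1"
        by (rule filterlim_compose)
      then have "(\<lambda>n. h x * (sin (1 / real (Suc n) * h x) / (1 / real (Suc n) * h x))) \<longlonglongrightarrow> h x * 1"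
        by (intro tendsto_mult tendsto_const)
      moreover have "h x * (sin (1 / real (Suc n) * h x) / (1 / real (Suc n) * h x))
        = real (Suc n) * sin (1 / real (Suc n) * h x)" for n
        using False by simp
      ultimately show ?thesis by simp
    qed simp
  qed
  then show ?thesis using measurable_sets[OF _ S, of h N] sN by simp
qed

text \<open>In \<open>gaussian_space\<close> the sigma-algebra is generated by \<open>H\<close>
  modulo null sets, and \<open>approx\<close> does not see these.\<close>

lemma indicator_approx:
  assumes A: "A \<in> sets M"
  shows "indicator A \<in> approx q"
proof -
  have "\<forall>A\<in>sets M. \<exists>B\<in>sigma_sets (space M) {h -` S \<inter> space M | h S. h \<in> H \<and> S \<in> sets borel}.
      (A - B) \<union> (B - A) \<in> null_sets M"
    using gaussian_space unfolding gaussian_space_def by (elim conjE)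
  from bspec[OF this A] obtain B where B: "B \<in> sigma_sets (space M) {h -` S \<inter> space M | h S. h \<in> H \<and> S \<in> sets borel}"
    "(A - B) \<union> (B - A) \<in> null_sets M"
    ..
  have "sigma_sets (space M) {h -` S \<inter> space M | h S. h \<in> H \<and> S \<in> sets borel} \<subseteq> sigma_sets (space M) trig_sets"
    by (rule sigma_sets_mono) (use H_preimage_trig_sigma in auto)
  with B(1) have B': "B \<in> sets M" "indicator B \<in> approx q" using trig_sigma_approx by auto
  show ?thesis
  proof (rule approx_cong_AE[OF q B'(2)])
    show "AE x in M. indicator B x = (indicator A x :: real)"
      using AE_not_in[OF B(2)] by eventually_elim (auto simp: indicator_def)
  qed (use A in auto)
qed

lemma in_L_approx:
  assumes f: "in_L M q f"
  shows "f \<in> approx q"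
proof -
  have m: "f \<in> borel_measurable M" using f by (simp add: in_L_def)
  obtain F where F: "\<And>i. simple_function M (F i)" "\<And>x. x \<in> space M \<Longrightarrow> (\<lambda>i. F i x) \<longlonglongrightarrow> f x"
    "\<And>i x. x \<in> space M \<Longrightarrow> dist (F i x) 0 \<le> 2 * dist (f x) 0"
    using borel_measurable_implies_sequence_metric[OF m, of 0] by blast
  have s: "F i \<in> approx q" for i
  proof -
    have fin: "finite (F i ` space M)" using F(1)[of i] by (simp add: simple_function_def)
    have [measurable]: "F i -` {y} \<inter> space M \<in> sets M" for y
      by (rule measurable_sets[OF borel_measurable_simple_function[OF F(1)]]) simp
    have "(\<lambda>x. \<Sum>y\<in>Y. y * indicator (F i -` {y} \<inter> space M) x) \<in> approx q" if "finite Y" for Y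
      using that
    proof (induction Y rule: finite_induct)
      case empty
      show ?case using trig_closure_approx[OF trig_closureI_trig[OF trig_const[of 0]]] by simp
    next
      case (insert y Y)
      then show ?case
        using approx_add[OF q approx_scale[OF q indicator_approx[of "F i -` {y} \<inter> space M"], of y] insert.IH] by (simp only: sum.insert[OF insert.hyps]) simp
    qed
    from this[OF fin] show ?thesis
    proof (rule approx_cong_AE[OF q])
      show "AE x in M. (\<Sum>y\<in>F i ` space M. y * indicator (F i -` {y} \<inter> space M) x) = F i x"
      proof (rule AE_I2)
        fix x assume x: "x \<in> space M"
        have "(\<Sum>y\<in>F i ` space M. y * indicator (F i -` {y} \<inter> space M) x)
          = (\<Sum>y\<in>F i ` space M. if y = F i x then y else 0)"
          using x by (intro sum.cong) (auto simp: indicator_def)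
        also have "\<dots> = F i x" using fin x by simp
        finally show "(\<Sum>y\<in>F i ` space M. y * indicator (F i -` {y} \<inter> space M) x) = F i x" .
      qed
      show "F i \<in> borel_measurable M" using F(1) by (rule borel_measurable_simple_function)
    qed
  qed
  show ?thesis
  proof (rule approx_dominated[OF q m, where s = F])
    show "F i \<in> approx q" for i by (rule s)
    from in_L_abs[OF f q(1)] show "in_L M q (\<lambda>x. 2 * \<bar>f x\<bar>)" by (rule in_L_scale)
  qed (use F in auto)
qed

end

end

subsection \<open>Interpolation by resolvent cut-offs\<close>

lemma tendsto_divide_power2: "(\<lambda>j. C / 2 ^ j) \<longlonglongrightarrow> (0::real)"
proof -
  have e: "C / 2 ^ j = C * (1 / 2) ^ j" for j by (simp add: power_one_over)
  show ?thesis unfolding e by (intro tendsto_mult_right_zero LIMSEQ_power_zero) simp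
qed

lemma divide_ge_1_le: "y \<ge> 0 \<Longrightarrow> z \<ge> 1 \<Longrightarrow> y / z \<le> (y :: real)"
  using mult_left_mono[of 1 z y] by (simp add: divide_le_eq)

context gaussian
begin

definition gdiff :: "(nat \<Rightarrow> 'v \<Rightarrow> real) \<Rightarrow> (nat \<Rightarrow> 'v \<Rightarrow> real) \<Rightarrow> nat \<Rightarrow> 'v \<Rightarrow> real" where
  "gdiff A B = gadd A (mul (\<lambda>n. -1) B)"

lemma graded_gdiff: "A \<in> graded \<Longrightarrow> B \<in> graded \<Longrightarrow> gdiff A B \<in> graded"
  by (simp add: gdiff_def graded_gadd graded_mul)

lemma ev_gdiff: "A \<in> graded \<Longrightarrow> B \<in> graded \<Longrightarrow> ev (gdiff A B) \<omega> = ev A \<omega> - ev B \<omega>"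
  by (simp add: gdiff_def ev_gadd graded_mul ev_scale)

lemma mul_gdiff: "mul m (gdiff A B) = gdiff (mul m A) (mul m B)"
  by (simp add: gdiff_def mul_def gadd_def fun_eq_iff algebra_simps)

lemma nrm_ev_gdiff: "A \<in> graded \<Longrightarrow> B \<in> graded \<Longrightarrow> nrm M p (ev (gdiff A B)) = nrm M p (\<lambda>x. ev A x - ev B x)"
  by (rule arg_cong[of _ _ "nrm M p"]) (simp add: fun_eq_iff ev_gdiff)

lemma nrm_gdiff_le:
  "A \<in> graded \<Longrightarrow> B \<in> graded \<Longrightarrow> even p \<Longrightarrow> p > 0 \<Longrightarrow> nrm M p (ev (gdiff A B)) \<le> nrm M p (ev A) + nrm M p (ev B)"
  by (simp add: nrm_ev_gdiff nrm_triangle_diff ev_in_L)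

lemma nrm_le_gdiff_add:
  assumes "A \<in> graded" "B \<in> graded" "even p" "p > 0"
  shows "nrm M p (ev A) \<le> nrm M p (ev (gdiff A B)) + nrm M p (ev B)"
proof -
  have "ev A = (\<lambda>x. ev (gdiff A B) x + ev B x)" using assms by (simp add: ev_gdiff)
  then show ?thesis
    using nrm_triangle[OF assms(3,4) ev_in_L[OF graded_gdiff[OF assms(1,2)]] ev_in_L[OF assms(2)]] by simp
qed

text \<open>Eigenvalue of 1 - L on the n-th chaos.\<close>

definition wt :: "nat \<Rightarrow> real" where "wt n = 1 + real n"

lemma wt_pos: "wt n > 0" by (simp add: wt_def)

lemma Lp_multiplier_inverse_wt_power: "Lp_multiplier (\<lambda>n. 1 / wt n ^ k) 1"
proof -
  have e: "(1 + real n) powr (- real (2::nat) / 2) = 1 / wt n" for n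
    by (simp add: wt_def powr_minus_divide)
  have "Lp_multiplier (\<lambda>n. 1 / wt n) 1" using Lp_multiplier_inverse_powr[of 2] unfolding e .
  from Lp_multiplier_power[OF this, of k] show ?thesis by (simp add: power_one_over)
qed

definition res :: "real \<Rightarrow> nat \<Rightarrow> real" where "res X n = X / (X + wt n)"

lemma Lp_multiplier_res: "X > 0 \<Longrightarrow> Lp_multiplier (res X) 1"
  using Lp_multiplier_resolvent[of X] by (simp add: res_def[abs_def] wt_def add.assoc)

lemma Lp_multiplier_res_power: "X > 0 \<Longrightarrow> Lp_multiplier (\<lambda>n. res X n ^ k) 1"
  using Lp_multiplier_power[OF Lp_multiplier_res] by simp

text \<open>Exchanges one power of 1 - L for a factor X and the bounded multiplier 1 -
  \<open>res X\<close>; both the growth X^r and the decay X^(-N) stem from this identity.\<close>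

lemma res_wt: "X > 0 \<Longrightarrow> wt n * res X n = X * (1 - res X n)"
  using wt_pos[of n] by (simp add: res_def field_simps)

text \<open>The cut-off is divisible by \<open>res\<^sup>r\<close>, which absorbs \<open>r\<close> powers of \<open>1 - L\<close> uniformly in every
  \<open>L\<^sup>q\<close>; its complement is divisible by \<open>(1 - res)\<^sup>N\<close>, which gives the decay \<open>X\<^sup>-\<^sup>N\<close> on smooth
  elements of \<open>L\<^sup>2\<close>.\<close>

definition cutoff :: "nat \<Rightarrow> nat \<Rightarrow> real \<Rightarrow> nat \<Rightarrow> real" where
  "cutoff r N X n = 1 - (1 - res X n ^ r) ^ N"

lemma Lp_multiplier_one_minus_cutoff: "X > 0 \<Longrightarrow> Lp_multiplier (\<lambda>n. 1 - cutoff r N X n) (2 ^ N)"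
  using Lp_multiplier_power[OF Lp_multiplier_diff[OF Lp_multiplier_const[of 1] Lp_multiplier_res_power[of X r]], of N] by (simp add: cutoff_def)

text \<open>With y = res^r, the cut-off 1 - (1 - y)^N is y times a geometric sum in 1 - y, and
  \<open>res_wt\<close> turns wt^r res^r into X^r (1 - res)^r. The factors 1 - res and 1 - res^r
  have bound 2 each.\<close>

lemma Lp_multiplier_wt_cutoff:
  assumes X: "X > 0"
  shows "Lp_multiplier (\<lambda>n. wt n ^ r * cutoff r N X n) (X ^ r * (2 ^ r * (\<Sum>i<N. 2 ^ i)))"
proof -
  have b2: "Lp_multiplier (\<lambda>n. 1 - res X n) 2" using Lp_multiplier_diff[OF Lp_multiplier_const[of 1] Lp_multiplier_res[OF X]] by simp
  have b3: "Lp_multiplier (\<lambda>n. 1 - res X n ^ r) 2" using Lp_multiplier_diff[OF Lp_multiplier_const[of 1] Lp_multiplier_res_power[OF X]] by simp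
  have "Lp_multiplier (\<lambda>n. X ^ r * ((1 - res X n) ^ r * (\<Sum>i<N. (1 - res X n ^ r) ^ i)))
     (\<bar>X ^ r\<bar> * (2 ^ r * (\<Sum>i<N. 2 ^ i)))"
    by (intro Lp_multiplier_mult Lp_multiplier_const Lp_multiplier_sum Lp_multiplier_power b2 b3)
  moreover have "X ^ r * ((1 - res X n) ^ r * (\<Sum>i<N. (1 - res X n ^ r) ^ i)) = wt n ^ r * cutoff r N X n" for n
  proof -
    have "cutoff r N X n = res X n ^ r * (\<Sum>i<N. (1 - res X n ^ r) ^ i)"
      using one_diff_power_eq[of "1 - res X n ^ r" N] by (simp add: cutoff_def)
    then have "wt n ^ r * cutoff r N X n = (wt n * res X n) ^ r * (\<Sum>i<N. (1 - res X n ^ r) ^ i)"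
      by (simp add: power_mult_distrib)
    then show ?thesis by (simp add: res_wt[OF X] power_mult_distrib)
  qed
  ultimately show ?thesis using X by simp
qed

text \<open>Here 1 - res^r is 1 - res times a geometric sum of r terms, and (1 - res) / wt = res /
  X; so each of the N factors contributes r / X.\<close>

lemma Lp_multiplier_cutoff_decay:
  assumes X: "X > 0"
  shows "Lp_multiplier (\<lambda>n. (1 - cutoff r N X n) / wt n ^ N) (real r ^ N / X ^ N)"
proof -
  have "Lp_multiplier (\<lambda>n. (1 / X * (res X n * (\<Sum>i<r. res X n ^ i))) ^ N) ((\<bar>1 / X\<bar> * (1 * (\<Sum>i<r. 1))) ^ N)"
    by (intro Lp_multiplier_power Lp_multiplier_mult Lp_multiplier_const Lp_multiplier_sum Lp_multiplier_res Lp_multiplier_res_power X)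
  moreover have "(1 / X * (res X n * (\<Sum>i<r. res X n ^ i))) ^ N = (1 - cutoff r N X n) / wt n ^ N" for n
  proof -
    have "1 / X * res X n = (1 - res X n) / wt n"
      using res_wt[OF X, of n] X wt_pos[of n] by (simp add: field_simps)
    then have "1 / X * (res X n * (\<Sum>i<r. res X n ^ i)) = (1 - res X n) / wt n * (\<Sum>i<r. res X n ^ i)"
      by (simp only: mult.assoc[symmetric])
    also have "\<dots> = (1 - res X n ^ r) / wt n" by (simp add: one_diff_power_eq)
    finally show ?thesis by (simp add: cutoff_def power_divide)
  qed
  ultimately show ?thesis using X by (simp add: power_divide)
qed

lemma cutoff_L2_decay:
  assumes X: "X > 0" and A: "A \<in> graded" and B: "nrm M 2 (ev (mul (\<lambda>n. wt n ^ (k + N)) A)) \<le> B"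
  shows "nrm M 2 (ev (mul (\<lambda>n. wt n ^ k * (1 - cutoff r N X n)) A)) \<le> real r ^ N / X ^ N * B"
proof -
  have "mul (\<lambda>n. wt n ^ k * (1 - cutoff r N X n)) A
    = mul (\<lambda>n. (1 - cutoff r N X n) / wt n ^ N) (mul (\<lambda>n. wt n ^ (k + N)) A)"
    unfolding mul_mul using wt_pos by (auto simp: mul_def power_add fun_eq_iff less_imp_neq[symmetric])
  then have "nrm M 2 (ev (mul (\<lambda>n. wt n ^ k * (1 - cutoff r N X n)) A))
    \<le> real r ^ N / X ^ N * nrm M 2 (ev (mul (\<lambda>n. wt n ^ (k + N)) A))"
    using Lp_multiplierD[OF Lp_multiplier_cutoff_decay[OF X] graded_mul[OF A], of 2] by simp
  also have "\<dots> \<le> real r ^ N / X ^ N * B" using X B by (intro mult_left_mono) auto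
  finally show ?thesis .
qed

text \<open>Split the increment as w b' + wt^r c (b' - b), where c is the old cut-off and w is wt^r
  times the change of the cut-off. The second term is small because b' - b is. In the first, w costs
  X^r in L^q; in L^2 the comparison of b' with the smooth a gives X^(-N), and interpolation combines
  the two.\<close>

lemma cutoff_step:
  fixes r p :: nat and Q B :: real
  assumes p: "even p" "p > 0" and Q: "Q \<ge> 0" and B: "B \<ge> 0"
  defines "N \<equiv> r * (p - 1) + p"
  shows "\<exists>K\<ge>0. \<forall>X\<ge>1. \<forall>b\<in>graded. \<forall>b'\<in>graded. \<forall>a\<in>graded.
    nrm M (2 * p - 2) (ev b') \<le> Q \<longrightarrow>
    nrm M p (ev (gdiff b' b)) \<le> 4 / X ^ Suc (N + r) \<longrightarrow>
    nrm M 2 (ev (gdiff b' a)) \<le> 3 / X ^ Suc (N + r) \<longrightarrow>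
    nrm M 2 (ev (mul (\<lambda>n. wt n ^ (r + N)) a)) \<le> B \<longrightarrow>
    nrm M p (ev (mul (\<lambda>n. wt n ^ r)
      (gdiff (mul (cutoff r N (2 * X)) b') (mul (cutoff r N X) b)))) \<le> K / X"
proof -
  have p2: "p \<ge> 2" using p by presburger
  then have q: "even (2 * p - 2)" "2 * p - 2 > 0" "p \<le> 2 * p - 2" by auto
  define C where "C = 2 ^ r * (\<Sum>i<N. 2 ^ i :: real)"
  have C: "C \<ge> 0" unfolding C_def by (intro mult_nonneg_nonneg sum_nonneg) auto
  \<comment> \<open>\<open>w\<close> is the difference of two multipliers with bounds (2 X)^r C and
    X^r C.\<close>
  define D where "D = (2 ^ r + 1) * C"
  have D: "D \<ge> 0" using C by (simp add: D_def)
  \<comment> \<open>\<open>K1\<close> serves the L^q bound and \<open>K2\<close> the L^2 bound; 3 D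
    comes from b' - a and 2 r^N B from a. The added 1 makes both positive, as the interpolation
    demands.\<close>
  define K1 K2 where "K1 = D * Q + 1" and "K2 = 3 * D + 2 * real r ^ N * B + 1"
  have K1: "K1 > 0" and K2: "K2 > 0"
    using D Q B by (auto simp: K1_def K2_def intro!: add_nonneg_pos)
  define K3 where "K3 = K2 * K1 ^ (p - 1) + 1"
  have K3: "K3 \<ge> 1" using K1 K2 by (simp add: K3_def)
  show ?thesis
  proof (intro exI[of _ "K3 + 4 * C"] conjI allI ballI impI)
    show "K3 + 4 * C \<ge> 0" using K3 C by simp
    fix X :: real and b b' a
    assume X1: "X \<ge> 1" and b: "b \<in> graded" and b': "b' \<in> graded" and a: "a \<in> graded"
      and bQ: "nrm M (2 * p - 2) (ev b') \<le> Q"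
      and bb: "nrm M p (ev (gdiff b' b)) \<le> 4 / X ^ Suc (N + r)"
      and ba: "nrm M 2 (ev (gdiff b' a)) \<le> 3 / X ^ Suc (N + r)"
      and aB: "nrm M 2 (ev (mul (\<lambda>n. wt n ^ (r + N)) a)) \<le> B"
    have X: "X > 0" "2 * X > 0" using X1 by auto
    define w where "w n = wt n ^ r * cutoff r N (2 * X) n - wt n ^ r * cutoff r N X n" for n
    have bw: "Lp_multiplier w (X ^ r * D)"
      using Lp_multiplier_diff[OF Lp_multiplier_wt_cutoff[OF X(2), of r N] Lp_multiplier_wt_cutoff[OF X(1), of r N]]
      by (simp add: w_def[abs_def] D_def C_def power_mult_distrib algebra_simps)
    define g where "g = mul w b'"
    have gg: "g \<in> graded" by (simp add: g_def graded_mul b')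
    have gq: "nrm M (2 * p - 2) (ev g) \<le> K1 * X ^ r"
    proof -
      have "nrm M (2 * p - 2) (ev g) \<le> X ^ r * D * nrm M (2 * p - 2) (ev b')"
        unfolding g_def by (rule Lp_multiplierD[OF bw b' q(1,2)])
      also have "\<dots> \<le> X ^ r * D * Q" using bQ D X by (intro mult_left_mono) auto
      also have "\<dots> \<le> K1 * X ^ r" using X by (simp add: K1_def algebra_simps)
      finally show ?thesis .
    qed
    have g2: "nrm M 2 (ev g) \<le> K2 / X ^ N"
    proof -
      have "nrm M 2 (ev g) \<le> nrm M 2 (ev (gdiff g (mul w a))) + nrm M 2 (ev (mul w a))"
        by (intro nrm_le_gdiff_add gg graded_mul a) auto
      also have "gdiff g (mul w a) = mul w (gdiff b' a)" by (simp add: g_def mul_gdiff)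
      also have "nrm M 2 (ev (mul w (gdiff b' a))) \<le> 3 * D / X ^ N"
      proof -
        have "nrm M 2 (ev (mul w (gdiff b' a))) \<le> X ^ r * D * nrm M 2 (ev (gdiff b' a))"
          by (intro Lp_multiplierD[OF bw] graded_gdiff b' a) auto
        also have "\<dots> \<le> X ^ r * D * (3 / X ^ Suc (N + r))" using ba D X by (intro mult_left_mono) auto
        also have "\<dots> = 3 * D / X ^ N / X" using X by (simp add: power_add mult_ac)
        also have "\<dots> \<le> 3 * D / X ^ N" using X1 D by (intro divide_ge_1_le) auto
        finally show ?thesis .
      qed
      also have "nrm M 2 (ev (mul w a)) \<le> 2 * (real r ^ N * B) / X ^ N"
      proof -
        \<comment> \<open>The change of the cut-off is rewritten as a difference of the complements,
          since it is these that decay on the smooth element.\<close>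
        have "mul w a = gdiff (mul (\<lambda>n. wt n ^ r * (1 - cutoff r N X n)) a) (mul (\<lambda>n. wt n ^ r * (1 - cutoff r N (2 * X) n)) a)"
        proof (intro ext)
          fix n v
          have "(x * c - x * d) * y = x * (1 - d) * y + - 1 * (x * (1 - c) * y)" for x c d y :: real
            by (simp add: left_diff_distrib right_diff_distrib)
          then show "mul w a n v = gdiff (mul (\<lambda>n. wt n ^ r * (1 - cutoff r N X n)) a)
              (mul (\<lambda>n. wt n ^ r * (1 - cutoff r N (2 * X) n)) a) n v"
            unfolding gdiff_def gadd_def mul_def w_def .
        qed
        then have "nrm M 2 (ev (mul w a)) \<le> nrm M 2 (ev (mul (\<lambda>n. wt n ^ r * (1 - cutoff r N X n)) a))
          + nrm M 2 (ev (mul (\<lambda>n. wt n ^ r * (1 - cutoff r N (2 * X) n)) a))"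
          using nrm_gdiff_le[OF graded_mul[OF a] graded_mul[OF a], of 2] by simp
        also have "\<dots> \<le> real r ^ N / X ^ N * B + real r ^ N / (2 * X) ^ N * B"
          by (intro add_mono cutoff_L2_decay X a aB)
        also have "real r ^ N / (2 * X) ^ N * B \<le> real r ^ N / X ^ N * B"
          using X B by (intro mult_right_mono divide_left_mono power_mono) auto
        finally show ?thesis by (simp add: mult.commute)
      qed
      finally have "nrm M 2 (ev g) \<le> 3 * D / X ^ N + 2 * (real r ^ N * B) / X ^ N" by simp
      also have "\<dots> \<le> K2 / X ^ N" using X by (simp add: K2_def add_divide_distrib mult.assoc)
      finally show ?thesis .
    qed
    have gp: "nrm M p (ev g) \<le> K3 / X"
    proof (rule nrm_leI[OF p])
      show "K3 / X \<ge> 0" using K3 X by simp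
      have "expectation (\<lambda>x. ev g x ^ p) \<le> K2 / X ^ N * (K1 * X ^ r) ^ (p - 1)"
        using gq g2 K1 K2 X by (intro nrm_interpolation p ev_in_L gg) auto
      also have "\<dots> = K2 * K1 ^ (p - 1) / X ^ p"
      proof -
        have "X ^ N = (X ^ r) ^ (p - 1) * X ^ p" by (simp add: N_def power_add power_mult)
        moreover have "K2 / (A * E) * (K1 ^ (p - 1) * A) = K2 * K1 ^ (p - 1) / E" if "A > 0" for A E
          using that by simp
        ultimately show ?thesis using X by (simp add: power_mult_distrib)
      qed
      \<comment> \<open>\<open>K3\<close> \<ge> 1 gives \<open>K3\<close> \<le> \<open>K3\<close>^p,
        which makes the bound a p-th power.\<close>
      also have "\<dots> \<le> K3 ^ p / X ^ p"
        using K3 self_le_power[OF K3 p(2)] X by (intro divide_right_mono) (auto simp: K3_def)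
      finally show "expectation (\<lambda>x. ev g x ^ p) \<le> (K3 / X) ^ p" by (simp add: power_divide)
    qed
    define h where "h = mul (\<lambda>n. wt n ^ r * cutoff r N X n) (gdiff b' b)"
    have hg: "h \<in> graded" unfolding h_def by (intro graded_mul graded_gdiff b b')
    have hp: "nrm M p (ev h) \<le> 4 * C / X"
    proof -
      have "nrm M p (ev h) \<le> X ^ r * C * nrm M p (ev (gdiff b' b))"
        unfolding h_def C_def by (intro Lp_multiplierD Lp_multiplier_wt_cutoff X graded_gdiff b b' p)
      also have "\<dots> \<le> X ^ r * C * (4 / X ^ Suc (N + r))" using bb C X by (intro mult_left_mono) auto
      also have "\<dots> = 4 * C / X / X ^ N" using X by (simp add: power_add)
      also have "\<dots> \<le> 4 * C / X" using X1 C by (intro divide_ge_1_le) (auto simp: one_le_power)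
      finally show ?thesis .
    qed
    have "mul (\<lambda>n. wt n ^ r) (gdiff (mul (cutoff r N (2 * X)) b') (mul (cutoff r N X) b)) = gadd g h"
    proof (intro ext)
      fix n v
      have "x * (c * y + - 1 * (d * z)) = (x * c - x * d) * y + x * d * (y + - 1 * z)" for x c d y z :: real
        by (simp add: left_diff_distrib right_diff_distrib)
      then show "mul (\<lambda>n. wt n ^ r) (gdiff (mul (cutoff r N (2 * X)) b') (mul (cutoff r N X) b)) n v = gadd g h n v"
        unfolding g_def h_def gdiff_def gadd_def mul_def w_def .
    qed
    then have "ev (mul (\<lambda>n. wt n ^ r) (gdiff (mul (cutoff r N (2 * X)) b') (mul (cutoff r N X) b)))
      = (\<lambda>x. ev g x + ev h x)"
      using ev_gadd[OF gg hg] by auto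
    then show "nrm M p (ev (mul (\<lambda>n. wt n ^ r)
      (gdiff (mul (cutoff r N (2 * X)) b') (mul (cutoff r N X) b)))) \<le> (K3 + 4 * C) / X"
      using nrm_triangle[OF p ev_in_L[OF gg] ev_in_L[OF hg]] gp hp by (simp add: add_divide_distrib)
  qed
qed

text \<open>The complement of the cut-off is bounded in L^q uniformly in X, and on b it is small in
  L^2, because b is near a and the complement decays on a. Interpolation gives 1 / X for the p-th
  power of the norm, enough for a limit.\<close>

lemma cutoff_converges:
  fixes r p :: nat and Q B :: real
  assumes p: "even p" "p > 0" and N: "N > 0" and Q: "Q \<ge> 0" and B: "B \<ge> 0"
  shows "\<exists>K\<ge>0. \<forall>X\<ge>1. \<forall>b\<in>graded. \<forall>a\<in>graded.
    nrm M (2 * p - 2) (ev b) \<le> Q \<longrightarrow>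
    nrm M 2 (ev (gdiff b a)) \<le> 3 / X \<longrightarrow>
    nrm M 2 (ev (mul (\<lambda>n. wt n ^ (r + N)) a)) \<le> B \<longrightarrow>
    nrm M p (ev (mul (\<lambda>n. 1 - cutoff r N X n) b)) ^ p \<le> K / X"
proof -
  have p2: "p \<ge> 2" using p by presburger
  then have q: "even (2 * p - 2)" "2 * p - 2 > 0" by auto
  define K1 K2 where "K1 = 2 ^ N * Q + 1" and "K2 = 3 * 2 ^ N + real r ^ N * B + 1"
  have K1: "K1 > 0" and K2: "K2 > 0"
    using Q B by (auto simp: K1_def K2_def intro!: add_nonneg_pos add_nonneg_nonneg)
  show ?thesis
  proof (intro exI[of _ "K2 * K1 ^ (p - 1)"] conjI allI ballI impI)
    show "K2 * K1 ^ (p - 1) \<ge> 0" using K1 K2 by simp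
    fix X :: real and b a
    assume X1: "X \<ge> 1" and b: "b \<in> graded" and a: "a \<in> graded"
      and bQ: "nrm M (2 * p - 2) (ev b) \<le> Q"
      and ba: "nrm M 2 (ev (gdiff b a)) \<le> 3 / X"
      and aB: "nrm M 2 (ev (mul (\<lambda>n. wt n ^ (r + N)) a)) \<le> B"
    have X: "X > 0" using X1 by simp
    define w where "w n = 1 - cutoff r N X n" for n
    have bw: "Lp_multiplier w (2 ^ N)" using Lp_multiplier_one_minus_cutoff[OF X] by (simp add: w_def[abs_def])
    define g where "g = mul w b"
    have gg: "g \<in> graded" by (simp add: g_def graded_mul b)
    have gq: "nrm M (2 * p - 2) (ev g) \<le> K1"
    proof -
      have "nrm M (2 * p - 2) (ev g) \<le> 2 ^ N * nrm M (2 * p - 2) (ev b)"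
        unfolding g_def by (rule Lp_multiplierD[OF bw b q])
      also have "\<dots> \<le> 2 ^ N * Q" using bQ by (intro mult_left_mono) auto
      finally show ?thesis by (simp add: K1_def)
    qed
    have g2: "nrm M 2 (ev g) \<le> K2 / X"
    proof -
      have "nrm M 2 (ev g) \<le> nrm M 2 (ev (gdiff g (mul w a))) + nrm M 2 (ev (mul w a))"
        by (intro nrm_le_gdiff_add gg graded_mul a) auto
      also have "gdiff g (mul w a) = mul w (gdiff b a)" by (simp add: g_def mul_gdiff)
      also have "nrm M 2 (ev (mul w (gdiff b a))) \<le> 2 ^ N * (3 / X)"
        by (rule order_trans[OF Lp_multiplierD[OF bw graded_gdiff[OF b a]] mult_left_mono[OF ba]]) auto
      also have "nrm M 2 (ev (mul w a)) \<le> real r ^ N * B / X"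
      proof -
        \<comment> \<open>Control of order r + N yields control of order N, negative powers of
          \<open>wt\<close> being multipliers with bound 1; the decay lemma is then applied with k =
          0.\<close>
        have "mul (\<lambda>n. wt n ^ (0 + N)) a = mul (\<lambda>n. 1 / wt n ^ r) (mul (\<lambda>n. wt n ^ (r + N)) a)"
          unfolding mul_mul using wt_pos by (auto simp: mul_def power_add fun_eq_iff less_imp_neq[symmetric])
        then have "nrm M 2 (ev (mul (\<lambda>n. wt n ^ (0 + N)) a)) \<le> B"
          using Lp_multiplierD[OF Lp_multiplier_inverse_wt_power[of r] graded_mul[OF a], of 2 "\<lambda>n. wt n ^ (r + N)"] aB by simp
        from cutoff_L2_decay[OF X a this, of r]
        have "nrm M 2 (ev (mul w a)) \<le> real r ^ N / X ^ N * B" by (simp add: w_def[abs_def])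
        also have "\<dots> \<le> real r ^ N / X * B"
        proof -
          have "X \<le> X ^ N" using self_le_power[OF X1 N] .
          then show ?thesis using X B by (intro mult_right_mono divide_left_mono) auto
        qed
        finally show ?thesis by simp
      qed
      finally have "nrm M 2 (ev g) \<le> 2 ^ N * (3 / X) + real r ^ N * B / X" by simp
      also have "\<dots> \<le> K2 / X" using X by (simp add: K2_def add_divide_distrib mult.commute)
      finally show ?thesis .
    qed
    have "expectation (\<lambda>x. ev g x ^ p) \<le> K2 / X * K1 ^ (p - 1)"
      using gq g2 K1 K2 X by (intro nrm_interpolation p ev_in_L gg) auto
    then show "nrm M p (ev (mul (\<lambda>n. 1 - cutoff r N X n) b)) ^ p \<le> K2 * K1 ^ (p - 1) / X"
      unfolding nrm_power[OF p] by (simp add: g_def w_def[abs_def])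
  qed
qed

text \<open>With X = 2^j the errors of order 1 / X from \<open>cutoff_step\<close> form a geometric
  series. One bound \<open>B\<close> serves all accuracies of the smooth approximants, so that the
  resulting constant does not depend on j.\<close>

lemma smooth_approximation:
  fixes r p :: nat
  assumes p: "even p" "p > 0" and U: "U \<noteq> {}"
  defines "N \<equiv> r * (p - 1) + p"
  assumes f: "\<And>q. even q \<Longrightarrow> q > 0 \<Longrightarrow> in_L M q f"
    and smooth: "\<And>e. e > 0 \<Longrightarrow> \<exists>a\<in>graded. nrm M 2 (\<lambda>x. f x - ev a x) < e \<and> nrm M 2 (ev (mul (\<lambda>n. wt n ^ (r + N)) a)) \<le> B"
  shows "\<exists>u K. (\<forall>j::nat. u j \<in> graded) \<and> (\<lambda>j. nrm M p (\<lambda>x. f x - ev (u j) x)) \<longlonglongrightarrow> 0 \<and>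
    K \<ge> 0 \<and> (\<forall>j. nrm M p (ev (mul (\<lambda>n. wt n ^ r) (gdiff (u (Suc j)) (u j)))) \<le> K / 2 ^ j)"
proof -
  have p2: "p \<ge> 2" using p by presburger
  then have q: "even (2 * p - 2)" "2 * p - 2 > 0" "p \<le> 2 * p - 2" "2 \<le> 2 * p - 2" by auto
  \<comment> \<open>This is X^(-(N + r + 1)) at X = 2^j: it absorbs the factor X^r of the cut-off
    and still leaves X^(-N-1).\<close>
  define \<epsilon> :: "nat \<Rightarrow> real" where "\<epsilon> j = 1 / (2 ^ j) ^ Suc (N + r)" for j
  have \<epsilon>: "\<epsilon> j > 0" "\<epsilon> j \<le> 1" "\<epsilon> (Suc j) \<le> \<epsilon> j" "\<epsilon> j \<le> 1 / 2 ^ j" for j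
  proof -
    show "\<epsilon> j > 0" by (simp add: \<epsilon>_def)
    show "\<epsilon> j \<le> 1" by (simp add: \<epsilon>_def one_le_power del: power_Suc)
    show "\<epsilon> (Suc j) \<le> \<epsilon> j" unfolding \<epsilon>_def by (intro divide_left_mono power_mono) auto
    have "(2::real) ^ j \<le> (2 ^ j) ^ Suc (N + r)" by (rule self_le_power) auto
    then show "\<epsilon> j \<le> 1 / 2 ^ j" unfolding \<epsilon>_def by (intro divide_left_mono) auto
  qed
  have "\<exists>b. b \<in> graded \<and> nrm M (2 * p - 2) (\<lambda>x. f x - ev b x) < \<epsilon> j" for j
  proof -
    obtain \<phi> where \<phi>: "\<phi> \<in> poly_functionals H" "nrm M (2 * p - 2) (\<lambda>x. f x - \<phi> x) < \<epsilon> j"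
      using approxD(2)[OF in_L_approx[OF q(1,2) f[OF q(1,2)]] \<epsilon>(1)] by blast
    obtain A where A: "A \<in> graded" "AE \<omega> in M. \<phi> \<omega> = ev A \<omega>"
      by (rule poly_functionals_graded[OF U \<phi>(1)])
    have "nrm M (2 * p - 2) (\<lambda>x. f x - ev A x) = nrm M (2 * p - 2) (\<lambda>x. f x - \<phi> x)"
    proof (rule nrm_cong_AE)
      show "AE x in M. f x - ev A x = f x - \<phi> x" using A(2) by eventually_elim simp
    qed (use in_L_measurable[OF f[OF q(1,2)]] in_L_measurable[OF ev_in_L[OF A(1), of 2]]
        in_L_measurable[OF poly_functionals_in_L[OF \<phi>(1), of 2]] in \<open>auto intro: borel_measurable_diff\<close>)
    with A \<phi> show ?thesis by auto
  qed
  then have "\<forall>j. \<exists>b. b \<in> graded \<and> nrm M (2 * p - 2) (\<lambda>x. f x - ev b x) < \<epsilon> j" by blast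
  from choice[OF this] obtain b where
    b': "\<forall>j. b j \<in> graded \<and> nrm M (2 * p - 2) (\<lambda>x. f x - ev (b j) x) < \<epsilon> j" ..
  then have b: "\<And>j. b j \<in> graded" and bf: "\<And>j. nrm M (2 * p - 2) (\<lambda>x. f x - ev (b j) x) < \<epsilon> j" by auto
  have "\<forall>j. \<exists>a. a \<in> graded \<and> nrm M 2 (\<lambda>x. f x - ev a x) < \<epsilon> j \<and> nrm M 2 (ev (mul (\<lambda>n. wt n ^ (r + N)) a)) \<le> B"
    using smooth[OF \<epsilon>(1)] by blast
  from choice[OF this] obtain a where
    a': "\<forall>j. a j \<in> graded \<and> nrm M 2 (\<lambda>x. f x - ev (a j) x) < \<epsilon> j \<and> nrm M 2 (ev (mul (\<lambda>n. wt n ^ (r + N)) (a j))) \<le> B" ..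
  then have a: "\<And>j. a j \<in> graded" and af: "\<And>j. nrm M 2 (\<lambda>x. f x - ev (a j) x) < \<epsilon> j"
    and aB: "\<And>j. nrm M 2 (ev (mul (\<lambda>n. wt n ^ (r + N)) (a j))) \<le> B" by auto
  have B: "B \<ge> 0" using aB[of 0] nrm_nonneg[of 2 M] by (meson even_numeral order_trans)
  define Q where "Q = nrm M (2 * p - 2) f + 1"
  have Q: "Q \<ge> 0" using nrm_nonneg[OF q(1), of M f] by (simp add: Q_def)
  have fq: "in_L M (2 * p - 2) f" "in_L M p f" "in_L M 2 f" using f q p by auto
  note bL = ev_in_L[OF b] and aL = ev_in_L[OF a]
  have bQ: "nrm M (2 * p - 2) (ev (b j)) \<le> Q" for j
  proof -
    have "nrm M (2 * p - 2) (ev (b j)) = nrm M (2 * p - 2) (\<lambda>x. f x - (f x - ev (b j) x))" by simp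
    also have "\<dots> \<le> nrm M (2 * p - 2) f + nrm M (2 * p - 2) (\<lambda>x. f x - ev (b j) x)"
      by (intro nrm_triangle_diff in_L_diff q fq bL)
    finally show ?thesis using bf[of j] \<epsilon>(2)[of j] by (simp add: Q_def)
  qed
  have bfp: "nrm M p (\<lambda>x. f x - ev (b j) x) \<le> 2 * \<epsilon> j" for j
    using nrm_mono[OF in_L_diff[OF q(1,2) fq(1) bL] p q(1,3), of j] bf[of j] by simp
  have bf2: "nrm M 2 (\<lambda>x. f x - ev (b j) x) \<le> 2 * \<epsilon> j" for j
    using nrm_mono[OF in_L_diff[OF q(1,2) fq(1) bL] _ _ q(1,4), of j] bf[of j] by simp
  \<comment> \<open>4 = 2 + 2, as each passage from L^q to L^p by \<open>nrm_mono\<close> costs a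
    factor 2; likewise 3 = 2 + 1 in \<open>ba\<close>, where the smooth approximant is measured in
    L^2 from the start.\<close>
  have bb: "nrm M p (ev (gdiff (b (Suc j)) (b j))) \<le> 4 * \<epsilon> j" for j
  proof -
    have "nrm M p (ev (gdiff (b (Suc j)) (b j))) \<le> nrm M p (\<lambda>x. ev (b (Suc j)) x - f x) + nrm M p (\<lambda>x. f x - ev (b j) x)"
      unfolding nrm_ev_gdiff[OF b b] by (intro nrm_triangle_via p bL fq)
    then show ?thesis
      using bfp[of j] bfp[of "Suc j"] \<epsilon>(3)[of j] nrm_minus[OF p(1), of M f "ev (b (Suc j))"] by simp
  qed
  have ba: "nrm M 2 (ev (gdiff (b j) (a j))) \<le> 3 * \<epsilon> j" for j
  proof -
    have "nrm M 2 (ev (gdiff (b j) (a j))) \<le> nrm M 2 (\<lambda>x. ev (b j) x - f x) + nrm M 2 (\<lambda>x. f x - ev (a j) x)"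
      unfolding nrm_ev_gdiff[OF b a] by (intro nrm_triangle_via bL fq aL) auto
    then show ?thesis
      using bf2[of j] af[of j] nrm_minus[of 2 M f "ev (b j)"] by simp
  qed
  obtain K where K: "K \<ge> 0" "\<forall>X\<ge>1. \<forall>b\<in>graded. \<forall>b'\<in>graded. \<forall>a\<in>graded.
    nrm M (2 * p - 2) (ev b') \<le> Q \<longrightarrow>
    nrm M p (ev (gdiff b' b)) \<le> 4 / X ^ Suc (N + r) \<longrightarrow>
    nrm M 2 (ev (gdiff b' a)) \<le> 3 / X ^ Suc (N + r) \<longrightarrow>
    nrm M 2 (ev (mul (\<lambda>n. wt n ^ (r + N)) a)) \<le> B \<longrightarrow>
    nrm M p (ev (mul (\<lambda>n. wt n ^ r)
      (gdiff (mul (cutoff r N (2 * X)) b') (mul (cutoff r N X) b)))) \<le> K / X"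
    using cutoff_step[OF p Q B, of r] unfolding N_def by blast
  have "N > 0" using p by (simp add: N_def)
  from cutoff_converges[OF p this Q B, of r]
  obtain K' where K': "K' \<ge> 0" "\<forall>X\<ge>1. \<forall>b\<in>graded. \<forall>a\<in>graded.
    nrm M (2 * p - 2) (ev b) \<le> Q \<longrightarrow>
    nrm M 2 (ev (gdiff b a)) \<le> 3 / X \<longrightarrow>
    nrm M 2 (ev (mul (\<lambda>n. wt n ^ (r + N)) a)) \<le> B \<longrightarrow>
    nrm M p (ev (mul (\<lambda>n. 1 - cutoff r N X n) b)) ^ p \<le> K' / X"
    by blast
  define u where "u j = mul (cutoff r N (2 ^ j)) (b j)" for j
  have u: "u j \<in> graded" for j by (simp add: u_def graded_mul b)
  show ?thesis
  proof (intro exI[of _ u] exI[of _ K] conjI allI u K(1))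
    fix j
    have "nrm M p (ev (mul (\<lambda>n. wt n ^ r)
      (gdiff (mul (cutoff r N (2 * 2 ^ j)) (b (Suc j))) (mul (cutoff r N (2 ^ j)) (b j))))) \<le> K / 2 ^ j"
    proof (rule K(2)[rule_format, OF _ b b a])
      show "nrm M (2 * p - 2) (ev (b (Suc j))) \<le> Q" by (rule bQ)
      show "nrm M p (ev (gdiff (b (Suc j)) (b j))) \<le> 4 / (2 ^ j) ^ Suc (N + r)"
        using bb[of j] by (simp add: \<epsilon>_def del: power_Suc)
      \<comment> \<open>The smooth element has index Suc j to match \<open>b (Suc j)\<close>;
        monotonicity of \<epsilon> brings the bound back to X = 2^j.\<close>
      show "nrm M 2 (ev (gdiff (b (Suc j)) (a (Suc j)))) \<le> 3 / (2 ^ j) ^ Suc (N + r)"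
        using ba[of "Suc j"] \<epsilon>(3)[of j] by (simp add: \<epsilon>_def del: power_Suc)
    qed (use aB in auto)
    then show "nrm M p (ev (mul (\<lambda>n. wt n ^ r) (gdiff (u (Suc j)) (u j)))) \<le> K / 2 ^ j"
      by (simp add: u_def)
  next
    have c: "nrm M p (ev (mul (\<lambda>n. 1 - cutoff r N (2 ^ j) n) (b j))) ^ p \<le> K' / 2 ^ j" for j
    proof (rule K'(2)[rule_format, OF _ b a])
      show "nrm M 2 (ev (gdiff (b j) (a j))) \<le> 3 / 2 ^ j" using ba[of j] \<epsilon>(4)[of j] by simp
    qed (use aB bQ in auto)
    note z = tendsto_divide_power2
    have "(\<lambda>j. root p (nrm M p (ev (mul (\<lambda>n. 1 - cutoff r N (2 ^ j) n) (b j))) ^ p)) \<longlonglongrightarrow> root p 0"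
      by (intro tendsto_real_root tendsto_sandwich[OF _ _ tendsto_const z[of K']] always_eventually allI c
        zero_le_even_power[OF p(1)])
    then have g: "(\<lambda>j. nrm M p (ev (mul (\<lambda>n. 1 - cutoff r N (2 ^ j) n) (b j)))) \<longlonglongrightarrow> 0"
      by (simp add: real_root_power_cancel[OF p(2) nrm_nonneg[OF p(1)]])
    show "(\<lambda>j. nrm M p (\<lambda>x. f x - ev (u j) x)) \<longlonglongrightarrow> 0"
    proof (rule tendsto_sandwich[OF _ _ tendsto_const])
      show "(\<lambda>j. 2 / 2 ^ j + nrm M p (ev (mul (\<lambda>n. 1 - cutoff r N (2 ^ j) n) (b j)))) \<longlonglongrightarrow> 0"
        using tendsto_add[OF z g] by simp
      show "\<forall>\<^sub>F j in sequentially. nrm M p (\<lambda>x. f x - ev (u j) x)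
        \<le> 2 / 2 ^ j + nrm M p (ev (mul (\<lambda>n. 1 - cutoff r N (2 ^ j) n) (b j)))"
      proof (intro always_eventually allI)
        fix j
        have "mul (\<lambda>n. 1 - cutoff r N (2 ^ j) n) (b j) = gdiff (b j) (u j)"
          by (simp add: u_def gdiff_def gadd_def mul_def fun_eq_iff algebra_simps)
        moreover have "nrm M p (\<lambda>x. f x - ev (u j) x) \<le> nrm M p (\<lambda>x. f x - ev (b j) x) + nrm M p (\<lambda>x. ev (b j) x - ev (u j) x)"
          by (intro nrm_triangle_via p fq bL ev_in_L u)
        ultimately show "nrm M p (\<lambda>x. f x - ev (u j) x)
          \<le> 2 / 2 ^ j + nrm M p (ev (mul (\<lambda>n. 1 - cutoff r N (2 ^ j) n) (b j)))"
          using bfp[of j] \<epsilon>(4)[of j] by (simp add: nrm_ev_gdiff[OF b u])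
      qed
    qed (intro always_eventually allI nrm_nonneg p(1))
  qed
qed

end

subsection \<open>Sobolev spaces\<close>

lemma abs_powr_even: "even p \<Longrightarrow> p > 0 \<Longrightarrow> \<bar>x\<bar> powr real p = (x :: real) ^ p"
  by (cases "x = 0") (auto simp: powr_realpow power_even_abs)

lemma Lp_even: "even p \<Longrightarrow> p > 0 \<Longrightarrow> f \<in> Lp M (real p) \<longleftrightarrow> in_L M p f"
  by (simp add: Lp_def in_L_def abs_powr_even)

lemma integral_powr_even:
  "even p \<Longrightarrow> p > 0 \<Longrightarrow> integral\<^sup>L M (\<lambda>x. \<bar>u x\<bar> powr real p) = nrm M p u ^ p"
  by (simp add: nrm_power abs_powr_even)

context prob_space
begin

text \<open>For |y| > \<delta> the exponent p - P is at most 0, so |y|^(p-P) \<le> \<delta>^(p-P).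
  This transfers statements for an even P to real exponents below it.\<close>

lemma powr_split:
  assumes "\<delta> > 0" "0 < p" "p \<le> real P"
  shows "\<bar>y\<bar> powr p \<le> \<delta> powr p + \<delta> powr (p - real P) * \<bar>y\<bar> ^ P"
proof (cases "\<bar>y\<bar> \<le> \<delta>")
  case True
  then have "\<bar>y\<bar> powr p \<le> \<delta> powr p" using assms by (intro powr_mono2) auto
  moreover have "0 \<le> \<delta> powr (p - real P) * \<bar>y\<bar> ^ P" by simp
  ultimately show ?thesis by linarith
next
  case False
  then have y: "\<bar>y\<bar> > 0" "\<bar>y\<bar> > \<delta>" using assms by auto
  have "\<bar>y\<bar> powr p = \<bar>y\<bar> powr (p - real P) * \<bar>y\<bar> ^ P"
    using y by (simp add: powr_realpow[symmetric] powr_add[symmetric])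
  also have "\<dots> \<le> \<delta> powr (p - real P) * \<bar>y\<bar> ^ P"
    using y assms by (intro mult_right_mono powr_mono2') auto
  moreover have "\<delta> powr p \<ge> 0" by simp
  ultimately show ?thesis by linarith
qed

lemma Lp_of_in_L:
  assumes "in_L M P f" "even P" "0 < p" "p \<le> real P"
  shows "f \<in> Lp M p"
proof -
  have [measurable]: "f \<in> borel_measurable M" using assms by (simp add: in_L_def)
  have "integrable M (\<lambda>x. 1 powr p + 1 powr (p - real P) * \<bar>f x\<bar> ^ P)"
    using assms by (simp add: in_L_def power_even_abs)
  then have "integrable M (\<lambda>x. \<bar>f x\<bar> powr p)"
    by (rule Bochner_Integration.integrable_bound) (use powr_split[of 1 p P] assms in auto)
  then show ?thesis by (simp add: Lp_def)
qed

lemma powr_integral_small: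
  assumes P: "even P" "P > 0" and p: "0 < p" "p \<le> real P" and e: "e > 0"
  obtains d where "d > 0" "\<And>g. in_L M P g \<Longrightarrow> nrm M P g \<le> d \<Longrightarrow> expectation (\<lambda>x. \<bar>g x\<bar> powr p) < e"
proof -
  \<comment> \<open>\<delta>^p takes e / 3; \<open>D\<close> and \<open>d\<close> limit the second
    term to e / 3 as well, which leaves a strict inequality.\<close>
  define \<delta> where "\<delta> = (e / 3) powr (1 / p)"
  have \<delta>: "\<delta> > 0" "\<delta> powr p = e / 3" using e p by (auto simp: \<delta>_def powr_powr)
  define D where "D = e / 3 / \<delta> powr (p - real P)"
  have D: "D > 0" using e \<delta> by (simp add: D_def)
  define d where "d = root P D"
  have d: "d > 0" "d ^ P = D" using D P by (auto simp: d_def real_root_gt_zero)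
  show ?thesis
  proof (rule that[OF d(1)])
    fix g assume g: "in_L M P g" "nrm M P g \<le> d"
    have i: "integrable M (\<lambda>x. \<bar>g x\<bar> ^ P)" using g P by (simp add: in_L_def power_even_abs)
    have "expectation (\<lambda>x. \<bar>g x\<bar> powr p) \<le> expectation (\<lambda>x. \<delta> powr p + \<delta> powr (p - real P) * \<bar>g x\<bar> ^ P)"
      using Lp_of_in_L[OF g(1) P(1) p] i powr_split[OF \<delta>(1) p] by (intro integral_mono) (auto simp: Lp_def)
    also have "\<dots> = e / 3 + \<delta> powr (p - real P) * expectation (\<lambda>x. g x ^ P)"
      using i P by (simp add: prob_space \<delta> power_even_abs)
    also have "\<dots> \<le> e / 3 + \<delta> powr (p - real P) * D"
      using nrm_leD[OF P g(2)] d(2) by (intro add_left_mono mult_left_mono) auto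
    also have "\<dots> < e" using e \<delta>(1) by (simp add: D_def)
    finally show "expectation (\<lambda>x. \<bar>g x\<bar> powr p) < e" .
  qed
qed

lemma powr_integral_tendsto:
  assumes P: "even P" "P > 0" and p: "0 < p" "p \<le> real P"
    and g: "\<And>k. in_L M P (g k)" and lim: "(\<lambda>k. nrm M P (g k)) \<longlonglongrightarrow> 0"
  shows "(\<lambda>k. expectation (\<lambda>x. \<bar>g k x\<bar> powr p)) \<longlonglongrightarrow> 0"
proof (rule order_tendstoI)
  fix e :: real assume "e < 0"
  moreover have "0 \<le> expectation (\<lambda>x. \<bar>g k x\<bar> powr p)" for k
    by (intro Bochner_Integration.integral_nonneg) simp
  ultimately show "\<forall>\<^sub>F k in sequentially. e < expectation (\<lambda>x. \<bar>g k x\<bar> powr p)"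
    by (intro always_eventually allI) (rule less_le_trans)
next
  fix e :: real assume e: "e > 0"
  obtain d where d: "d > 0" "\<And>g. in_L M P g \<Longrightarrow> nrm M P g \<le> d \<Longrightarrow> expectation (\<lambda>x. \<bar>g x\<bar> powr p) < e"
    by (rule powr_integral_small[OF P p e]) blast
  have "\<forall>\<^sub>F k in sequentially. nrm M P (g k) < d"
    using order_tendstoD(2)[OF lim d(1)] .
  then show "\<forall>\<^sub>F k in sequentially. expectation (\<lambda>x. \<bar>g k x\<bar> powr p) < e"
    by eventually_elim (intro d g less_imp_le)
qed

end

context gaussian
begin

text \<open>Membership for a real p is verified in the norm of an even P \<ge> p, where the
  multiplier bounds live.\<close>

lemma sobolevI:
  assumes P: "even P" "P > 0" and p: "0 < p" "p \<le> real P"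
    and f: "in_L M P f" and \<phi>: "\<And>k. \<phi> k \<in> poly_functionals H"
    and ou: "\<And>k. in_L M P (ou_pow M H r (\<phi> k))"
    and lim: "(\<lambda>k. nrm M P (\<lambda>x. f x - \<phi> k x)) \<longlonglongrightarrow> 0"
    and cauchy: "\<And>e. e > 0 \<Longrightarrow> \<exists>N. \<forall>m\<ge>N. \<forall>n\<ge>N. nrm M P (\<lambda>x. ou_pow M H r (\<phi> m) x - ou_pow M H r (\<phi> n) x) \<le> e"
  shows "f \<in> sobolev M H p r"
  unfolding sobolev_def
proof (intro CollectI conjI exI[of _ \<phi>] allI impI \<phi>)
  show "f \<in> Lp M p" by (rule Lp_of_in_L[OF f P(1) p])
  show "ou_pow M H r (\<phi> k) \<in> Lp M p" for k by (rule Lp_of_in_L[OF ou P(1) p])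
  have "(\<lambda>k. nrm M P (\<lambda>x. \<phi> k x - f x)) \<longlonglongrightarrow> 0"
    using lim by (simp add: nrm_minus[OF P(1), of M f])
  from powr_integral_tendsto[OF P p in_L_diff[OF P poly_functionals_in_L[OF \<phi>] f] this]
  show "(\<lambda>k. expectation (\<lambda>x. \<bar>\<phi> k x - f x\<bar> powr p)) \<longlonglongrightarrow> 0" .
  fix e :: real assume e: "e > 0"
  obtain d where d: "d > 0" "\<And>g. in_L M P g \<Longrightarrow> nrm M P g \<le> d \<Longrightarrow> expectation (\<lambda>x. \<bar>g x\<bar> powr p) < e"
    by (rule powr_integral_small[OF P p e]) blast
  obtain N where N: "\<forall>m\<ge>N. \<forall>n\<ge>N. nrm M P (\<lambda>x. ou_pow M H r (\<phi> m) x - ou_pow M H r (\<phi> n) x) \<le> d"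
    using cauchy[OF d(1)] by blast
  show "\<exists>N. \<forall>m\<ge>N. \<forall>n\<ge>N. expectation (\<lambda>x. \<bar>ou_pow M H r (\<phi> m) x - ou_pow M H r (\<phi> n) x\<bar> powr p) < e"
    using N by (intro exI[of _ N] allI impI d(2) in_L_diff[OF P] ou) auto
qed

text \<open>Order 2 k in \<open>ou_pow\<close> is the whole power (1 - L)^k. From the Cauchy
  property a bound on (1 - L)^k along the sequence is extracted, without identifying the
  limit.\<close>

lemma sobolev_2_bounded_approximation:
  assumes U: "U \<noteq> {}" and f: "f \<in> sobolev M H 2 (real (2 * k))"
  shows "\<exists>B. \<forall>e>0. \<exists>a\<in>graded. nrm M 2 (\<lambda>x. f x - ev a x) < e \<and> nrm M 2 (ev (mul (\<lambda>n. wt n ^ k) a)) \<le> B"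
proof -
  let ?ou = "ou_pow M H (real (2 * k))"
  have two: "even (2::nat)" "(2::nat) > 0" by auto
  note [simp] = integral_powr_even[OF two, simplified]
  obtain \<phi> where fL: "f \<in> Lp M 2" and \<phi>: "\<And>j. \<phi> j \<in> poly_functionals H"
    and lim: "(\<lambda>j. expectation (\<lambda>x. \<bar>\<phi> j x - f x\<bar> powr 2)) \<longlonglongrightarrow> 0"
    and c: "\<forall>e>0. \<exists>N. \<forall>m\<ge>N. \<forall>n\<ge>N. expectation (\<lambda>x. \<bar>?ou (\<phi> m) x - ?ou (\<phi> n) x\<bar> powr 2) < e"
    using f unfolding sobolev_def by blast
  have fL: "in_L M 2 f" using fL Lp_even[OF two, of f M] by simp
  note \<phi>L = poly_functionals_in_L[OF \<phi>]
  have "\<exists>A. A \<in> graded \<and> (AE \<omega> in M. \<phi> j \<omega> = ev A \<omega>) \<and> decomposes (\<phi> j) A" for j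
  proof -
    obtain B where "B \<in> graded" "AE \<omega> in M. \<phi> j \<omega> = ev B \<omega>" "decomposes (\<phi> j) B"
      by (rule poly_functionals_graded[OF U \<phi>])
    then show ?thesis by blast
  qed
  then have "\<forall>j. \<exists>A. A \<in> graded \<and> (AE \<omega> in M. \<phi> j \<omega> = ev A \<omega>) \<and> decomposes (\<phi> j) A" by blast
  from choice[OF this] obtain A where
    A': "\<forall>j. A j \<in> graded \<and> (AE \<omega> in M. \<phi> j \<omega> = ev (A j) \<omega>) \<and> decomposes (\<phi> j) (A j)" ..
  then have A: "\<And>j. A j \<in> graded" "\<And>j. AE \<omega> in M. \<phi> j \<omega> = ev (A j) \<omega>" "\<And>j. decomposes (\<phi> j) (A j)" by auto
  define G where "G j = mul (\<lambda>n. wt n ^ k) (A j)" for j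
  have G: "G j \<in> graded" for j by (simp add: G_def graded_mul A)
  have e: "(1 + real n) powr (real (2 * k) / 2) = wt n ^ k" for n
    by (simp add: wt_def powr_realpow add_pos_nonneg)
  have ou: "AE \<omega> in M. ?ou (\<phi> j) \<omega> = ev (G j) \<omega>" and oum: "?ou (\<phi> j) \<in> borel_measurable M" for j
    using ou_pow_AE[OF A(3), of "real (2 * k)" j] unfolding e G_def by auto
  note GL = ev_in_L[OF G, of 2]
  obtain N where N: "\<forall>m\<ge>N. \<forall>n\<ge>N. expectation (\<lambda>x. \<bar>?ou (\<phi> m) x - ?ou (\<phi> n) x\<bar> powr 2) < 1"
    using c by (auto dest: spec[of _ 1])
  \<comment> \<open>The Cauchy property with tolerance 1 bounds all terms from \<open>N\<close> on;
    the approximant is later taken beyond both \<open>N\<close> and the accuracy threshold.\<close>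
  define B where "B = 1 + nrm M 2 (ev (G N))"
  have B: "nrm M 2 (ev (G m)) \<le> B" if "m \<ge> N" for m
  proof -
    have ae: "AE x in M. ?ou (\<phi> m) x - ?ou (\<phi> N) x = ev (gdiff (G m) (G N)) x"
      using ou[of m] ou[of N] by eventually_elim (simp add: ev_gdiff G)
    have "nrm M 2 (ev (gdiff (G m) (G N))) = nrm M 2 (\<lambda>x. ?ou (\<phi> m) x - ?ou (\<phi> N) x)"
      by (rule nrm_cong_AE[symmetric, OF ae borel_measurable_diff[OF oum oum] in_L_measurable[OF ev_in_L[OF graded_gdiff[OF G G]]]])
    also have "\<dots> \<le> 1"
    proof (rule nrm_leI[OF two])
      show "expectation (\<lambda>x. (?ou (\<phi> m) x - ?ou (\<phi> N) x)\<^sup>2) \<le> 1\<^sup>2"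
        using N[rule_format, OF that order_refl] nrm_power[OF two, of M "\<lambda>x. ?ou (\<phi> m) x - ?ou (\<phi> N) x"] by simp
    qed simp
    finally show ?thesis
      using nrm_le_gdiff_add[OF G[of m] G[of N] two] by (simp add: B_def)
  qed
  have lim': "(\<lambda>j. nrm M 2 (\<lambda>x. f x - ev (A j) x) ^ 2) \<longlonglongrightarrow> 0"
  proof -
    have "nrm M 2 (\<lambda>x. f x - ev (A j) x) = nrm M 2 (\<lambda>x. \<phi> j x - f x)" for j
    proof -
      have "AE x in M. f x - ev (A j) x = f x - \<phi> j x" using A(2)[of j] by eventually_elim simp
      then have "nrm M 2 (\<lambda>x. f x - ev (A j) x) = nrm M 2 (\<lambda>x. f x - \<phi> j x)"
        by (rule nrm_cong_AE[OF _ borel_measurable_diff[OF in_L_measurable[OF fL] in_L_measurable[OF ev_in_L[OF A(1)]]]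
              borel_measurable_diff[OF in_L_measurable[OF fL] in_L_measurable[OF \<phi>L]]])
      then show ?thesis using nrm_minus[OF two(1), of M f "\<phi> j"] by simp
    qed
    then show ?thesis using lim by simp
  qed
  show ?thesis
  proof (intro exI[of _ B] allI impI)
    fix e :: real assume e: "e > 0"
    then have "\<forall>\<^sub>F j in sequentially. nrm M 2 (\<lambda>x. f x - ev (A j) x) ^ 2 < e\<^sup>2"
      by (intro order_tendstoD(2)[OF lim']) simp
    then obtain N' where N': "\<forall>j\<ge>N'. nrm M 2 (\<lambda>x. f x - ev (A j) x) ^ 2 < e\<^sup>2"
      unfolding eventually_sequentially by blast
    have "nrm M 2 (\<lambda>x. f x - ev (A (max N N')) x) < e"
      using N'[rule_format, of "max N N'"] e by (intro power_less_imp_less_base[of _ 2 e]) auto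
    then show "\<exists>a\<in>graded. nrm M 2 (\<lambda>x. f x - ev a x) < e \<and> nrm M 2 (ev (mul (\<lambda>n. wt n ^ k) a)) \<le> B"
      using A(1) B[of "max N N'"] by (intro bexI[of _ "A (max N N')"]) (auto simp: G_def)
  qed
qed

text \<open>The bound carries the negative tail of the geometric series so that the induction step
  reproduces it exactly.\<close>

lemma telescope_le:
  assumes u: "\<And>j::nat. u j \<in> graded" and p: "even p" "p > 0" and K: "K \<ge> 0"
    and step: "\<And>j. nrm M p (ev (mul w (gdiff (u (Suc j)) (u j)))) \<le> K / 2 ^ j"
  shows "nrm M p (ev (mul w (gdiff (u (n + k)) (u n)))) \<le> 2 * K / 2 ^ n - 2 * K / 2 ^ (n + k)"
proof (induction k)
  case 0
  have "ev (mul w (gdiff (u n) (u n))) = (\<lambda>x. 0)"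
    by (simp add: mul_gdiff ev_gdiff graded_mul u fun_eq_iff)
  then show ?case using p by (simp add: nrm_def power_0_left)
next
  case (Suc k)
  define D E where "D = mul w (gdiff (u (Suc (n + k))) (u (n + k)))" and "E = mul w (gdiff (u (n + k)) (u n))"
  have g: "D \<in> graded" "E \<in> graded" by (simp_all add: D_def E_def graded_mul graded_gdiff u)
  have "mul w (gdiff (u (n + Suc k)) (u n)) = gadd D E"
    by (simp add: D_def E_def gdiff_def gadd_def mul_def fun_eq_iff algebra_simps)
  then have "ev (mul w (gdiff (u (n + Suc k)) (u n))) = (\<lambda>x. ev D x + ev E x)"
    using ev_gadd[OF g] by auto
  then have "nrm M p (ev (mul w (gdiff (u (n + Suc k)) (u n)))) \<le> nrm M p (ev D) + nrm M p (ev E)"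
    using nrm_triangle[OF p ev_in_L[OF g(1)] ev_in_L[OF g(2)]] by simp
  also have "\<dots> \<le> K / 2 ^ (n + k) + (2 * K / 2 ^ n - 2 * K / 2 ^ (n + k))"
    using step[of "n + k"] Suc by (intro add_mono) (simp_all add: D_def E_def)
  also have "\<dots> = 2 * K / 2 ^ n - 2 * K / 2 ^ (n + Suc k)" by simp
  finally show ?case .
qed

text \<open>The construction controls (1 - L)^r, while the Sobolev norm of order r contains (1 -
  L)^(r/2); the bounded multiplier (1 - L)^(-r/2) closes the gap. The L^2 smoothness that enters has
  order 2 (r + N).\<close>

lemma sobolev_of_smooth:
  assumes U: "U \<noteq> {}" and f: "\<And>q. even q \<Longrightarrow> q > 0 \<Longrightarrow> in_L M q f"
    and smooth: "\<And>k::nat. f \<in> sobolev M H 2 (real k)"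
    and P: "even P" "P > 0" and p: "0 < p" "p \<le> real P"
  shows "f \<in> sobolev M H p (real r)"
proof -
  define N where "N = r * (P - 1) + P"
  obtain B where B: "\<And>e. e > 0 \<Longrightarrow> \<exists>a\<in>graded. nrm M 2 (\<lambda>x. f x - ev a x) < e \<and> nrm M 2 (ev (mul (\<lambda>n. wt n ^ (r + N)) a)) \<le> B"
    using sobolev_2_bounded_approximation[OF U smooth, of "r + N"] by blast
  have "\<exists>u K. (\<forall>j::nat. u j \<in> graded) \<and> (\<lambda>j. nrm M P (\<lambda>x. f x - ev (u j) x)) \<longlonglongrightarrow> 0 \<and>
    K \<ge> 0 \<and> (\<forall>j. nrm M P (ev (mul (\<lambda>n. wt n ^ r) (gdiff (u (Suc j)) (u j)))) \<le> K / 2 ^ j)"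
    by (rule smooth_approximation[OF P U f B[unfolded N_def]])
  then obtain u K where u: "\<And>j::nat. u j \<in> graded" and lim: "(\<lambda>j. nrm M P (\<lambda>x. f x - ev (u j) x)) \<longlonglongrightarrow> 0"
    and K: "K \<ge> 0" "\<And>j. nrm M P (ev (mul (\<lambda>n. wt n ^ r) (gdiff (u (Suc j)) (u j)))) \<le> K / 2 ^ j"
    by blast
  define G where "G j = mul (\<lambda>n. (1 + real n) powr (real r / 2)) (u j)" for j
  have G: "G j \<in> graded" for j by (simp add: G_def graded_mul u)
  have dec: "decomposes (ev (u j)) (u j)" for j
    by (rule decomposesI[OF u ev_in_L[OF u]]) simp
  have ou: "AE \<omega> in M. ou_pow M H (real r) (ev (u j)) \<omega> = ev (G j) \<omega>"
    and oum: "ou_pow M H (real r) (ev (u j)) \<in> borel_measurable M" for j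
    using ou_pow_AE[OF dec, of "real r" j] unfolding G_def by auto
  have tail: "nrm M P (ev (gdiff (G (n + k)) (G n))) \<le> 2 * K / 2 ^ n" for n k
  proof -
    have "gdiff (G (n + k)) (G n) = mul (\<lambda>n. (1 + real n) powr (- real r / 2)) (mul (\<lambda>n. wt n ^ r) (gdiff (u (n + k)) (u n)))"
    proof -
      have "(1 + real n) powr (- real r / 2) * wt n ^ r = (1 + real n) powr (real r / 2)" for n
      proof -
        have "wt n ^ r = (1 + real n) powr real r" by (simp add: wt_def powr_realpow add_pos_nonneg)
        then show ?thesis by (simp add: powr_add[symmetric])
      qed
      then show ?thesis unfolding G_def mul_mul mul_gdiff by simp
    qed
    then have "nrm M P (ev (gdiff (G (n + k)) (G n))) \<le> 1 * nrm M P (ev (mul (\<lambda>n. wt n ^ r) (gdiff (u (n + k)) (u n))))"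
      using Lp_multiplierD[OF Lp_multiplier_inverse_powr graded_mul[OF graded_gdiff[OF u u]] P] by simp
    also have "\<dots> \<le> 2 * K / 2 ^ n - 2 * K / 2 ^ (n + k)"
      using telescope_le[OF u P K] by simp
    also have "\<dots> \<le> 2 * K / 2 ^ n" using K by simp
    finally show ?thesis .
  qed
  have tail': "nrm M P (\<lambda>x. ou_pow M H (real r) (ev (u m)) x - ou_pow M H (real r) (ev (u n)) x) \<le> 2 * K / 2 ^ N0"
    if mn: "m \<ge> N0" "n \<ge> N0" for m n N0
  proof -
    have main: "nrm M P (\<lambda>x. ou_pow M H (real r) (ev (u m)) x - ou_pow M H (real r) (ev (u n)) x) \<le> 2 * K / 2 ^ N0"
      if "m \<ge> n" "n \<ge> N0" for m n
    proof -
      have ae: "AE x in M. ou_pow M H (real r) (ev (u m)) x - ou_pow M H (real r) (ev (u n)) x = ev (gdiff (G m) (G n)) x"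
        using ou[of m] ou[of n] by eventually_elim (simp add: ev_gdiff G)
      have "nrm M P (\<lambda>x. ou_pow M H (real r) (ev (u m)) x - ou_pow M H (real r) (ev (u n)) x) = nrm M P (ev (gdiff (G m) (G n)))"
        by (rule nrm_cong_AE[OF ae borel_measurable_diff[OF oum oum] in_L_measurable[OF ev_in_L[OF graded_gdiff[OF G G]]]])
      also have "\<dots> \<le> 2 * K / 2 ^ n" using tail[of n "m - n"] that by simp
      also have "\<dots> \<le> 2 * K / 2 ^ N0" using K that by (intro divide_left_mono) auto
      finally show ?thesis .
    qed
    show ?thesis
    proof (cases "m \<ge> n")
      case False
      then show ?thesis
        using main[of m n] mn nrm_minus[OF P(1), of M "ou_pow M H (real r) (ev (u m))" "ou_pow M H (real r) (ev (u n))"]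
        by simp
    qed (use main mn in auto)
  qed
  show ?thesis
  proof (rule sobolevI[OF P p f[OF P] _ _ lim])
    show "ev (u k) \<in> poly_functionals H" for k by (rule ev_poly_functionals[OF u])
    show "in_L M P (ou_pow M H (real r) (ev (u k)))" for k
      by (rule in_L_cong_AE[OF _ ev_in_L[OF G[of k]] oum]) (use ou[of k] in eventually_elim, simp)
    fix e :: real assume e: "e > 0"
    have z: "(\<lambda>j. 2 * K / 2 ^ j) \<longlonglongrightarrow> 0" by (rule tendsto_divide_power2)
    have "\<forall>\<^sub>F j in sequentially. 2 * K / 2 ^ j < e" using order_tendstoD(2)[OF z e] .
    then obtain N0 where "2 * K / 2 ^ N0 < e" by (auto simp: eventually_sequentially)
    then show "\<exists>N. \<forall>m\<ge>N. \<forall>n\<ge>N. nrm M P (\<lambda>x. ou_pow M H (real r) (ev (u m)) x - ou_pow M H (real r) (ev (u n)) x) \<le> e"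
      using tail' by (intro exI[of _ N0]) (meson less_imp_le order_trans)
  qed
qed

text \<open>If every element of \<open>H\<close> vanishes a.e., all the chaoses are trivial (even the zeroth one, as
  defined) and \<open>ou_pow\<close> is zero.\<close>

lemma sobolev_degenerate:
  assumes U: "U = {}" and f: "in_L M P f" and P: "even P" "P > 0" and p: "0 < p" "p \<le> real P"
  shows "f \<in> sobolev M H p r"
proof -
  have "\<forall>k::nat. \<exists>\<phi>. \<phi> \<in> poly_functionals H \<and> nrm M P (\<lambda>x. f x - \<phi> x) < 1 / real (Suc k)"
    using approxD(2)[OF in_L_approx[OF P f]] by (auto simp: Bex_def)
  from choice[OF this] obtain \<phi> where
    \<phi>: "\<forall>k. \<phi> k \<in> poly_functionals H \<and> nrm M P (\<lambda>x. f x - \<phi> k x) < 1 / real (Suc k)" ..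
  then have \<phi>P: "\<And>k. \<phi> k \<in> poly_functionals H" by blast
  note ou = ou_pow_degenerate[OF U \<phi>P, where r = r]
  have z: "in_L M P (\<lambda>x. 0)" "nrm M P (\<lambda>x. 0) = 0"
    using P by (auto simp: in_L_def nrm_def power_0_left)
  show ?thesis
  proof (rule sobolevI[OF P p f \<phi>P])
    show "in_L M P (ou_pow M H r (\<phi> k))" for k
      by (rule in_L_cong_AE[OF _ z(1) ou(1)]) (use ou(2)[of k] in eventually_elim, simp)
    have "(\<lambda>n. 1 / real (Suc n)) \<longlonglongrightarrow> 0" by (rule LIMSEQ_Suc[OF lim_1_over_n])
    then show "(\<lambda>k. nrm M P (\<lambda>x. f x - \<phi> k x)) \<longlonglongrightarrow> 0"
      by (rule tendsto_sandwich[rotated 2, OF tendsto_const])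
        (intro always_eventually allI nrm_nonneg P(1) less_imp_le[OF conjunct2[OF \<phi>[rule_format]]])+
    fix e :: real assume "e > 0"
    have "nrm M P (\<lambda>x. ou_pow M H r (\<phi> m) x - ou_pow M H r (\<phi> n) x) = 0" for m n
    proof -
      have "AE x in M. ou_pow M H r (\<phi> m) x - ou_pow M H r (\<phi> n) x = 0"
        using ou(2)[of m] ou(2)[of n] by eventually_elim simp
      from nrm_cong_AE[OF this borel_measurable_diff[OF ou(1) ou(1)]] show ?thesis using z by simp
    qed
    then show "\<exists>N. \<forall>m\<ge>N. \<forall>n\<ge>N. nrm M P (\<lambda>x. ou_pow M H r (\<phi> m) x - ou_pow M H r (\<phi> n) x) \<le> e"
      using \<open>e > 0\<close> by auto
  qed
qed

lemma sobolev_Lp: "f \<in> sobolev M H p r \<Longrightarrow> f \<in> Lp M p"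
  by (simp add: sobolev_def)

lemma D_infty_eq: "D2_infty M H \<inter> L_infty_minus_0 M = D_infty M H"
proof (intro equalityI subsetI)
  fix f assume f: "f \<in> D_infty M H"
  then have s: "f \<in> sobolev M H p (real r)" if "p > 1" for p r
    using that by (auto simp: D_infty_def)
  have "f \<in> Lp M p" if "1 \<le> p" for p
  proof (cases "p = 1")
    case True
    have "f \<in> Lp M (real 2)" using sobolev_Lp[OF s[of 2 0]] by simp
    then have "in_L M 2 f" by (subst (asm) Lp_even) auto
    from Lp_of_in_L[OF this, of 1] show ?thesis using True by simp
  next
    case False
    then show ?thesis using sobolev_Lp[OF s[of p 0]] that by simp
  qed
  then show "f \<in> D2_infty M H \<inter> L_infty_minus_0 M"
    using s[of 2] by (simp add: D2_infty_def L_infty_minus_0_def)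
next
  fix f assume f: "f \<in> D2_infty M H \<inter> L_infty_minus_0 M"
  have fL: "in_L M q f" if "even q" "q > 0" for q :: nat
  proof -
    have "f \<in> Lp M (real q)" using f that by (simp add: L_infty_minus_0_def Suc_leI)
    then show ?thesis using Lp_even[OF that] by blast
  qed
  have smooth: "f \<in> sobolev M H 2 (real k)" for k
    using f by (auto simp: D2_infty_def)
  have "f \<in> sobolev M H p (real r)" if p: "p > 1" for p r
  proof -
    obtain n :: nat where n: "p \<le> real n" using real_arch_simple by blast
    \<comment> \<open>An even integer that is at least p; p > 1 forces n > 0.\<close>
    define P where "P = 2 * n"
    have P: "even P" "P > 0" "0 < p" "p \<le> real P"
      using n p by (auto simp: P_def intro: ccontr)
    show ?thesis
    proof (cases "U = {}")
      case True
      show ?thesis by (rule sobolev_degenerate[OF True fL[OF P(1,2)] P])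
    next
      case False
      show ?thesis by (rule sobolev_of_smooth[OF False fL smooth P])
    qed
  qed
  then show "f \<in> D_infty M H" by (simp add: D_infty_def)
qed

end

theorem theorem2p5:
  fixes M :: "'a measure" and H :: "('a \<Rightarrow> real) set"
  assumes "gaussian_space M H"
  shows "D2_infty M H \<inter> L_infty_minus_0 M = D_infty M H"
proof -
  interpret prob_space M using assms by (simp add: gaussian_space_def)
  interpret gaussian M H by unfold_locales (rule assms)
  show ?thesis by (rule D_infty_eq)
qed

end
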